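(* Let $q,r,s\in\mathbb{C}\setminus\{0\}$. There exist two right-covariant $\mathbb{Z}_2$-graded first order differential calculi $(\Gamma^1,\mathsf{d})$ over the $\mathbb{Z}_2$-graded Hopf algebra ${\cal F}(\mathbb{C}_q^{2|1})$ with respect to itself such that $\{\mathsf{d}x,\mathsf{d}y,\mathsf{d}\theta\}$ is a free right ${\cal F}(\mathbb{C}_q^{2|1})$-module basis of $\Gamma^1$. Their bimodule structures are determined, respectively, by the following two systems of relations. First calculus: $$\mathsf{d}x\cdot x=r\,x\cdot\mathsf{d}x,\quad \mathsf{d}y\cdot x=r\,x\cdot\mathsf{d}y,\quad \mathsf{d}\theta\cdot x=q^{-1}r\,x\cdot\mathsf{d}\theta,$$ $$\mathsf{d}x\cdot y=y\cdot\mathsf{d}x+(r-1)x\cdot\mathsf{d}y,\quad \mathsf{d}y\cdot y=s\,y\cdot\mathsf{d}y,\quad \mathsf{d}\theta\cdot y=q^{-1}s\,y\cdot\mathsf{d}\theta,$$ $$\mathsf{d}x\cdot\theta=-q\theta\cdot\mathsf{d}x+(r-1)x\cdot\mathsf{d}\theta,\quad \mathsf{d}y\cdot\theta=-q\theta\cdot\mathsf{d}y+(s-1)y\cdot\mathsf{d}\theta,\quad \mathsf{d}\theta\cdot\theta=\theta\cdot\mathsf{d}\theta.$$ Second calculus: $$\mathsf{d}x\cdot x=r\,x\cdot\mathsf{d}x,\quad \mathsf{d}y\cdot x=x\cdot\mathsf{d}y+(s-1)y\cdot\mathsf{d}x,\quad \mathsf{d}\theta\cdot x=q^{-1}r\,x\cdot\mathsf{d}\theta,$$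 $$\mathsf{d}x\cdot y=s\,y\cdot\mathsf{d}x,\quad \mathsf{d}y\cdot y=s\,y\cdot\mathsf{d}y,\quad \mathsf{d}\theta\cdot y=q^{-1}s\,y\cdot\mathsf{d}\theta,$$ $$\mathsf{d}x\cdot\theta=-q\theta\cdot\mathsf{d}x+(r-1)x\cdot\mathsf{d}\theta,\quad \mathsf{d}y\cdot\theta=-q\theta\cdot\mathsf{d}y+(s-1)y\cdot\mathsf{d}\theta,\quad \mathsf{d}\theta\cdot\theta=\theta\cdot\mathsf{d}\theta.$$
   Context: ${\cal F}={\cal F}(\mathbb{C}_q^{2|1})$ is the unital associative $\mathbb{Z}_2$-graded $\mathbb{C}$-algebra generated by even $x,y$, their inverses $x^{-1},y^{-1}$, and odd $\theta$, with relations $xy=yx$, $x\theta=q\theta x$, $y\theta=q\theta y$, $\theta^2=0$. It is a $\mathbb{Z}_2$-graded Hopf algebra with $\Delta(x)=x\otimes x$, $\Delta(y)=y\otimes y$, $\Delta(\theta)=\theta\otimes x^{-1}y+\mathbf 1\otimes\theta$, $\epsilon(x)=\epsilon(y)=1$, $\epsilon(\theta)=0$; tensor products of graded objects use the sign rule $(a_1\otimes a_2)(b_1\otimes b_2)=(-1)^{p(a_2)p(b_1)}a_1b_1\otimes a_2b_2$, $p$ = parity. A first order $\mathbb{Z}_2$-graded differential calculus over a $\mathbb{Z}_2$-graded algebra ${\cal A}$ is a pair $(\Gamma,\mathsf d)$, $\Gamma$ an ${\cal A}$-bimodule and $\mathsf d:{\cal A}\to\Gamma$ linear with $\mathsf d(ab)=(\mathsf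 da)\cdot b+(-1)^{p(a)}a\cdot\mathsf db$, such that $\Gamma=\mathrm{Lin}\{a\cdot\mathsf db: a,b\in{\cal A}\}$; parities satisfy $p(\mathsf da)=p(a)+1$ mod 2 (so $\mathsf dx,\mathsf dy$ are odd and $\mathsf d\theta$ is even). A calculus over a $\mathbb{Z}_2$-graded Hopf algebra ${\cal H}$ is right-covariant if there is a linear map $\Delta_R:\Gamma\to\Gamma\otimes{\cal H}$ with $\Delta_R(a\cdot\mathsf db)=\Delta(a)(\mathsf d\otimes\mathrm{id})\Delta(b)$ for all $a,b\in{\cal H}$. The bimodule $\Gamma^1$ is taken to be generated as a free left ${\cal F}$-module by $\mathsf dx,\mathsf dy,\mathsf d\theta$.
   Formalization: For r = s = 1 the two systems of relations coincide and define the same calculus, so that the two calculi are different (non-isomorphic) is asserted only for (r, s) ≠ (1, 1); all other claims hold for all nonzero q, r, s. *)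

theory Defs
  imports
    "HOL-Algebra.Algebraic_Closure_Type"
    "HOL-Algebra.QuotRing"
    "HOL-Library.Poly_Mapping"
    "HOL-Library.Z2"
begin

section \<open>Super vector spaces and superalgebras over the complex numbers\<close>

text \<open>
  Parities live in the two-element field \<^typ>\<open>bit\<close>. As for HOL-Algebra modules,
  the fields \<^const>\<open>monoid.mult\<close> and \<^const>\<open>one\<close> carry information only for algebras.
\<close>

record 'v superspace = "(complex, 'v) module" +
  homog :: "bit \<Rightarrow> 'v set"

abbreviation complex_ring :: "complex ring" where
  "complex_ring \<equiv> ring_of_type_algebra"

definition parity_sign :: "bit \<Rightarrow> complex" where
  "parity_sign i = (if i = 0 then 1 else - 1)"

definition lin_span :: "(complex, 'v, 'x) module_scheme \<Rightarrow> 'v set \<Rightarrow> 'v set" where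
  "lin_span V S = (\<lambda>N. submodule N complex_ring V) hull S"

definition linear_map ::
    "(complex, 'v, 'x) module_scheme \<Rightarrow> (complex, 'w, 'y) module_scheme \<Rightarrow> ('v \<Rightarrow> 'w) \<Rightarrow> bool" where
  "linear_map V W f \<longleftrightarrow>
     f \<in> carrier V \<rightarrow> carrier W \<and>
     (\<forall>u\<in>carrier V. \<forall>v\<in>carrier V. f (u \<oplus>\<^bsub>V\<^esub> v) = f u \<oplus>\<^bsub>W\<^esub> f v) \<and>
     (\<forall>c. \<forall>v\<in>carrier V. f (c \<odot>\<^bsub>V\<^esub> v) = c \<odot>\<^bsub>W\<^esub> f v)"

locale super_vector_space = module complex_ring V for V :: "('v, 'x) superspace_scheme" +
  assumes homog_submodule: "submodule (homog V i) complex_ring V"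
    and homog_decomposition: "v \<in> carrier V \<Longrightarrow>
      \<exists>!p. fst p \<in> homog V 0 \<and> snd p \<in> homog V 1 \<and> v = fst p \<oplus>\<^bsub>V\<^esub> snd p"

definition homog_part :: "('v, 'x) superspace_scheme \<Rightarrow> bit \<Rightarrow> 'v \<Rightarrow> 'v" where
  "homog_part V i v = (THE u. u \<in> homog V i \<and> (\<exists>w\<in>homog V (i + 1). v = u \<oplus>\<^bsub>V\<^esub> w))"

locale superalgebra = super_vector_space A + ring A for A :: "('a, 'x) superspace_scheme" +
  assumes smult_mult_left: "\<lbrakk>a \<in> carrier A; b \<in> carrier A\<rbrakk> \<Longrightarrow>
      (c \<odot>\<^bsub>A\<^esub> a) \<otimes>\<^bsub>A\<^esub> b = c \<odot>\<^bsub>A\<^esub> (a \<otimes>\<^bsub>A\<^esub> b)"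
    and smult_mult_right: "\<lbrakk>a \<in> carrier A; b \<in> carrier A\<rbrakk> \<Longrightarrow>
      a \<otimes>\<^bsub>A\<^esub> (c \<odot>\<^bsub>A\<^esub> b) = c \<odot>\<^bsub>A\<^esub> (a \<otimes>\<^bsub>A\<^esub> b)"
    and homog_one: "\<one>\<^bsub>A\<^esub> \<in> homog A 0"
    and homog_mult: "\<lbrakk>a \<in> homog A i; b \<in> homog A j\<rbrakk> \<Longrightarrow> a \<otimes>\<^bsub>A\<^esub> b \<in> homog A (i + j)"


section \<open>Tensor products\<close>

text \<open>
  The tensor product of \<open>V\<close> and \<open>W\<close> is the free vector space on
  \<open>carrier V \<times> carrier W\<close> modulo the subspace spanned by the bilinearity relations;
  its elements are cosets.
\<close>

definition tensor_free ::
    "(complex, 'v, 'x) module_scheme \<Rightarrow> (complex, 'w, 'y) module_scheme \<Rightarrow>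
     (complex, 'v \<times> 'w \<Rightarrow>\<^sub>0 complex) module" where
  "tensor_free V W =
     \<lparr>carrier = {p. Poly_Mapping.keys p \<subseteq> carrier V \<times> carrier W},
      monoid.mult = undefined, one = undefined, ring.zero = 0, add = (+),
      module.smult = (\<lambda>c. Poly_Mapping.map ((*) c))\<rparr>"

definition tensor_relators ::
    "(complex, 'v, 'x) module_scheme \<Rightarrow> (complex, 'w, 'y) module_scheme \<Rightarrow>
     ('v \<times> 'w \<Rightarrow>\<^sub>0 complex) set" where
  "tensor_relators V W =
     {Poly_Mapping.single (v \<oplus>\<^bsub>V\<^esub> v', w) 1 - Poly_Mapping.single (v, w) 1
        - Poly_Mapping.single (v', w) 1
      | v v' w. v \<in> carrier V \<and> v' \<in> carrier V \<and> w \<in> carrier W} \<union>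
     {Poly_Mapping.single (v, w \<oplus>\<^bsub>W\<^esub> w') 1 - Poly_Mapping.single (v, w) 1
        - Poly_Mapping.single (v, w') 1
      | v w w'. v \<in> carrier V \<and> w \<in> carrier W \<and> w' \<in> carrier W} \<union>
     {Poly_Mapping.single (c \<odot>\<^bsub>V\<^esub> v, w) 1 - Poly_Mapping.single (v, w) c
      | c v w. v \<in> carrier V \<and> w \<in> carrier W} \<union>
     {Poly_Mapping.single (v, c \<odot>\<^bsub>W\<^esub> w) 1 - Poly_Mapping.single (v, w) c
      | c v w. v \<in> carrier V \<and> w \<in> carrier W}"

definition tensor_class ::
    "(complex, 'v, 'x) module_scheme \<Rightarrow> (complex, 'w, 'y) module_scheme \<Rightarrow>
     ('v \<times> 'w \<Rightarrow>\<^sub>0 complex) \<Rightarrow> ('v \<times> 'w \<Rightarrow>\<^sub>0 complex) set" where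
  "tensor_class V W p =
     lin_span (tensor_free V W) (tensor_relators V W) +>\<^bsub>tensor_free V W\<^esub> p"

definition pure_tensor ::
    "(complex, 'v, 'x) module_scheme \<Rightarrow> (complex, 'w, 'y) module_scheme \<Rightarrow>
     'v \<Rightarrow> 'w \<Rightarrow> ('v \<times> 'w \<Rightarrow>\<^sub>0 complex) set" where
  "pure_tensor V W v w = tensor_class V W (Poly_Mapping.single (v, w) 1)"

definition tensor_space ::
    "(complex, 'v, 'x) module_scheme \<Rightarrow> (complex, 'w, 'y) module_scheme \<Rightarrow>
     (complex, ('v \<times> 'w \<Rightarrow>\<^sub>0 complex) set) module" where
  "tensor_space V W =
     \<lparr>carrier = tensor_class V W ` carrier (tensor_free V W),
      monoid.mult = undefined, one = undefined,
      ring.zero = tensor_class V W 0,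
      add = set_add (tensor_free V W),
      module.smult = (\<lambda>c S. \<Union>p\<in>S. tensor_class V W (Poly_Mapping.map ((*) c) p))\<rparr>"

text \<open>\<open>f \<otimes> g\<close> for linear \<open>f\<close> into \<open>V\<close> and \<open>g\<close> into \<open>W\<close>, as a map on cosets.\<close>

definition tensor_map ::
    "(complex, 'v, 'x) module_scheme \<Rightarrow> (complex, 'w, 'y) module_scheme \<Rightarrow>
     ('a \<Rightarrow> 'v) \<Rightarrow> ('b \<Rightarrow> 'w) \<Rightarrow>
     ('a \<times> 'b \<Rightarrow>\<^sub>0 complex) set \<Rightarrow> ('v \<times> 'w \<Rightarrow>\<^sub>0 complex) set" where
  "tensor_map V W f g S =
     (\<Union>p\<in>S. tensor_class V W
        (\<Sum>(a, b)\<in>Poly_Mapping.keys p.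
           Poly_Mapping.single (f a, g b) (Poly_Mapping.lookup p (a, b))))"

text \<open>
  The bilinear extension of
  \<open>(a1 \<otimes> a2)(b1 \<otimes> b2) = (-1)^(p(a2) p(b1)) f a1 b1 \<otimes> g a2 b2\<close>, where \<open>f\<close> and \<open>g\<close>
  are bilinear with values in \<open>V\<close> and \<open>W\<close>. The superspaces \<open>P\<close> (containing \<open>a2\<close>) and
  \<open>Q\<close> (containing \<open>b1\<close>) supply the parities; inhomogeneous \<open>a2\<close> and \<open>b1\<close> are split into
  their homogeneous parts.
\<close>

definition koszul_product ::
    "('p, 'x) superspace_scheme \<Rightarrow> ('q, 'y) superspace_scheme \<Rightarrow>
     (complex, 'v, 'z) module_scheme \<Rightarrow> (complex, 'w, 'u) module_scheme \<Rightarrow>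
     ('a \<Rightarrow> 'q \<Rightarrow> 'v) \<Rightarrow> ('p \<Rightarrow> 'b \<Rightarrow> 'w) \<Rightarrow>
     ('a \<times> 'p \<Rightarrow>\<^sub>0 complex) set \<Rightarrow> ('q \<times> 'b \<Rightarrow>\<^sub>0 complex) set \<Rightarrow>
     ('v \<times> 'w \<Rightarrow>\<^sub>0 complex) set" where
  "koszul_product P Q V W f g S T =
     (\<Union>s\<in>S. \<Union>t\<in>T. tensor_class V W
        (\<Sum>(a1, a2)\<in>Poly_Mapping.keys s. \<Sum>(b1, b2)\<in>Poly_Mapping.keys t.
         \<Sum>i\<in>{0, 1}. \<Sum>j\<in>{0, 1}.
           Poly_Mapping.single (f a1 (homog_part Q j b1), g (homog_part P i a2) b2)
             (parity_sign (i * j) * Poly_Mapping.lookup s (a1, a2)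
                * Poly_Mapping.lookup t (b1, b2))))"

definition tensor_algebra ::
    "('a, 'x) superspace_scheme \<Rightarrow> ('b, 'y) superspace_scheme \<Rightarrow>
     (complex, ('a \<times> 'b \<Rightarrow>\<^sub>0 complex) set) module" where
  "tensor_algebra A B =
     (tensor_space A B)
       \<lparr>monoid.mult := koszul_product B A A B (monoid.mult A) (monoid.mult B),
        one := pure_tensor A B \<one>\<^bsub>A\<^esub> \<one>\<^bsub>B\<^esub>\<rparr>"


section \<open>First order graded differential calculi\<close>

record ('a, 'v) superbimodule = "'v superspace" +
  lact :: "'a \<Rightarrow> 'v \<Rightarrow> 'v" (infixr \<open>\<triangleright>\<index>\<close> 75)
  ract :: "'v \<Rightarrow> 'a \<Rightarrow> 'v" (infixl \<open>\<triangleleft>\<index>\<close> 75)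

locale super_bimodule = superalgebra A + M?: super_vector_space M
  for A :: "('a, 'x) superspace_scheme" and M :: "('a, 'v, 'y) superbimodule_scheme" +
  assumes lact_closed: "\<lbrakk>a \<in> carrier A; m \<in> carrier M\<rbrakk> \<Longrightarrow> a \<triangleright>\<^bsub>M\<^esub> m \<in> carrier M"
    and lact_add_left: "\<lbrakk>a \<in> carrier A; b \<in> carrier A; m \<in> carrier M\<rbrakk> \<Longrightarrow>
      (a \<oplus>\<^bsub>A\<^esub> b) \<triangleright>\<^bsub>M\<^esub> m = (a \<triangleright>\<^bsub>M\<^esub> m) \<oplus>\<^bsub>M\<^esub> (b \<triangleright>\<^bsub>M\<^esub> m)"
    and lact_add_right: "\<lbrakk>a \<in> carrier A; m \<in> carrier M; n \<in> carrier M\<rbrakk> \<Longrightarrow>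
      a \<triangleright>\<^bsub>M\<^esub> (m \<oplus>\<^bsub>M\<^esub> n) = (a \<triangleright>\<^bsub>M\<^esub> m) \<oplus>\<^bsub>M\<^esub> (a \<triangleright>\<^bsub>M\<^esub> n)"
    and lact_smult_left: "\<lbrakk>a \<in> carrier A; m \<in> carrier M\<rbrakk> \<Longrightarrow>
      (c \<odot>\<^bsub>A\<^esub> a) \<triangleright>\<^bsub>M\<^esub> m = c \<odot>\<^bsub>M\<^esub> (a \<triangleright>\<^bsub>M\<^esub> m)"
    and lact_smult_right: "\<lbrakk>a \<in> carrier A; m \<in> carrier M\<rbrakk> \<Longrightarrow>
      a \<triangleright>\<^bsub>M\<^esub> (c \<odot>\<^bsub>M\<^esub> m) = c \<odot>\<^bsub>M\<^esub> (a \<triangleright>\<^bsub>M\<^esub> m)"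
    and lact_one: "m \<in> carrier M \<Longrightarrow> \<one>\<^bsub>A\<^esub> \<triangleright>\<^bsub>M\<^esub> m = m"
    and lact_mult: "\<lbrakk>a \<in> carrier A; b \<in> carrier A; m \<in> carrier M\<rbrakk> \<Longrightarrow>
      (a \<otimes>\<^bsub>A\<^esub> b) \<triangleright>\<^bsub>M\<^esub> m = a \<triangleright>\<^bsub>M\<^esub> (b \<triangleright>\<^bsub>M\<^esub> m)"
    and ract_closed: "\<lbrakk>a \<in> carrier A; m \<in> carrier M\<rbrakk> \<Longrightarrow> m \<triangleleft>\<^bsub>M\<^esub> a \<in> carrier M"
    and ract_add_left: "\<lbrakk>a \<in> carrier A; m \<in> carrier M; n \<in> carrier M\<rbrakk> \<Longrightarrow>
      (m \<oplus>\<^bsub>M\<^esub> n) \<triangleleft>\<^bsub>M\<^esub> a = (m \<triangleleft>\<^bsub>M\<^esub> a) \<oplus>\<^bsub>M\<^esub> (n \<triangleleft>\<^bsub>M\<^esub> a)"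
    and ract_add_right: "\<lbrakk>a \<in> carrier A; b \<in> carrier A; m \<in> carrier M\<rbrakk> \<Longrightarrow>
      m \<triangleleft>\<^bsub>M\<^esub> (a \<oplus>\<^bsub>A\<^esub> b) = (m \<triangleleft>\<^bsub>M\<^esub> a) \<oplus>\<^bsub>M\<^esub> (m \<triangleleft>\<^bsub>M\<^esub> b)"
    and ract_smult_left: "\<lbrakk>a \<in> carrier A; m \<in> carrier M\<rbrakk> \<Longrightarrow>
      (c \<odot>\<^bsub>M\<^esub> m) \<triangleleft>\<^bsub>M\<^esub> a = c \<odot>\<^bsub>M\<^esub> (m \<triangleleft>\<^bsub>M\<^esub> a)"
    and ract_smult_right: "\<lbrakk>a \<in> carrier A; m \<in> carrier M\<rbrakk> \<Longrightarrow>
      m \<triangleleft>\<^bsub>M\<^esub> (c \<odot>\<^bsub>A\<^esub> a) = c \<odot>\<^bsub>M\<^esub> (m \<triangleleft>\<^bsub>M\<^esub> a)"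
    and ract_one: "m \<in> carrier M \<Longrightarrow> m \<triangleleft>\<^bsub>M\<^esub> \<one>\<^bsub>A\<^esub> = m"
    and ract_mult: "\<lbrakk>a \<in> carrier A; b \<in> carrier A; m \<in> carrier M\<rbrakk> \<Longrightarrow>
      m \<triangleleft>\<^bsub>M\<^esub> (a \<otimes>\<^bsub>A\<^esub> b) = (m \<triangleleft>\<^bsub>M\<^esub> a) \<triangleleft>\<^bsub>M\<^esub> b"
    and lact_ract: "\<lbrakk>a \<in> carrier A; b \<in> carrier A; m \<in> carrier M\<rbrakk> \<Longrightarrow>
      (a \<triangleright>\<^bsub>M\<^esub> m) \<triangleleft>\<^bsub>M\<^esub> b = a \<triangleright>\<^bsub>M\<^esub> (m \<triangleleft>\<^bsub>M\<^esub> b)"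
    and homog_lact: "\<lbrakk>a \<in> homog A i; m \<in> homog M j\<rbrakk> \<Longrightarrow> a \<triangleright>\<^bsub>M\<^esub> m \<in> homog M (i + j)"
    and homog_ract: "\<lbrakk>m \<in> homog M i; a \<in> homog A j\<rbrakk> \<Longrightarrow> m \<triangleleft>\<^bsub>M\<^esub> a \<in> homog M (i + j)"

locale super_fodc = super_bimodule A \<Gamma>
  for A :: "('a, 'x) superspace_scheme" and \<Gamma> :: "('a, 'v, 'y) superbimodule_scheme" +
  fixes d :: "'a \<Rightarrow> 'v"
  assumes diff_linear: "linear_map A \<Gamma> d"
    and diff_parity: "a \<in> homog A i \<Longrightarrow> d a \<in> homog \<Gamma> (i + 1)"
    and graded_Leibniz: "\<lbrakk>a \<in> homog A i; b \<in> carrier A\<rbrakk> \<Longrightarrow>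
      d (a \<otimes>\<^bsub>A\<^esub> b) = (d a \<triangleleft>\<^bsub>\<Gamma>\<^esub> b) \<oplus>\<^bsub>\<Gamma>\<^esub> (parity_sign i \<odot>\<^bsub>\<Gamma>\<^esub> (a \<triangleright>\<^bsub>\<Gamma>\<^esub> d b))"
    and diff_generates:
      "carrier \<Gamma> = lin_span \<Gamma> {a \<triangleright>\<^bsub>\<Gamma>\<^esub> d b | a b. a \<in> carrier A \<and> b \<in> carrier A}"

definition right_covariant ::
    "('a, 'x) superspace_scheme \<Rightarrow> ('a \<Rightarrow> ('a \<times> 'a \<Rightarrow>\<^sub>0 complex) set) \<Rightarrow>
     ('a, 'v, 'y) superbimodule_scheme \<Rightarrow> ('a \<Rightarrow> 'v) \<Rightarrow> bool" where
  "right_covariant A \<Delta> \<Gamma> d \<longleftrightarrow>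
     (\<exists>\<Delta>R. linear_map \<Gamma> (tensor_space \<Gamma> A) \<Delta>R \<and>
        (\<forall>a\<in>carrier A. \<forall>b\<in>carrier A.
           \<Delta>R (a \<triangleright>\<^bsub>\<Gamma>\<^esub> d b) =
             koszul_product A \<Gamma> \<Gamma> A (lact \<Gamma>) (monoid.mult A)
               (\<Delta> a) (tensor_map \<Gamma> A d id (\<Delta> b))))"

definition free_right_basis ::
    "('a, 'x) superspace_scheme \<Rightarrow> ('a, 'v, 'y) superbimodule_scheme \<Rightarrow> 'v list \<Rightarrow> bool" where
  "free_right_basis A \<Gamma> bs \<longleftrightarrow>
     set bs \<subseteq> carrier \<Gamma> \<and>
     (\<forall>\<omega>\<in>carrier \<Gamma>. \<exists>!c. c \<in> {..<length bs} \<rightarrow>\<^sub>E carrier A \<and>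
        \<omega> = (\<Oplus>\<^bsub>\<Gamma>\<^esub>k\<in>{..<length bs}. (bs ! k) \<triangleleft>\<^bsub>\<Gamma>\<^esub> c k))"

definition free_left_basis ::
    "('a, 'x) superspace_scheme \<Rightarrow> ('a, 'v, 'y) superbimodule_scheme \<Rightarrow> 'v list \<Rightarrow> bool" where
  "free_left_basis A \<Gamma> bs \<longleftrightarrow>
     set bs \<subseteq> carrier \<Gamma> \<and>
     (\<forall>\<omega>\<in>carrier \<Gamma>. \<exists>!c. c \<in> {..<length bs} \<rightarrow>\<^sub>E carrier A \<and>
        \<omega> = (\<Oplus>\<^bsub>\<Gamma>\<^esub>k\<in>{..<length bs}. c k \<triangleright>\<^bsub>\<Gamma>\<^esub> (bs ! k)))"

definition calculus_isomorphic ::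
    "('a, 'x) superspace_scheme \<Rightarrow>
     ('a, 'v, 'y) superbimodule_scheme \<Rightarrow> ('a \<Rightarrow> 'v) \<Rightarrow>
     ('a, 'w, 'z) superbimodule_scheme \<Rightarrow> ('a \<Rightarrow> 'w) \<Rightarrow> bool" where
  "calculus_isomorphic A \<Gamma> d \<Gamma>' d' \<longleftrightarrow>
     (\<exists>\<phi>. bij_betw \<phi> (carrier \<Gamma>) (carrier \<Gamma>') \<and> linear_map \<Gamma> \<Gamma>' \<phi> \<and>
        (\<forall>i. \<phi> ` homog \<Gamma> i = homog \<Gamma>' i) \<and>
        (\<forall>a\<in>carrier A. \<forall>\<omega>\<in>carrier \<Gamma>.
           \<phi> (a \<triangleright>\<^bsub>\<Gamma>\<^esub> \<omega>) = a \<triangleright>\<^bsub>\<Gamma>'\<^esub> \<phi> \<omega> \<and> \<phi> (\<omega> \<triangleleft>\<^bsub>\<Gamma>\<^esub> a) = \<phi> \<omega> \<triangleleft>\<^bsub>\<Gamma>'\<^esub> a) \<and>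
        (\<forall>a\<in>carrier A. \<phi> (d a) = d' a))"


section \<open>The free algebra on the generators\<close>

datatype gen = GX | GY | GXinv | GYinv | GTheta

text \<open>
  Words are given their own type so that concatenation can be its addition; the free algebra
  is then the monoid algebra \<open>word \<Rightarrow>\<^sub>0 complex\<close> with the convolution product of
  \<open>Poly_Mapping\<close>.
\<close>

datatype word = Word (letters: "gen list")

instantiation word :: monoid_add
begin

definition zero_word :: word where "0 = Word []"

definition plus_word :: "word \<Rightarrow> word \<Rightarrow> word" where
  "u + v = Word (letters u @ letters v)"

instance by standard (simp_all add: zero_word_def plus_word_def)

end

type_synonym ncpoly = "word \<Rightarrow>\<^sub>0 complex"

definition free_algebra :: "(complex, ncpoly) module" where
  "free_algebra =
     \<lparr>carrier = UNIV, monoid.mult = (*), one = 1, ring.zero = 0, add = (+),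
      module.smult = (\<lambda>c. Poly_Mapping.map ((*) c))\<rparr>"

definition word_parity :: "word \<Rightarrow> bit" where
  "word_parity w = of_nat (count_list (letters w) GTheta)"

definition nc_monom :: "gen list \<Rightarrow> ncpoly" where
  "nc_monom gs = Poly_Mapping.single (Word gs) 1"

definition nc_eval :: "(complex, 'a, 'x) module_scheme \<Rightarrow> (gen \<Rightarrow> 'a) \<Rightarrow> ncpoly \<Rightarrow> 'a" where
  "nc_eval A \<gamma> p =
     (\<Oplus>\<^bsub>A\<^esub>w\<in>Poly_Mapping.keys p.
        Poly_Mapping.lookup p w \<odot>\<^bsub>A\<^esub> foldr (\<lambda>g a. \<gamma> g \<otimes>\<^bsub>A\<^esub> a) (letters w) \<one>\<^bsub>A\<^esub>)"


section \<open>The function algebra of the quantum superspace\<close>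

definition qsp_relators :: "complex \<Rightarrow> ncpoly set" where
  "qsp_relators q =
     {nc_monom [GX, GXinv] - 1, nc_monom [GXinv, GX] - 1,
      nc_monom [GY, GYinv] - 1, nc_monom [GYinv, GY] - 1,
      nc_monom [GX, GY] - nc_monom [GY, GX],
      nc_monom [GX, GTheta] - q \<odot>\<^bsub>free_algebra\<^esub> nc_monom [GTheta, GX],
      nc_monom [GY, GTheta] - q \<odot>\<^bsub>free_algebra\<^esub> nc_monom [GTheta, GY],
      nc_monom [GTheta, GTheta]}"

definition qsp_ideal :: "complex \<Rightarrow> ncpoly set" where
  "qsp_ideal q = genideal free_algebra (qsp_relators q)"

definition qsp_class :: "complex \<Rightarrow> ncpoly \<Rightarrow> ncpoly set" where
  "qsp_class q p = qsp_ideal q +>\<^bsub>free_algebra\<^esub> p"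

definition qsp :: "complex \<Rightarrow> ncpoly set superspace" where
  "qsp q =
     \<lparr>carrier = carrier (free_algebra Quot qsp_ideal q),
      monoid.mult = monoid.mult (free_algebra Quot qsp_ideal q),
      one = one (free_algebra Quot qsp_ideal q),
      ring.zero = ring.zero (free_algebra Quot qsp_ideal q),
      add = add (free_algebra Quot qsp_ideal q),
      module.smult = (\<lambda>c S. \<Union>p\<in>S. qsp_class q (c \<odot>\<^bsub>free_algebra\<^esub> p)),
      homog = (\<lambda>i. qsp_class q ` {p. \<forall>w\<in>Poly_Mapping.keys p. word_parity w = i})\<rparr>"

definition qsp_gen :: "complex \<Rightarrow> gen \<Rightarrow> ncpoly set" where
  "qsp_gen q g = qsp_class q (nc_monom [g])"

fun qsp_comult_gen :: "complex \<Rightarrow> gen \<Rightarrow> (ncpoly set \<times> ncpoly set \<Rightarrow>\<^sub>0 complex) set" where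
  "qsp_comult_gen q GTheta =
     pure_tensor (qsp q) (qsp q) (qsp_gen q GTheta) (qsp_gen q GXinv \<otimes>\<^bsub>qsp q\<^esub> qsp_gen q GY)
       \<oplus>\<^bsub>tensor_algebra (qsp q) (qsp q)\<^esub>
     pure_tensor (qsp q) (qsp q) \<one>\<^bsub>qsp q\<^esub> (qsp_gen q GTheta)"
| "qsp_comult_gen q g = pure_tensor (qsp q) (qsp q) (qsp_gen q g) (qsp_gen q g)"

text \<open>
  The algebra homomorphism with the prescribed values on the generators. Evaluation at
  those values is constant on each coset of the defining ideal.
\<close>

definition qsp_comult :: "complex \<Rightarrow> ncpoly set \<Rightarrow> (ncpoly set \<times> ncpoly set \<Rightarrow>\<^sub>0 complex) set" where
  "qsp_comult q S =
     the_elem (nc_eval (tensor_algebra (qsp q) (qsp q)) (qsp_comult_gen q) ` S)"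

definition qsp_differentials :: "complex \<Rightarrow> (ncpoly set \<Rightarrow> 'v) \<Rightarrow> 'v list" where
  "qsp_differentials q d = [d (qsp_gen q GX), d (qsp_gen q GY), d (qsp_gen q GTheta)]"


section \<open>The two systems of commutation relations\<close>

definition first_relations ::
    "complex \<Rightarrow> complex \<Rightarrow> complex \<Rightarrow> (ncpoly set, 'v) superbimodule \<Rightarrow>
     (ncpoly set \<Rightarrow> 'v) \<Rightarrow> bool" where
  "first_relations q r s \<Gamma> d \<longleftrightarrow>
     (let x = qsp_gen q GX; y = qsp_gen q GY; \<theta> = qsp_gen q GTheta in
       d x \<triangleleft>\<^bsub>\<Gamma>\<^esub> x = r \<odot>\<^bsub>\<Gamma>\<^esub> (x \<triangleright>\<^bsub>\<Gamma>\<^esub> d x) \<and>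
       d y \<triangleleft>\<^bsub>\<Gamma>\<^esub> x = r \<odot>\<^bsub>\<Gamma>\<^esub> (x \<triangleright>\<^bsub>\<Gamma>\<^esub> d y) \<and>
       d \<theta> \<triangleleft>\<^bsub>\<Gamma>\<^esub> x = (inverse q * r) \<odot>\<^bsub>\<Gamma>\<^esub> (x \<triangleright>\<^bsub>\<Gamma>\<^esub> d \<theta>) \<and>
       d x \<triangleleft>\<^bsub>\<Gamma>\<^esub> y = (y \<triangleright>\<^bsub>\<Gamma>\<^esub> d x) \<oplus>\<^bsub>\<Gamma>\<^esub> ((r - 1) \<odot>\<^bsub>\<Gamma>\<^esub> (x \<triangleright>\<^bsub>\<Gamma>\<^esub> d y)) \<and>
       d y \<triangleleft>\<^bsub>\<Gamma>\<^esub> y = s \<odot>\<^bsub>\<Gamma>\<^esub> (y \<triangleright>\<^bsub>\<Gamma>\<^esub> d y) \<and>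
       d \<theta> \<triangleleft>\<^bsub>\<Gamma>\<^esub> y = (inverse q * s) \<odot>\<^bsub>\<Gamma>\<^esub> (y \<triangleright>\<^bsub>\<Gamma>\<^esub> d \<theta>) \<and>
       d x \<triangleleft>\<^bsub>\<Gamma>\<^esub> \<theta> = ((- q) \<odot>\<^bsub>\<Gamma>\<^esub> (\<theta> \<triangleright>\<^bsub>\<Gamma>\<^esub> d x)) \<oplus>\<^bsub>\<Gamma>\<^esub> ((r - 1) \<odot>\<^bsub>\<Gamma>\<^esub> (x \<triangleright>\<^bsub>\<Gamma>\<^esub> d \<theta>)) \<and>
       d y \<triangleleft>\<^bsub>\<Gamma>\<^esub> \<theta> = ((- q) \<odot>\<^bsub>\<Gamma>\<^esub> (\<theta> \<triangleright>\<^bsub>\<Gamma>\<^esub> d y)) \<oplus>\<^bsub>\<Gamma>\<^esub> ((s - 1) \<odot>\<^bsub>\<Gamma>\<^esub> (y \<triangleright>\<^bsub>\<Gamma>\<^esub> d \<theta>)) \<and>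
       d \<theta> \<triangleleft>\<^bsub>\<Gamma>\<^esub> \<theta> = \<theta> \<triangleright>\<^bsub>\<Gamma>\<^esub> d \<theta>)"

definition second_relations ::
    "complex \<Rightarrow> complex \<Rightarrow> complex \<Rightarrow> (ncpoly set, 'v) superbimodule \<Rightarrow>
     (ncpoly set \<Rightarrow> 'v) \<Rightarrow> bool" where
  "second_relations q r s \<Gamma> d \<longleftrightarrow>
     (let x = qsp_gen q GX; y = qsp_gen q GY; \<theta> = qsp_gen q GTheta in
       d x \<triangleleft>\<^bsub>\<Gamma>\<^esub> x = r \<odot>\<^bsub>\<Gamma>\<^esub> (x \<triangleright>\<^bsub>\<Gamma>\<^esub> d x) \<and>
       d y \<triangleleft>\<^bsub>\<Gamma>\<^esub> x = (x \<triangleright>\<^bsub>\<Gamma>\<^esub> d y) \<oplus>\<^bsub>\<Gamma>\<^esub> ((s - 1) \<odot>\<^bsub>\<Gamma>\<^esub> (y \<triangleright>\<^bsub>\<Gamma>\<^esub> d x)) \<and>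
       d \<theta> \<triangleleft>\<^bsub>\<Gamma>\<^esub> x = (inverse q * r) \<odot>\<^bsub>\<Gamma>\<^esub> (x \<triangleright>\<^bsub>\<Gamma>\<^esub> d \<theta>) \<and>
       d x \<triangleleft>\<^bsub>\<Gamma>\<^esub> y = s \<odot>\<^bsub>\<Gamma>\<^esub> (y \<triangleright>\<^bsub>\<Gamma>\<^esub> d x) \<and>
       d y \<triangleleft>\<^bsub>\<Gamma>\<^esub> y = s \<odot>\<^bsub>\<Gamma>\<^esub> (y \<triangleright>\<^bsub>\<Gamma>\<^esub> d y) \<and>
       d \<theta> \<triangleleft>\<^bsub>\<Gamma>\<^esub> y = (inverse q * s) \<odot>\<^bsub>\<Gamma>\<^esub> (y \<triangleright>\<^bsub>\<Gamma>\<^esub> d \<theta>) \<and>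
       d x \<triangleleft>\<^bsub>\<Gamma>\<^esub> \<theta> = ((- q) \<odot>\<^bsub>\<Gamma>\<^esub> (\<theta> \<triangleright>\<^bsub>\<Gamma>\<^esub> d x)) \<oplus>\<^bsub>\<Gamma>\<^esub> ((r - 1) \<odot>\<^bsub>\<Gamma>\<^esub> (x \<triangleright>\<^bsub>\<Gamma>\<^esub> d \<theta>)) \<and>
       d y \<triangleleft>\<^bsub>\<Gamma>\<^esub> \<theta> = ((- q) \<odot>\<^bsub>\<Gamma>\<^esub> (\<theta> \<triangleright>\<^bsub>\<Gamma>\<^esub> d y)) \<oplus>\<^bsub>\<Gamma>\<^esub> ((s - 1) \<odot>\<^bsub>\<Gamma>\<^esub> (y \<triangleright>\<^bsub>\<Gamma>\<^esub> d \<theta>)) \<and>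
       d \<theta> \<triangleleft>\<^bsub>\<Gamma>\<^esub> \<theta> = \<theta> \<triangleright>\<^bsub>\<Gamma>\<^esub> d \<theta>)"

end

theory Submission
  imports Defs
begin

text \<open>
  A bimodule that is free as a left module on \<open>dx, dy, d\<theta>\<close> is the same as a homomorphism from
  \<open>A = F(C_q^{2|1})\<close> to \<open>3 \<times> 3\<close> matrices over \<open>A\<close>, and a differential on it amounts to an
  extension to \<open>4 \<times> 4\<close> matrices. Such a homomorphism is given on the generators, so everything
  reduces to the defining relations of \<open>A\<close>, which are verified by rewriting to the normal form
  \<open>\<theta>^k x^i y^j\<close>. The matrices are triangular with automorphisms of \<open>A\<close> on the diagonal, hence
  \<open>dx, dy, d\<theta>\<close> is also a basis of the right module. The coaction is the left-linear map with
  \<open>dx \<mapsto> dx \<otimes> x\<close>, \<open>dy \<mapsto> dy \<otimes> y\<close>, \<open>d\<theta> \<mapsto> d\<theta> \<otimes> x^{-1} y\<close>; it is compatible with \<open>d\<close> because it is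
  right-linear and \<open>d \<otimes> id\<close> satisfies a graded Leibniz rule. Left and right freeness turn the
  relations into an isomorphism onto the constructed calculus, and the two calculi are told apart
  by the relation for \<open>dx \<cdot> y\<close>, in which the counit detects the coefficients.
\<close>

section \<open>Linear extension\<close>

text \<open>All computation is done with polynomials in the free algebra. There the matrices
  multiply exactly, whatever the entries at the generators are; passing to cosets then only asks
  that finitely many polynomials lie in the defining ideal, for which equality of normal forms
  suffices. Tensor products are treated likewise, through representatives that are additive only
  modulo the span of the bilinearity relations. Apart from telling the two calculi apart, every
  claim is an identity, or an ideal membership derived from another one: uniqueness of right
  coordinates, for instance, holds because the diagonal automorphisms preserve and reflect the
  ideal. The weights of the coaction are forced by (d \<otimes> id)\<Delta>: the summand 1 \<otimes>
  \<theta> of \<Delta>(\<theta>) is killed by d(1) = 0, which leaves d\<theta> \<otimes> x^{-1} y.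
  That summand returns when the coaction is compared with right multiplication by \<theta>; there it
  ties the diagonal coefficients -q, -q, 1 of the \<theta>-relations to the commutation of \<theta>
  with the weights and to the parities of dx, dy, d\<theta>.\<close>

definition scal :: "complex \<Rightarrow> ('k \<Rightarrow>\<^sub>0 complex) \<Rightarrow> ('k \<Rightarrow>\<^sub>0 complex)" where
  "scal c p = Poly_Mapping.map ((*) c) p"

lemma lookup_scal [simp]: "Poly_Mapping.lookup (scal c p) k = c * Poly_Mapping.lookup p k"
  by (simp add: scal_def Poly_Mapping.map.rep_eq when_def)

lemma scal_simps [simp]:
  "scal c 0 = 0" "scal 0 p = 0" "scal 1 p = p" "scal a (scal b p) = scal (a * b) p"
  "scal c (Poly_Mapping.single k a) = Poly_Mapping.single k (c * a)"
  by (auto intro!: poly_mapping_eqI simp: lookup_single when_def)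

lemma scal_distribs:
  "scal c (p + p') = scal c p + scal c p'" "scal c (p - p') = scal c p - scal c p'"
  "scal (a + b) p = scal a p + scal b p" "scal (a - b) p = scal a p - scal b p"
  "scal c (- p) = - scal c p" "scal (- c) p = - scal c p"
  by (auto intro!: poly_mapping_eqI simp: lookup_add lookup_minus algebra_simps)

lemma scal_sum: "scal c (sum f S) = (\<Sum>x\<in>S. scal c (f x))"
  by (induction S rule: infinite_finite_induct) (simp_all add: scal_distribs)

lemma keys_scal_subset: "Poly_Mapping.keys (scal c p) \<subseteq> Poly_Mapping.keys p"
  by (auto simp: in_keys_iff)

lemma poly_mapping_sum_single:
  "p = (\<Sum>k\<in>Poly_Mapping.keys p. Poly_Mapping.single k (Poly_Mapping.lookup p k))"
  by (intro poly_mapping_eqI) (auto simp: lookup_sum lookup_single when_def in_keys_iff)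

text \<open>The \<open>single\<close> case keeps \<open>k\<close> among the keys of
  \<open>p\<close>, so that support conditions such as membership in a carrier survive the
  induction.\<close>

lemma poly_mapping_linear_induct [case_names zero single add]:
  fixes p :: "'k \<Rightarrow>\<^sub>0 'b::comm_monoid_add"
  assumes "P 0" "\<And>k c. k \<in> Poly_Mapping.keys p \<Longrightarrow> P (Poly_Mapping.single k c)"
    and "\<And>f g. P f \<Longrightarrow> P g \<Longrightarrow> P (f + g)"
  shows "P p"
proof -
  have "P (\<Sum>k\<in>S. Poly_Mapping.single k (Poly_Mapping.lookup p k))"
    if "finite S" "S \<subseteq> Poly_Mapping.keys p" for S
    using that by (induction S) (auto intro: assms)
  then show ?thesis
    by (metis poly_mapping_sum_single finite_keys order_refl)
qed

text \<open>The linear map with prescribed values on the basis of a free vector space. Normal forms,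
  matrices, parity projections, rescalings, the sign-rule product and the counit are all instances,
  so their linearity comes from one set of rules.\<close>

definition lext :: "('k \<Rightarrow> ('m \<Rightarrow>\<^sub>0 complex)) \<Rightarrow> ('k \<Rightarrow>\<^sub>0 complex) \<Rightarrow> ('m \<Rightarrow>\<^sub>0 complex)" where
  "lext \<beta> p = (\<Sum>k\<in>Poly_Mapping.keys p. scal (Poly_Mapping.lookup p k) (\<beta> k))"

lemma lext_superset:
  assumes "finite S" "Poly_Mapping.keys p \<subseteq> S"
  shows "lext \<beta> p = (\<Sum>k\<in>S. scal (Poly_Mapping.lookup p k) (\<beta> k))"
  unfolding lext_def using assms by (intro sum.mono_neutral_left) (auto simp: in_keys_iff)

lemma lext_zero [simp]: "lext \<beta> 0 = 0"
  by (simp add: lext_def)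

lemma lext_single [simp]: "lext \<beta> (Poly_Mapping.single k c) = scal c (\<beta> k)"
  by (simp add: lext_def)

lemma lext_add: "lext \<beta> (p + p') = lext \<beta> p + lext \<beta> p'"
proof -
  let ?S = "Poly_Mapping.keys p \<union> Poly_Mapping.keys p'"
  \<comment> \<open>Keys of \<open>p + p'\<close> may cancel, so all three sums are taken over one
    common finite set.\<close>
  have "lext \<beta> r = (\<Sum>k\<in>?S. scal (Poly_Mapping.lookup r k) (\<beta> k))" if "r \<in> {p, p', p + p'}" for r
    using that keys_add[of p p'] by (intro lext_superset) auto
  then show ?thesis
    by (simp add: lookup_add scal_distribs sum.distrib)
qed

lemma lext_scal: "lext \<beta> (scal c p) = scal c (lext \<beta> p)"
  using lext_superset[OF finite_keys keys_scal_subset] by (simp add: lext_def scal_sum)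

lemma lext_uminus: "lext \<beta> (- p) = - lext \<beta> p"
  using lext_scal[of \<beta> "- 1" p] by (simp add: scal_distribs)

lemma lext_diff: "lext \<beta> (p - p') = lext \<beta> p - lext \<beta> p'"
  using lext_add[of \<beta> p "- p'"] by (simp add: lext_uminus)

lemma lext_sum: "lext \<beta> (sum f S) = (\<Sum>x\<in>S. lext \<beta> (f x))"
  by (induction S rule: infinite_finite_induct) (simp_all add: lext_add)

lemma lext_fun_add: "lext (\<lambda>k. \<beta> k + \<gamma> k) p = lext \<beta> p + lext \<gamma> p"
  by (simp add: lext_def scal_distribs sum.distrib)

lemma lext_fun_scal: "lext (\<lambda>k. scal c (\<beta> k)) p = scal c (lext \<beta> p)"
  by (simp add: lext_def scal_sum mult.commute)

lemma lext_fun_diff: "lext (\<lambda>k. \<beta> k - \<gamma> k) p = lext \<beta> p - lext \<gamma> p"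
  by (simp add: lext_def scal_distribs sum_subtractf)

lemma keys_lext: "Poly_Mapping.keys (lext \<beta> p) \<subseteq> (\<Union>k\<in>Poly_Mapping.keys p. Poly_Mapping.keys (\<beta> k))"
  unfolding lext_def using keys_sum keys_scal_subset by fastforce

lemmas lext_simps = lext_add lext_scal lext_uminus lext_diff lext_sum


section \<open>The free algebra and the defining ideal\<close>

lemma scal_conv_mult: "scal c p = Poly_Mapping.single 0 c * (p :: ncpoly)"
  unfolding scal_def by (rule mult_map_scale_conv_mult)

lemma scal_mult_left: "scal c p * p' = scal c (p * (p' :: ncpoly))"
  by (simp add: scal_conv_mult mult.assoc)

text \<open>A scalar is \<open>single 0 c\<close>, and the zero word is neutral for concatenation,
  so scalars are central.\<close>

lemma scal_mult_right: "p * scal c p' = scal c (p * (p' :: ncpoly))"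
proof -
  have "p * Poly_Mapping.single 0 c = Poly_Mapping.single 0 c * p"
    by (induction p rule: poly_mapping_linear_induct)
      (simp_all add: mult_single algebra_simps)
  then show ?thesis by (simp add: scal_conv_mult flip: mult.assoc)
qed

lemma Word_add: "Word u + Word v = Word (u @ v)"
  by (simp add: plus_word_def)

lemma nc_monom_mult: "nc_monom u * nc_monom v = nc_monom (u @ v)"
  by (simp add: nc_monom_def mult_single Word_add)

lemma nc_monom_Nil: "nc_monom [] = 1"
  by (simp add: nc_monom_def flip: zero_word_def)

lemma single_conv_nc_monom: "Poly_Mapping.single w c = scal c (nc_monom (letters w))"
  by (simp add: nc_monom_def)

lemma ncpoly_induct [case_names zero monom add]:
  assumes "P 0" "\<And>c gs. P (scal c (nc_monom gs))" "\<And>f g. P f \<Longrightarrow> P g \<Longrightarrow> P (f + g)"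
  shows "P (p :: ncpoly)"
  by (induction p rule: poly_mapping_linear_induct) (auto simp: single_conv_nc_monom assms)

lemma free_algebra_ring: "ring free_algebra"
proof -
  have "\<exists>y. y + x = 0 \<and> x + y = 0" for x :: ncpoly
    by (rule exI[of _ "- x"]) simp
  then show ?thesis
    by unfold_locales (auto simp: free_algebra_def Units_def algebra_simps)
qed

lemma free_algebra_simps [simp]:
  "carrier free_algebra = UNIV" "x \<otimes>\<^bsub>free_algebra\<^esub> y = x * y" "\<one>\<^bsub>free_algebra\<^esub> = 1"
  "\<zero>\<^bsub>free_algebra\<^esub> = 0" "x \<oplus>\<^bsub>free_algebra\<^esub> y = x + y" "c \<odot>\<^bsub>free_algebra\<^esub> x = scal c x"
  by (simp_all add: free_algebra_def scal_def)

lemma free_algebra_minus [simp]: "\<ominus>\<^bsub>free_algebra\<^esub> x = - x"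
proof -
  interpret ring free_algebra by (rule free_algebra_ring)
  show ?thesis by (rule minus_equality) simp_all
qed

lemma qsp_ideal_ideal: "ideal (qsp_ideal q) free_algebra"
  unfolding qsp_ideal_def by (rule ring.genideal_ideal[OF free_algebra_ring]) simp

lemma qsp_relators_in_ideal: "p \<in> qsp_relators q \<Longrightarrow> p \<in> qsp_ideal q"
  unfolding qsp_ideal_def using ring.genideal_self[OF free_algebra_ring] by fastforce

lemma qsp_ideal_zero [simp]: "0 \<in> qsp_ideal q"
  using additive_subgroup.zero_closed[OF ideal.axioms(1)[OF qsp_ideal_ideal]] by simp

lemma qsp_ideal_add: "a \<in> qsp_ideal q \<Longrightarrow> b \<in> qsp_ideal q \<Longrightarrow> a + b \<in> qsp_ideal q"
  using additive_subgroup.a_closed[OF ideal.axioms(1)[OF qsp_ideal_ideal]] by simp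

lemma qsp_ideal_lmult: "a \<in> qsp_ideal q \<Longrightarrow> b * a \<in> qsp_ideal q"
  using ideal.I_l_closed[OF qsp_ideal_ideal] by simp

lemma qsp_ideal_rmult: "a \<in> qsp_ideal q \<Longrightarrow> a * b \<in> qsp_ideal q"
  using ideal.I_r_closed[OF qsp_ideal_ideal] by simp

lemma qsp_ideal_scal: "a \<in> qsp_ideal q \<Longrightarrow> scal c a \<in> qsp_ideal q"
  by (simp add: scal_conv_mult qsp_ideal_lmult)

lemma qsp_ideal_uminus: "a \<in> qsp_ideal q \<Longrightarrow> - a \<in> qsp_ideal q"
  using qsp_ideal_scal[of a q "- 1"] by (simp add: scal_distribs)

lemma qsp_ideal_diff: "a \<in> qsp_ideal q \<Longrightarrow> b \<in> qsp_ideal q \<Longrightarrow> a - b \<in> qsp_ideal q"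
  using qsp_ideal_add[of a q "- b"] by (simp add: qsp_ideal_uminus)

lemma qsp_ideal_sum: "(\<And>i. i \<in> S \<Longrightarrow> f i \<in> qsp_ideal q) \<Longrightarrow> sum f S \<in> qsp_ideal q"
  by (induction S rule: infinite_finite_induct) (auto simp: qsp_ideal_add)

text \<open>Induction over the two-sided ideal, used whenever a map has to descend to the quotient.
  Closure under negation follows from multiplication by -1.\<close>

lemma qsp_ideal_minimal:
  assumes "a \<in> qsp_ideal q" "qsp_relators q \<subseteq> J" "0 \<in> J"
    and add: "\<And>x y. x \<in> J \<Longrightarrow> y \<in> J \<Longrightarrow> x + y \<in> J"
    and lmult: "\<And>x y. x \<in> J \<Longrightarrow> y * x \<in> J" and rmult: "\<And>x y. x \<in> J \<Longrightarrow> x * y \<in> J"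
  shows "a \<in> J"
proof -
  interpret ring free_algebra by (rule free_algebra_ring)
  have uminus: "- x \<in> J" if "x \<in> J" for x
    using lmult[OF that, of "- 1"] by simp
  have "subgroup J (add_monoid free_algebra)"
    by (rule add.subgroupI) (use \<open>0 \<in> J\<close> add uminus in \<open>auto simp flip: a_inv_def\<close>)
  then have "ideal J free_algebra"
    by (intro idealI free_algebra_ring) (auto intro: lmult rmult)
  then have "qsp_ideal q \<subseteq> J"
    unfolding qsp_ideal_def using assms(2) by (intro genideal_minimal)
  then show ?thesis using assms(1) by auto
qed

section \<open>Arithmetic of cosets of the defining ideal\<close>

lemma qsp_class_conv: "qsp_class q p = (\<lambda>h. h + p) ` qsp_ideal q"
  by (auto simp: qsp_class_def a_r_coset_def r_coset_def)

lemma qsp_class_eq_iff: "qsp_class q p = qsp_class q p' \<longleftrightarrow> p - p' \<in> qsp_ideal q"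
proof
  assume "qsp_class q p = qsp_class q p'"
  then have "0 + p \<in> qsp_class q p'"
    unfolding qsp_class_conv using qsp_ideal_zero by (metis imageI)
  then show "p - p' \<in> qsp_ideal q" by (auto simp: qsp_class_conv)
next
  assume *: "p - p' \<in> qsp_ideal q"
  have "h + p \<in> qsp_class q p'" if "h \<in> qsp_ideal q" for h
    unfolding qsp_class_conv by (rule image_eqI[OF _ qsp_ideal_add[OF that *]]) simp
  moreover have "h + p' \<in> qsp_class q p" if "h \<in> qsp_ideal q" for h
    unfolding qsp_class_conv by (rule image_eqI[OF _ qsp_ideal_diff[OF that *]]) simp
  ultimately show "qsp_class q p = qsp_class q p'" by (auto simp: qsp_class_conv)
qed

lemma mem_qsp_class_iff: "p' \<in> qsp_class q p \<longleftrightarrow> p' - p \<in> qsp_ideal q"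
proof -
  have "p' \<in> qsp_class q p" if "p' - p \<in> qsp_ideal q"
    unfolding qsp_class_conv by (rule image_eqI[OF _ that]) simp
  then show ?thesis by (auto simp: qsp_class_conv)
qed

lemma qsp_class_self: "p \<in> qsp_class q p"
  by (simp add: mem_qsp_class_iff)

lemma qsp_add: "qsp_class q p \<oplus>\<^bsub>qsp q\<^esub> qsp_class q p' = qsp_class q (p + p')"
proof -
  have "h + p + (h' + p') - (p + p') \<in> qsp_ideal q" if "h \<in> qsp_ideal q" "h' \<in> qsp_ideal q" for h h'
    using qsp_ideal_add[OF that] by (simp add: algebra_simps)
  moreover have "\<exists>h\<in>qsp_ideal q. \<exists>h'\<in>qsp_ideal q. k = h + p + (h' + p')" if "k - (p + p') \<in> qsp_ideal q" for k
    by (rule bexI[OF _ that], rule bexI[of _ 0]) (simp_all add: algebra_simps)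
  ultimately have "(\<exists>h\<in>qsp_ideal q. \<exists>h'\<in>qsp_ideal q. k = h + p + (h' + p')) \<longleftrightarrow> k - (p + p') \<in> qsp_ideal q" for k
    by blast
  then show ?thesis
    by (simp add: set_eq_iff mem_qsp_class_iff qsp_def FactRing_def set_add_def set_mult_def)
      (simp add: qsp_class_conv)
qed

lemma qsp_mult: "qsp_class q p \<otimes>\<^bsub>qsp q\<^esub> qsp_class q p' = qsp_class q (p * p')"
  using ideal.rcoset_mult_add[OF qsp_ideal_ideal, of p p' q]
  by (simp add: qsp_def FactRing_def qsp_class_def)

lemma qsp_smult: "c \<odot>\<^bsub>qsp q\<^esub> qsp_class q p = qsp_class q (scal c p)"
proof -
  have "qsp_class q (scal c p') = qsp_class q (scal c p)" if "p' \<in> qsp_class q p" for p'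
    using qsp_ideal_scal[of "p' - p" q c] that by (simp add: qsp_class_eq_iff mem_qsp_class_iff scal_distribs)
  moreover have "p \<in> qsp_class q p" by (rule qsp_class_self)
  ultimately have "(\<Union>p'\<in>qsp_class q p. qsp_class q (scal c p')) = qsp_class q (scal c p)"
    by blast
  then show ?thesis by (simp add: qsp_def)
qed

lemma qsp_one: "\<one>\<^bsub>qsp q\<^esub> = qsp_class q 1"
  by (simp add: qsp_def FactRing_def qsp_class_def)

lemma qsp_zero: "\<zero>\<^bsub>qsp q\<^esub> = qsp_class q 0"
  by (simp add: qsp_def FactRing_def qsp_class_conv)

lemma qsp_carrier: "carrier (qsp q) = range (qsp_class q)"
  unfolding qsp_class_def[abs_def]
  by (simp add: qsp_def FactRing_def A_RCOSETS_def RCOSETS_def a_r_coset_def UNION_singleton_eq_range)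

lemma qsp_class_closed [simp]: "qsp_class q p \<in> carrier (qsp q)"
  by (simp add: qsp_carrier)

lemma qsp_homog: "homog (qsp q) i = qsp_class q ` {p. \<forall>w\<in>Poly_Mapping.keys p. word_parity w = i}"
  by (simp add: qsp_def)

lemma qsp_cases [cases set]:
  assumes "a \<in> carrier (qsp q)"
  obtains p where "a = qsp_class q p"
  using assms by (auto simp: qsp_carrier)

lemma qsp_ring: "ring (qsp q)"
proof -
  have "\<exists>a\<in>carrier (qsp q). a \<oplus>\<^bsub>qsp q\<^esub> b = \<zero>\<^bsub>qsp q\<^esub>" if "b \<in> carrier (qsp q)" for b
    using that
  proof (cases rule: qsp_cases)
    case (1 p)
    then show ?thesis
      by (intro bexI[of _ "qsp_class q (- p)"]) (simp_all add: qsp_add qsp_zero)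
  qed
  then have "abelian_group (qsp q)"
    by (intro abelian_groupI)
      ((elim qsp_cases; simp add: qsp_add qsp_zero algebra_simps) | simp add: qsp_zero)+
  then show ?thesis
  proof (rule ringI)
    show "monoid (qsp q)"
      by (rule monoidI) ((elim qsp_cases)?; simp add: qsp_one qsp_mult mult.assoc)+
  qed (elim qsp_cases; simp add: qsp_add qsp_mult algebra_simps)+
qed

lemma complex_ring_simps [simp]:
  "carrier complex_ring = UNIV" "x \<otimes>\<^bsub>complex_ring\<^esub> y = x * y" "\<one>\<^bsub>complex_ring\<^esub> = 1"
  "\<zero>\<^bsub>complex_ring\<^esub> = 0" "x \<oplus>\<^bsub>complex_ring\<^esub> y = x + y"
  by (simp_all add: ring_of_type_algebra_def)

lemma complex_ring_cring: "cring complex_ring"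
  by (rule cring_from_type_algebra)

lemma qsp_module: "module complex_ring (qsp q)"
proof -
  interpret ring "qsp q" by (rule qsp_ring)
  show ?thesis
    by (intro moduleI complex_ring_cring abelian_group_axioms)
      (elim qsp_cases; simp add: qsp_add qsp_smult scal_distribs)+
qed

section \<open>Super vector spaces\<close>

lemma parity_sign_simps [simp]:
  "parity_sign 0 = 1" "parity_sign 1 = - 1" "parity_sign i * parity_sign i = 1"
  by (simp_all add: parity_sign_def)

lemma parity_sign_add: "parity_sign (i + j) = parity_sign i * parity_sign j"
  by (cases i; cases j) simp_all

lemma bit_add_self [simp]: "(i :: bit) + i = 0"
  by (cases i) simp_all

lemma bit_add_self_left [simp]: "(i :: bit) + (i + j) = j"
  by (cases i; cases j) simp_all

lemma ex1_uniqueness: "\<exists>!x. P x \<Longrightarrow> P x \<Longrightarrow> P y \<Longrightarrow> x = y"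
  by blast

lemma lin_span_incl: "S \<subseteq> lin_span V S"
  unfolding lin_span_def by (rule hull_subset)

lemma lin_span_minimal: "submodule N complex_ring V \<Longrightarrow> S \<subseteq> N \<Longrightarrow> lin_span V S \<subseteq> N"
  unfolding lin_span_def by (rule hull_minimal)

lemma lin_span_submodule:
  assumes V: "module complex_ring V" and S: "S \<subseteq> carrier V"
  shows "submodule (lin_span V S) complex_ring V"
proof -
  interpret module complex_ring V by (rule V)
  have *: "v \<in> lin_span V S \<longleftrightarrow> (\<forall>N. submodule N complex_ring V \<and> S \<subseteq> N \<longrightarrow> v \<in> N)" for v
    by (simp add: lin_span_def hull_def)
  show ?thesis
  proof (rule submoduleI)
    \<comment> \<open>The carrier is itself a submodule containing \<open>S\<close>, so the
      intersection that defines the hull stays inside it.\<close>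
    show "lin_span V S \<subseteq> carrier V"
      using carrier_is_submodule S by (auto simp: *)
    show "\<zero>\<^bsub>V\<^esub> \<in> lin_span V S"
      using subgroup.one_closed[OF submodule.axioms(1)] by (fastforce simp: *)
  qed (use submoduleE(3,4,5) in \<open>auto simp: *\<close>)
qed

context super_vector_space
begin

lemma homog_closed: "v \<in> homog V i \<Longrightarrow> v \<in> carrier V"
  using submoduleE(1)[OF homog_submodule] by auto

lemma homog_add: "u \<in> homog V i \<Longrightarrow> v \<in> homog V i \<Longrightarrow> u \<oplus>\<^bsub>V\<^esub> v \<in> homog V i"
  by (rule submoduleE(5)[OF homog_submodule])

lemma homog_smult: "v \<in> homog V i \<Longrightarrow> c \<odot>\<^bsub>V\<^esub> v \<in> homog V i"
  by (rule submoduleE(4)[OF homog_submodule]) simp_all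

lemma homog_zero: "\<zero>\<^bsub>V\<^esub> \<in> homog V i"
  using subgroup.one_closed[OF submodule.axioms(1)[OF homog_submodule]] by simp

text \<open>The decomposition axiom is stated in the order even, odd; for \<open>i = 1\<close> its
  two components exchange roles.\<close>

lemma homog_part_exists:
  assumes "v \<in> carrier V"
  obtains u w where "u \<in> homog V i" "w \<in> homog V (i + 1)" "v = u \<oplus>\<^bsub>V\<^esub> w"
proof -
  obtain p where p: "fst p \<in> homog V 0" "snd p \<in> homog V 1" "v = fst p \<oplus>\<^bsub>V\<^esub> snd p"
    using homog_decomposition[OF assms] by auto
  show ?thesis
    using p that[of "fst p" "snd p"] that[of "snd p" "fst p"] homog_closed
    by (cases i) (simp_all add: M.a_comm)
qed

lemma homog_part_unique:
  assumes "u \<in> homog V i" "w \<in> homog V (i + 1)" "u' \<in> homog V i" "w' \<in> homog V (i + 1)"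
    and eq: "u \<oplus>\<^bsub>V\<^esub> w = u' \<oplus>\<^bsub>V\<^esub> w'"
  shows "u = u' \<and> w = w'"
proof -
  have c: "u \<in> carrier V" "w \<in> carrier V" "u' \<in> carrier V" "w' \<in> carrier V"
    using assms homog_closed by auto
  have ex1: "\<exists>!p. fst p \<in> homog V 0 \<and> snd p \<in> homog V 1 \<and> u \<oplus>\<^bsub>V\<^esub> w = fst p \<oplus>\<^bsub>V\<^esub> snd p"
    using c by (intro homog_decomposition) simp
  note * = ex1_uniqueness[OF ex1, of "(u, w)" "(u', w')"] ex1_uniqueness[OF ex1, of "(w, u)" "(w', u')"]
  show ?thesis
    using * assms c by (cases i) (auto simp: M.a_comm)
qed

text \<open>The way to evaluate \<open>homog_part\<close>, a definite description: exhibiting any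
  decomposition suffices.\<close>

lemma homog_part_eqI:
  assumes "u \<in> homog V i" "w \<in> homog V (i + 1)" "v = u \<oplus>\<^bsub>V\<^esub> w"
  shows "homog_part V i v = u"
  unfolding homog_part_def using assms homog_part_unique by (intro the_equality) blast+

lemma homog_part_homog: "v \<in> carrier V \<Longrightarrow> homog_part V i v \<in> homog V i"
  using homog_part_exists homog_part_eqI by metis

lemma homog_part_closed [simp]: "v \<in> carrier V \<Longrightarrow> homog_part V i v \<in> carrier V"
  using homog_part_homog homog_closed by blast

lemma homog_part_sum:
  assumes "v \<in> carrier V"
  shows "v = homog_part V 0 v \<oplus>\<^bsub>V\<^esub> homog_part V 1 v"
proof -
  obtain u w where uw: "u \<in> homog V 0" "w \<in> homog V (0 + 1)" "v = u \<oplus>\<^bsub>V\<^esub> w"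
    by (rule homog_part_exists[OF assms])
  have "v = w \<oplus>\<^bsub>V\<^esub> u" using uw homog_closed by (simp add: M.a_comm)
  then show ?thesis
    using homog_part_eqI[OF uw] homog_part_eqI[of w 1 u v] uw by simp
qed

lemma homog_part_add:
  assumes "u \<in> carrier V" "v \<in> carrier V"
  shows "homog_part V i (u \<oplus>\<^bsub>V\<^esub> v) = homog_part V i u \<oplus>\<^bsub>V\<^esub> homog_part V i v"
proof -
  obtain u1 u2 where u: "u1 \<in> homog V i" "u2 \<in> homog V (i + 1)" "u = u1 \<oplus>\<^bsub>V\<^esub> u2"
    by (rule homog_part_exists[OF assms(1)])
  obtain v1 v2 where v: "v1 \<in> homog V i" "v2 \<in> homog V (i + 1)" "v = v1 \<oplus>\<^bsub>V\<^esub> v2"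
    by (rule homog_part_exists[OF assms(2)])
  have c: "u1 \<in> carrier V" "u2 \<in> carrier V" "v1 \<in> carrier V" "v2 \<in> carrier V"
    using u v homog_closed by auto
  have "u \<oplus>\<^bsub>V\<^esub> v = (u1 \<oplus>\<^bsub>V\<^esub> v1) \<oplus>\<^bsub>V\<^esub> (u2 \<oplus>\<^bsub>V\<^esub> v2)"
    unfolding u(3) v(3) using c by (simp add: M.a_ac)
  from homog_part_eqI[OF _ _ this, of i] show ?thesis
    using homog_part_eqI[OF u] homog_part_eqI[OF v] u v homog_add by simp
qed

lemma homog_part_smult:
  assumes "v \<in> carrier V"
  shows "homog_part V i (c \<odot>\<^bsub>V\<^esub> v) = c \<odot>\<^bsub>V\<^esub> homog_part V i v"
proof -
  obtain v1 v2 where v: "v1 \<in> homog V i" "v2 \<in> homog V (i + 1)" "v = v1 \<oplus>\<^bsub>V\<^esub> v2"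
    by (rule homog_part_exists[OF assms])
  have "c \<odot>\<^bsub>V\<^esub> v = c \<odot>\<^bsub>V\<^esub> v1 \<oplus>\<^bsub>V\<^esub> c \<odot>\<^bsub>V\<^esub> v2"
    unfolding v(3) using v homog_closed by (intro smult_r_distr) auto
  from homog_part_eqI[OF _ _ this, of i] show ?thesis
    using homog_part_eqI[OF v] v homog_smult by simp
qed

lemma homog_part_of_homog:
  assumes "v \<in> homog V j"
  shows "homog_part V i v = (if i = j then v else \<zero>\<^bsub>V\<^esub>)"
proof (cases "i = j")
  case True
  then show ?thesis
    using homog_part_eqI[of v i "\<zero>\<^bsub>V\<^esub>" v] assms homog_zero homog_closed by simp
next
  case False
  then have "j = i + 1" by (cases i; cases j) simp_all
  then show ?thesis
    using False homog_part_eqI[of "\<zero>\<^bsub>V\<^esub>" i v v] assms homog_zero homog_closed by simp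
qed

end


section \<open>The tensor product of vector spaces\<close>

locale tensor_modules = V: module complex_ring V + W: module complex_ring W
  for V :: "(complex, 'v, 'x) module_scheme" and W :: "(complex, 'w, 'y) module_scheme"
begin

abbreviation "TF \<equiv> tensor_free V W"
abbreviation "TN \<equiv> lin_span TF (tensor_relators V W)"
abbreviation "TS \<equiv> tensor_space V W"
abbreviation "cls \<equiv> tensor_class V W"
abbreviation tens :: "'v \<Rightarrow> 'w \<Rightarrow> 'v \<times> 'w \<Rightarrow>\<^sub>0 complex" where
  "tens v w \<equiv> Poly_Mapping.single (v, w) 1"

lemma TF_simps [simp]:
  "x \<oplus>\<^bsub>TF\<^esub> y = x + y" "\<zero>\<^bsub>TF\<^esub> = 0" "c \<odot>\<^bsub>TF\<^esub> x = scal c x"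
  by (simp_all add: tensor_free_def scal_def)

lemma TF_carrier: "p \<in> carrier TF \<longleftrightarrow> Poly_Mapping.keys p \<subseteq> carrier V \<times> carrier W"
  by (simp add: tensor_free_def)

lemma TF_closed [simp]:
  "0 \<in> carrier TF" "p \<in> carrier TF \<Longrightarrow> p' \<in> carrier TF \<Longrightarrow> p + p' \<in> carrier TF"
  "p \<in> carrier TF \<Longrightarrow> scal c p \<in> carrier TF"
  "v \<in> carrier V \<Longrightarrow> w \<in> carrier W \<Longrightarrow> Poly_Mapping.single (v, w) c \<in> carrier TF"
  using keys_add[of p p'] keys_scal_subset[of c p] by (auto simp: TF_carrier)

lemma TF_diff_closed [simp]: "p \<in> carrier TF \<Longrightarrow> p' \<in> carrier TF \<Longrightarrow> p - p' \<in> carrier TF"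
  using TF_closed(2)[OF _ TF_closed(3), of p p' "- 1"] by (simp add: scal_distribs)

lemma TF_uminus_closed [simp]: "p \<in> carrier TF \<Longrightarrow> - p \<in> carrier TF"
  using TF_diff_closed[of 0 p] by simp

lemma TF_module: "module complex_ring TF"
proof -
  have "abelian_group TF"
  proof (rule abelian_groupI)
    fix x assume "x \<in> carrier TF"
    then show "\<exists>y\<in>carrier TF. y \<oplus>\<^bsub>TF\<^esub> x = \<zero>\<^bsub>TF\<^esub>"
      using TF_diff_closed[of 0 x] by (intro bexI[of _ "0 - x"]) simp_all
  qed (simp_all add: algebra_simps)
  then show ?thesis
    by (intro moduleI complex_ring_cring) (simp_all add: scal_distribs)
qed

lemma relators_closed: "tensor_relators V W \<subseteq> carrier TF"
  unfolding tensor_relators_def by auto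

lemma TN_submodule: "submodule TN complex_ring TF"
  by (rule lin_span_submodule[OF TF_module relators_closed])

lemma TN_closed: "p \<in> TN \<Longrightarrow> p \<in> carrier TF"
  using module.submoduleE(1)[OF TF_module TN_submodule] by auto

lemma TN_add: "p \<in> TN \<Longrightarrow> p' \<in> TN \<Longrightarrow> p + p' \<in> TN"
  using module.submoduleE(5)[OF TF_module TN_submodule] by simp

lemma TN_scal: "p \<in> TN \<Longrightarrow> scal c p \<in> TN"
  using module.submoduleE(4)[OF TF_module TN_submodule, of c p] by simp

lemma TN_zero [simp]: "0 \<in> TN"
  using subgroup.one_closed[OF submodule.axioms(1)[OF TN_submodule]] by simp

lemma TN_diff: "p \<in> TN \<Longrightarrow> p' \<in> TN \<Longrightarrow> p - p' \<in> TN"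
  using TN_add[of p "scal (- 1) p'"] TN_scal[of p' "- 1"] by (simp add: scal_distribs)

lemma TN_sum: "(\<And>i. i \<in> S \<Longrightarrow> f i \<in> TN) \<Longrightarrow> sum f S \<in> TN"
  by (induction S rule: infinite_finite_induct) (auto simp: TN_add)

lemma cls_conv: "cls p = (\<lambda>h. h + p) ` TN"
  by (auto simp: tensor_class_def a_r_coset_def r_coset_def)

lemma mem_cls_iff: "p' \<in> cls p \<longleftrightarrow> p' - p \<in> TN"
proof -
  have "p' \<in> cls p" if "p' - p \<in> TN"
    unfolding cls_conv by (rule image_eqI[OF _ that]) simp
  then show ?thesis by (auto simp: cls_conv)
qed

lemma cls_self: "p \<in> cls p"
  by (simp add: mem_cls_iff)

lemma cls_eq_iff: "cls p = cls p' \<longleftrightarrow> p - p' \<in> TN"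
proof
  assume "cls p = cls p'"
  then show "p - p' \<in> TN" using cls_self[of p] by (simp add: mem_cls_iff)
next
  assume *: "p - p' \<in> TN"
  have "p'' - p \<in> TN \<longleftrightarrow> p'' - p' \<in> TN" for p''
    using TN_add[OF _ *, of "p'' - p"] TN_diff[OF _ *, of "p'' - p'"] by auto
  then show "cls p = cls p'" by (auto simp: mem_cls_iff)
qed

lemma TS_carrier: "carrier TS = cls ` carrier TF"
  by (simp add: tensor_space_def)

lemma TS_closed [simp]: "p \<in> carrier TF \<Longrightarrow> cls p \<in> carrier TS"
  by (simp add: TS_carrier)

lemma TS_cases [cases set]:
  assumes "z \<in> carrier TS"
  obtains p where "z = cls p" "p \<in> carrier TF"
  using assms by (auto simp: TS_carrier)

lemma TS_zero: "\<zero>\<^bsub>TS\<^esub> = cls 0"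
  by (simp add: tensor_space_def)

lemma TS_add: "cls p \<oplus>\<^bsub>TS\<^esub> cls p' = cls (p + p')"
proof -
  have "h + p + (h' + p') - (p + p') \<in> TN" if "h \<in> TN" "h' \<in> TN" for h h'
    using TN_add[OF that] by (simp add: algebra_simps)
  moreover have "\<exists>h\<in>TN. \<exists>h'\<in>TN. k = h + p + (h' + p')" if "k - (p + p') \<in> TN" for k
    by (rule bexI[OF _ that], rule bexI[of _ 0]) (simp_all add: algebra_simps)
  ultimately have "(\<exists>h\<in>TN. \<exists>h'\<in>TN. k = h + p + (h' + p')) \<longleftrightarrow> k - (p + p') \<in> TN" for k
    by blast
  then show ?thesis
    by (simp add: set_eq_iff mem_cls_iff tensor_space_def set_add_def set_mult_def)
      (simp add: cls_conv)
qed

lemma TS_smult: "c \<odot>\<^bsub>TS\<^esub> cls p = cls (scal c p)"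
proof -
  have "cls (scal c p') = cls (scal c p)" if "p' \<in> cls p" for p'
    using TN_scal[of "p' - p" c] that by (simp add: cls_eq_iff mem_cls_iff scal_distribs)
  moreover have "p \<in> cls p" by (rule cls_self)
  ultimately have "(\<Union>p'\<in>cls p. cls (scal c p')) = cls (scal c p)"
    by blast
  then show ?thesis by (simp add: tensor_space_def flip: scal_def)
qed

lemma TS_module: "module complex_ring TS"
proof -
  have "abelian_group TS"
  proof (rule abelian_groupI)
    fix x assume "x \<in> carrier TS"
    then show "\<exists>y\<in>carrier TS. y \<oplus>\<^bsub>TS\<^esub> x = \<zero>\<^bsub>TS\<^esub>"
    proof (cases rule: TS_cases)
      case (1 p)
      then show ?thesis
        using TF_diff_closed[of 0 p] by (intro bexI[of _ "cls (0 - p)"]) (simp_all add: TS_add TS_zero)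
    qed
  qed ((elim TS_cases; simp add: TS_add TS_zero algebra_simps) | simp add: TS_zero)+
  then show ?thesis
    by (intro moduleI complex_ring_cring)
      (assumption | (elim TS_cases; simp add: TS_add TS_smult scal_distribs))+
qed

abbreviation "pt \<equiv> pure_tensor V W"

lemma pt_conv: "pt v w = cls (tens v w)"
  by (simp add: pure_tensor_def)

lemma pt_closed [simp]: "v \<in> carrier V \<Longrightarrow> w \<in> carrier W \<Longrightarrow> pt v w \<in> carrier TS"
  by (simp add: pt_conv)

lemma relator_add_left:
  assumes "v \<in> carrier V" "v' \<in> carrier V" "w \<in> carrier W"
  shows "tens (v \<oplus>\<^bsub>V\<^esub> v') w - tens v w - tens v' w \<in> TN"
  by (rule subsetD[OF lin_span_incl]) (use assms in \<open>unfold tensor_relators_def, blast\<close>)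

lemma relator_add_right:
  assumes "v \<in> carrier V" "w \<in> carrier W" "w' \<in> carrier W"
  shows "tens v (w \<oplus>\<^bsub>W\<^esub> w') - tens v w - tens v w' \<in> TN"
  by (rule subsetD[OF lin_span_incl]) (use assms in \<open>unfold tensor_relators_def, blast\<close>)

lemma relator_smult_left:
  assumes "v \<in> carrier V" "w \<in> carrier W"
  shows "tens (c \<odot>\<^bsub>V\<^esub> v) w - Poly_Mapping.single (v, w) c \<in> TN"
  by (rule subsetD[OF lin_span_incl]) (use assms in \<open>unfold tensor_relators_def, blast\<close>)

lemma relator_smult_right:
  assumes "v \<in> carrier V" "w \<in> carrier W"
  shows "tens v (c \<odot>\<^bsub>W\<^esub> w) - Poly_Mapping.single (v, w) c \<in> TN"
  by (rule subsetD[OF lin_span_incl]) (use assms in \<open>unfold tensor_relators_def, blast\<close>)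

lemma pt_add_left:
  assumes "v \<in> carrier V" "v' \<in> carrier V" "w \<in> carrier W"
  shows "pt (v \<oplus>\<^bsub>V\<^esub> v') w = pt v w \<oplus>\<^bsub>TS\<^esub> pt v' w"
  using relator_add_left[OF assms] by (simp add: pt_conv TS_add cls_eq_iff algebra_simps)

lemma pt_add_right:
  assumes "v \<in> carrier V" "w \<in> carrier W" "w' \<in> carrier W"
  shows "pt v (w \<oplus>\<^bsub>W\<^esub> w') = pt v w \<oplus>\<^bsub>TS\<^esub> pt v w'"
  using relator_add_right[OF assms] by (simp add: pt_conv TS_add cls_eq_iff algebra_simps)

lemma pt_smult_left:
  assumes "v \<in> carrier V" "w \<in> carrier W"
  shows "pt (c \<odot>\<^bsub>V\<^esub> v) w = c \<odot>\<^bsub>TS\<^esub> pt v w"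
  using relator_smult_left[OF assms] by (simp add: pt_conv TS_smult cls_eq_iff)

lemma pt_smult_right:
  assumes "v \<in> carrier V" "w \<in> carrier W"
  shows "pt v (c \<odot>\<^bsub>W\<^esub> w) = c \<odot>\<^bsub>TS\<^esub> pt v w"
  using relator_smult_right[OF assms] by (simp add: pt_conv TS_smult cls_eq_iff)

lemma pt_zero_left: "w \<in> carrier W \<Longrightarrow> pt \<zero>\<^bsub>V\<^esub> w = \<zero>\<^bsub>TS\<^esub>"
  using pt_smult_left[of "\<zero>\<^bsub>V\<^esub>" w 0] module.smult_l_null[OF TS_module, of "pt \<zero>\<^bsub>V\<^esub> w"] by simp

lemma pt_zero_right: "v \<in> carrier V \<Longrightarrow> pt v \<zero>\<^bsub>W\<^esub> = \<zero>\<^bsub>TS\<^esub>"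
  using pt_smult_right[of v "\<zero>\<^bsub>W\<^esub>" 0] module.smult_l_null[OF TS_module, of "pt v \<zero>\<^bsub>W\<^esub>"] by simp

lemma cls_single: "v \<in> carrier V \<Longrightarrow> w \<in> carrier W \<Longrightarrow> cls (Poly_Mapping.single (v, w) c) = c \<odot>\<^bsub>TS\<^esub> pt v w"
  by (simp add: pt_conv TS_smult)

text \<open>The universal property of the tensor product on representatives: if
  \<open>\<beta>\<close> is bilinear modulo a subspace \<open>J\<close>, the polynomials whose image
  lies in \<open>J\<close> form a submodule that contains all relators, hence also their
  span.\<close>

lemma lext_TN_mem:
  assumes p: "p \<in> TN" and J: "0 \<in> J" "\<And>x y. x \<in> J \<Longrightarrow> y \<in> J \<Longrightarrow> x + y \<in> J" "\<And>c x. x \<in> J \<Longrightarrow> scal c x \<in> J"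
    and add_left: "\<And>v v' w. v \<in> carrier V \<Longrightarrow> v' \<in> carrier V \<Longrightarrow> w \<in> carrier W \<Longrightarrow>
      \<beta> (v \<oplus>\<^bsub>V\<^esub> v', w) - \<beta> (v, w) - \<beta> (v', w) \<in> J"
    and add_right: "\<And>v w w'. v \<in> carrier V \<Longrightarrow> w \<in> carrier W \<Longrightarrow> w' \<in> carrier W \<Longrightarrow>
      \<beta> (v, w \<oplus>\<^bsub>W\<^esub> w') - \<beta> (v, w) - \<beta> (v, w') \<in> J"
    and smult_left: "\<And>c v w. v \<in> carrier V \<Longrightarrow> w \<in> carrier W \<Longrightarrow>
      \<beta> (c \<odot>\<^bsub>V\<^esub> v, w) - scal c (\<beta> (v, w)) \<in> J"
    and smult_right: "\<And>c v w. v \<in> carrier V \<Longrightarrow> w \<in> carrier W \<Longrightarrow>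
      \<beta> (v, c \<odot>\<^bsub>W\<^esub> w) - scal c (\<beta> (v, w)) \<in> J"
  shows "lext \<beta> p \<in> J"
proof -
  interpret TF: module complex_ring TF by (rule TF_module)
  let ?K = "{p \<in> carrier TF. lext \<beta> p \<in> J}"
  have inv: "\<ominus>\<^bsub>TF\<^esub> a = - a" if "a \<in> carrier TF" for a
    using that by (intro TF.minus_equality) simp_all
  have uminus: "- x \<in> J" if "x \<in> J" for x
    using J(3)[OF that, of "- 1"] by (simp add: scal_distribs)
  have "submodule ?K complex_ring TF"
    by (rule TF.submoduleI) (use J uminus in \<open>simp_all add: lext_simps inv\<close>)
  moreover have "lext \<beta> r \<in> J" if "r \<in> tensor_relators V W" for r
    using that unfolding tensor_relators_def
    by (elim UnE CollectE exE conjE)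
      (simp_all only: lext_simps lext_single scal_simps add_left add_right smult_left smult_right)
  then have "tensor_relators V W \<subseteq> ?K"
    using relators_closed by auto
  ultimately have "TN \<subseteq> ?K"
    by (rule lin_span_minimal)
  then show ?thesis using p by (simp add: subset_eq)
qed

lemma lext_TN: "(\<And>k. k \<in> Poly_Mapping.keys t \<Longrightarrow> \<beta> k \<in> TN) \<Longrightarrow> lext \<beta> t \<in> TN"
  unfolding lext_def by (intro TN_sum TN_scal)

lemma lext_TF:
  assumes "\<And>k. k \<in> Poly_Mapping.keys t \<Longrightarrow> \<beta> k \<in> carrier TF"
  shows "lext \<beta> t \<in> carrier TF"
  using assms keys_lext[of \<beta> t] by (simp add: TF_carrier) blast

end

lemma scal_commute: "scal c (scal d p) = scal d (scal c p)"
  by (simp add: mult.commute)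

text \<open>A tensor is a sum of pure tensors, and these split into homogeneous ones. A scalar is
  absorbed into the left factor and zero is the pure tensor of two zeros, so \<open>add\<close> and
  \<open>pure\<close> are the only cases.\<close>

lemma tensor_homog_induct [consumes 3, case_names add pure]:
  assumes V: "super_vector_space V" and W: "super_vector_space W"
    and z: "z \<in> carrier (tensor_space V W)"
    and add: "\<And>x y. x \<in> carrier (tensor_space V W) \<Longrightarrow> y \<in> carrier (tensor_space V W) \<Longrightarrow>
      Pr x \<Longrightarrow> Pr y \<Longrightarrow> Pr (x \<oplus>\<^bsub>tensor_space V W\<^esub> y)"
    and pure: "\<And>v w i j. v \<in> homog V i \<Longrightarrow> w \<in> homog W j \<Longrightarrow> Pr (pure_tensor V W v w)"
  shows "Pr z"
proof -
  interpret V: super_vector_space V by (rule V)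
  interpret W: super_vector_space W by (rule W)
  interpret tensor_modules V W ..
  interpret TS: module complex_ring TS by (rule TS_module)
  have pure': "Pr (pt v w)" if "v \<in> carrier V" "w \<in> carrier W" for v w
  proof -
    have *: "Pr (pt v' w)" if v': "v' \<in> homog V i" for v' i
    proof -
      have "Pr (pt v' (homog_part W 0 w) \<oplus>\<^bsub>TS\<^esub> pt v' (homog_part W 1 w))"
        using v' V.homog_closed[OF v'] \<open>w \<in> carrier W\<close>
        by (intro add pure[OF v' W.homog_part_homog]) simp_all
      then show ?thesis
        using W.homog_part_sum[OF \<open>w \<in> carrier W\<close>] V.homog_closed[OF v'] \<open>w \<in> carrier W\<close>
        by (metis pt_add_right W.homog_part_closed)
    qed
    have "Pr (pt (homog_part V 0 v) w \<oplus>\<^bsub>TS\<^esub> pt (homog_part V 1 v) w)"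
      using that by (intro add *[OF V.homog_part_homog]) simp_all
    then show ?thesis
      using V.homog_part_sum[OF \<open>v \<in> carrier V\<close>] that by (metis pt_add_left V.homog_part_closed)
  qed
  obtain p where p: "z = cls p" "p \<in> carrier TF"
    using z by (rule TS_cases)
  have "cls p \<in> carrier TS \<and> Pr (cls p)"
  proof (induction p rule: poly_mapping_linear_induct)
    case zero
    have "Pr (pt \<zero>\<^bsub>V\<^esub> \<zero>\<^bsub>W\<^esub>)"
      by (rule pure'; simp)
    then show ?case by (simp add: pt_zero_left TS_zero)
  next
    case (single k c)
    obtain v w where "k = (v, w)" by fastforce
    with single p(2) have "v \<in> carrier V" "w \<in> carrier W" "k = (v, w)"
      by (auto simp: TF_carrier)
    then show ?case
      using pure'[of "c \<odot>\<^bsub>V\<^esub> v" w] by (simp add: cls_single pt_smult_left)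
  next
    case (add f g)
    then show ?case
      using assms(4)[of "cls f" "cls g"] TS.a_closed[of "cls f" "cls g"] by (simp add: TS_add)
  qed
  then show ?thesis by (simp add: p)
qed


section \<open>Products with the sign rule\<close>

text \<open>One setting for all products with the sign rule: (a \<otimes> p)(q \<otimes> b) is
  \<open>f a q\<close> \<otimes> \<open>g p b\<close> with the sign of moving p past q. It covers
  the product of A \<otimes> A and both of its actions on \<Gamma> \<otimes> A.\<close>

locale koszul_pairing =
  fixes A :: "('a, 'x1) superspace_scheme" and P :: "('p, 'x2) superspace_scheme"
    and Q :: "('q, 'x3) superspace_scheme" and B :: "('b, 'x4) superspace_scheme"
    and V :: "('v, 'x5) superspace_scheme" and W :: "('w, 'x6) superspace_scheme"
    and f :: "'a \<Rightarrow> 'q \<Rightarrow> 'v" and g :: "'p \<Rightarrow> 'b \<Rightarrow> 'w"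
  assumes svs: "super_vector_space A" "super_vector_space P" "super_vector_space Q"
      "super_vector_space B" "super_vector_space V" "super_vector_space W"
    and f_closed: "\<And>a q. a \<in> carrier A \<Longrightarrow> q \<in> carrier Q \<Longrightarrow> f a q \<in> carrier V"
    and f_add_left: "\<And>a a' q. a \<in> carrier A \<Longrightarrow> a' \<in> carrier A \<Longrightarrow> q \<in> carrier Q \<Longrightarrow>
      f (a \<oplus>\<^bsub>A\<^esub> a') q = f a q \<oplus>\<^bsub>V\<^esub> f a' q"
    and f_add_right: "\<And>a q q'. a \<in> carrier A \<Longrightarrow> q \<in> carrier Q \<Longrightarrow> q' \<in> carrier Q \<Longrightarrow>
      f a (q \<oplus>\<^bsub>Q\<^esub> q') = f a q \<oplus>\<^bsub>V\<^esub> f a q'"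
    and f_smult_left: "\<And>c a q. a \<in> carrier A \<Longrightarrow> q \<in> carrier Q \<Longrightarrow>
      f (c \<odot>\<^bsub>A\<^esub> a) q = c \<odot>\<^bsub>V\<^esub> f a q"
    and f_smult_right: "\<And>c a q. a \<in> carrier A \<Longrightarrow> q \<in> carrier Q \<Longrightarrow>
      f a (c \<odot>\<^bsub>Q\<^esub> q) = c \<odot>\<^bsub>V\<^esub> f a q"
    and f_homog: "\<And>a q i j. a \<in> homog A i \<Longrightarrow> q \<in> homog Q j \<Longrightarrow> f a q \<in> homog V (i + j)"
    and g_closed: "\<And>p b. p \<in> carrier P \<Longrightarrow> b \<in> carrier B \<Longrightarrow> g p b \<in> carrier W"
    and g_add_left: "\<And>p p' b. p \<in> carrier P \<Longrightarrow> p' \<in> carrier P \<Longrightarrow> b \<in> carrier B \<Longrightarrow>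
      g (p \<oplus>\<^bsub>P\<^esub> p') b = g p b \<oplus>\<^bsub>W\<^esub> g p' b"
    and g_add_right: "\<And>p b b'. p \<in> carrier P \<Longrightarrow> b \<in> carrier B \<Longrightarrow> b' \<in> carrier B \<Longrightarrow>
      g p (b \<oplus>\<^bsub>B\<^esub> b') = g p b \<oplus>\<^bsub>W\<^esub> g p b'"
    and g_smult_left: "\<And>c p b. p \<in> carrier P \<Longrightarrow> b \<in> carrier B \<Longrightarrow>
      g (c \<odot>\<^bsub>P\<^esub> p) b = c \<odot>\<^bsub>W\<^esub> g p b"
    and g_smult_right: "\<And>c p b. p \<in> carrier P \<Longrightarrow> b \<in> carrier B \<Longrightarrow>
      g p (c \<odot>\<^bsub>B\<^esub> b) = c \<odot>\<^bsub>W\<^esub> g p b"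
    and g_homog: "\<And>p b i j. p \<in> homog P i \<Longrightarrow> b \<in> homog B j \<Longrightarrow> g p b \<in> homog W (i + j)"
begin

interpretation P: super_vector_space P by (rule svs)
interpretation Q: super_vector_space Q by (rule svs)

sublocale AP: tensor_modules A P
  using svs by (intro tensor_modules.intro) (simp_all add: super_vector_space_def)
sublocale QB: tensor_modules Q B
  using svs by (intro tensor_modules.intro) (simp_all add: super_vector_space_def)
sublocale VW: tensor_modules V W
  using svs by (intro tensor_modules.intro) (simp_all add: super_vector_space_def)
sublocale TS: module complex_ring VW.TS
  by (rule VW.TS_module)

abbreviation "kp \<equiv> koszul_product P Q V W f g"

text \<open>The product of one pair of free generators before passing to cosets, that is, the inner
  double sum of \<open>koszul_product\<close>. It is multilinear only modulo the bilinearity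
  relations, since each pair is a generator of its own.\<close>

definition kappa :: "'a \<Rightarrow> 'p \<Rightarrow> 'q \<Rightarrow> 'b \<Rightarrow> ('v \<times> 'w \<Rightarrow>\<^sub>0 complex)" where
  "kappa a1 a2 b1 b2 = (\<Sum>i\<in>{0, 1}. \<Sum>j\<in>{0, 1}.
     scal (parity_sign (i * j)) (VW.tens (f a1 (homog_part Q j b1)) (g (homog_part P i a2) b2)))"

definition kappa_ext where
  "kappa_ext s t = lext (\<lambda>(a1, a2). lext (\<lambda>(b1, b2). kappa a1 a2 b1 b2) t) s"

lemma kp_conv_kappa_ext: "kp S T = (\<Union>s\<in>S. \<Union>t\<in>T. VW.cls (kappa_ext s t))"
  unfolding koszul_product_def kappa_ext_def
  by (simp add: lext_def kappa_def case_prod_beta scal_sum scal_distribs mult_ac)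

lemma kappa_closed:
  assumes "a1 \<in> carrier A" "a2 \<in> carrier P" "b1 \<in> carrier Q" "b2 \<in> carrier B"
  shows "kappa a1 a2 b1 b2 \<in> carrier VW.TF"
  unfolding kappa_def using assms by (simp add: f_closed g_closed)

lemma kappa_add:
  assumes "a1 \<in> carrier A" "a2 \<in> carrier P" "b1 \<in> carrier Q" "b2 \<in> carrier B"
  shows "a1' \<in> carrier A \<Longrightarrow> kappa (a1 \<oplus>\<^bsub>A\<^esub> a1') a2 b1 b2 - kappa a1 a2 b1 b2 - kappa a1' a2 b1 b2 \<in> VW.TN"
    and "a2' \<in> carrier P \<Longrightarrow> kappa a1 (a2 \<oplus>\<^bsub>P\<^esub> a2') b1 b2 - kappa a1 a2 b1 b2 - kappa a1 a2' b1 b2 \<in> VW.TN"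
    and "b1' \<in> carrier Q \<Longrightarrow> kappa a1 a2 (b1 \<oplus>\<^bsub>Q\<^esub> b1') b2 - kappa a1 a2 b1 b2 - kappa a1 a2 b1' b2 \<in> VW.TN"
    and "b2' \<in> carrier B \<Longrightarrow> kappa a1 a2 b1 (b2 \<oplus>\<^bsub>B\<^esub> b2') - kappa a1 a2 b1 b2 - kappa a1 a2 b1 b2' \<in> VW.TN"
proof -
  note fold = sum_subtractf[symmetric] scal_distribs(2)[symmetric]
  note closed = assms P.homog_part_closed Q.homog_part_closed f_closed g_closed
  show "a1' \<in> carrier A \<Longrightarrow> kappa (a1 \<oplus>\<^bsub>A\<^esub> a1') a2 b1 b2 - kappa a1 a2 b1 b2 - kappa a1' a2 b1 b2 \<in> VW.TN"
    unfolding kappa_def fold using closed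
    by (intro VW.TN_sum VW.TN_scal) (simp add: f_add_left VW.relator_add_left)
  show "a2' \<in> carrier P \<Longrightarrow> kappa a1 (a2 \<oplus>\<^bsub>P\<^esub> a2') b1 b2 - kappa a1 a2 b1 b2 - kappa a1 a2' b1 b2 \<in> VW.TN"
    unfolding kappa_def fold using closed
    by (intro VW.TN_sum VW.TN_scal) (simp add: P.homog_part_add g_add_left VW.relator_add_right)
  show "b1' \<in> carrier Q \<Longrightarrow> kappa a1 a2 (b1 \<oplus>\<^bsub>Q\<^esub> b1') b2 - kappa a1 a2 b1 b2 - kappa a1 a2 b1' b2 \<in> VW.TN"
    unfolding kappa_def fold using closed
    by (intro VW.TN_sum VW.TN_scal) (simp add: Q.homog_part_add f_add_right VW.relator_add_left)
  show "b2' \<in> carrier B \<Longrightarrow> kappa a1 a2 b1 (b2 \<oplus>\<^bsub>B\<^esub> b2') - kappa a1 a2 b1 b2 - kappa a1 a2 b1 b2' \<in> VW.TN"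
    unfolding kappa_def fold using closed
    by (intro VW.TN_sum VW.TN_scal) (simp add: g_add_right VW.relator_add_right)
qed

lemma kappa_smult:
  assumes "a1 \<in> carrier A" "a2 \<in> carrier P" "b1 \<in> carrier Q" "b2 \<in> carrier B"
  shows "kappa (c \<odot>\<^bsub>A\<^esub> a1) a2 b1 b2 - scal c (kappa a1 a2 b1 b2) \<in> VW.TN"
    and "kappa a1 (c \<odot>\<^bsub>P\<^esub> a2) b1 b2 - scal c (kappa a1 a2 b1 b2) \<in> VW.TN"
    and "kappa a1 a2 (c \<odot>\<^bsub>Q\<^esub> b1) b2 - scal c (kappa a1 a2 b1 b2) \<in> VW.TN"
    and "kappa a1 a2 b1 (c \<odot>\<^bsub>B\<^esub> b2) - scal c (kappa a1 a2 b1 b2) \<in> VW.TN"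
  unfolding kappa_def scal_sum scal_commute[of c] sum_subtractf[symmetric] scal_distribs(2)[symmetric]
  by (intro VW.TN_sum VW.TN_scal; use assms in \<open>simp add: f_closed g_closed P.homog_part_smult
    Q.homog_part_smult f_smult_left f_smult_right g_smult_left g_smult_right VW.relator_smult_left VW.relator_smult_right\<close>)+

text \<open>For each generator occurring in \<open>t\<close>, \<open>kappa\<close> is bilinear in
  its first two arguments modulo \<open>VW.TN\<close>, so \<open>lext_TN_mem\<close> applies.
  Additivity holds on carriers only, whence the condition on \<open>t\<close>.\<close>

lemma kappa_ext_left:
  assumes s: "s \<in> AP.TN" and t: "t \<in> carrier QB.TF"
  shows "kappa_ext s t \<in> VW.TN"
proof -
  have keys: "b1 \<in> carrier Q \<and> b2 \<in> carrier B" if "(b1, b2) \<in> Poly_Mapping.keys t" for b1 b2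
    using t that by (auto simp: QB.TF_carrier)
  show ?thesis
    unfolding kappa_ext_def
    by (rule AP.lext_TN_mem[OF s])
      (auto simp: VW.TN_add VW.TN_scal kappa_add kappa_smult
        simp flip: lext_fun_diff lext_fun_scal intro!: VW.lext_TN dest!: keys)
qed

lemma kappa_ext_right:
  assumes s: "s \<in> carrier AP.TF" and t: "t \<in> QB.TN"
  shows "kappa_ext s t \<in> VW.TN"
proof -
  have keys: "a1 \<in> carrier A \<and> a2 \<in> carrier P" if "(a1, a2) \<in> Poly_Mapping.keys s" for a1 a2
    using s that by (auto simp: AP.TF_carrier)
  have "lext (\<lambda>(b1, b2). kappa a1 a2 b1 b2) t \<in> VW.TN" if "a1 \<in> carrier A \<and> a2 \<in> carrier P" for a1 a2
    by (rule QB.lext_TN_mem[OF t])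
      (use that in \<open>simp_all add: VW.TN_add VW.TN_scal kappa_add kappa_smult\<close>)
  then show ?thesis
    unfolding kappa_ext_def by (intro VW.lext_TN) (auto dest: keys)
qed

lemma kappa_ext_bilinear:
  "kappa_ext (s + s') t = kappa_ext s t + kappa_ext s' t"
  "kappa_ext (s - s') t = kappa_ext s t - kappa_ext s' t"
  "kappa_ext (scal c s) t = scal c (kappa_ext s t)"
  "kappa_ext s (t + t') = kappa_ext s t + kappa_ext s t'"
  "kappa_ext s (t - t') = kappa_ext s t - kappa_ext s t'"
  "kappa_ext s (scal c t) = scal c (kappa_ext s t)"
  unfolding kappa_ext_def
  by (simp_all add: lext_simps case_prod_beta' lext_fun_add lext_fun_diff lext_fun_scal)

lemma kappa_ext_closed:
  assumes "s \<in> carrier AP.TF" "t \<in> carrier QB.TF"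
  shows "kappa_ext s t \<in> carrier VW.TF"
  unfolding kappa_ext_def using assms
  by (auto intro!: VW.lext_TF kappa_closed simp: AP.TF_carrier QB.TF_carrier)

lemma kp_cls:
  assumes s: "s \<in> carrier AP.TF" and t: "t \<in> carrier QB.TF"
  shows "kp (AP.cls s) (QB.cls t) = VW.cls (kappa_ext s t)"
proof -
  have "VW.cls (kappa_ext s' t') = VW.cls (kappa_ext s t)" if "s' \<in> AP.cls s" "t' \<in> QB.cls t" for s' t'
  proof -
    have d: "s' - s \<in> AP.TN" "t' - t \<in> QB.TN"
      using that by (simp_all add: AP.mem_cls_iff QB.mem_cls_iff)
    have "t' \<in> carrier QB.TF"
      using QB.TF_closed(2)[OF QB.TN_closed[OF d(2)] t] by simp
    \<comment> \<open>The change of representatives splits as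
      \<open>kappa_ext (s' - s) t' + kappa_ext s (t' - t)\<close>.\<close>
    from VW.TN_add[OF kappa_ext_left[OF d(1) this] kappa_ext_right[OF s d(2)]]
    show ?thesis by (simp add: VW.cls_eq_iff kappa_ext_bilinear)
  qed
  moreover have "s \<in> AP.cls s" "t \<in> QB.cls t"
    by (rule AP.cls_self, rule QB.cls_self)
  ultimately show ?thesis
    unfolding kp_conv_kappa_ext by blast
qed

lemma kp_closed [simp]:
  "S \<in> carrier AP.TS \<Longrightarrow> T \<in> carrier QB.TS \<Longrightarrow> kp S T \<in> carrier VW.TS"
  by (elim AP.TS_cases QB.TS_cases) (simp add: kp_cls kappa_ext_closed)

lemma kp_add_left:
  "S \<in> carrier AP.TS \<Longrightarrow> S' \<in> carrier AP.TS \<Longrightarrow> T \<in> carrier QB.TS \<Longrightarrow>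
    kp (S \<oplus>\<^bsub>AP.TS\<^esub> S') T = kp S T \<oplus>\<^bsub>VW.TS\<^esub> kp S' T"
  by (elim AP.TS_cases QB.TS_cases)
    (simp add: kp_cls AP.TS_add VW.TS_add kappa_ext_bilinear)

lemma kp_add_right:
  "S \<in> carrier AP.TS \<Longrightarrow> T \<in> carrier QB.TS \<Longrightarrow> T' \<in> carrier QB.TS \<Longrightarrow>
    kp S (T \<oplus>\<^bsub>QB.TS\<^esub> T') = kp S T \<oplus>\<^bsub>VW.TS\<^esub> kp S T'"
  by (elim AP.TS_cases QB.TS_cases)
    (simp add: kp_cls QB.TS_add VW.TS_add kappa_ext_bilinear)

lemma kp_smult_left:
  "S \<in> carrier AP.TS \<Longrightarrow> T \<in> carrier QB.TS \<Longrightarrow>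
    kp (c \<odot>\<^bsub>AP.TS\<^esub> S) T = c \<odot>\<^bsub>VW.TS\<^esub> kp S T"
  by (elim AP.TS_cases QB.TS_cases)
    (simp add: kp_cls AP.TS_smult VW.TS_smult kappa_ext_bilinear)

lemma kp_smult_right:
  "S \<in> carrier AP.TS \<Longrightarrow> T \<in> carrier QB.TS \<Longrightarrow>
    kp S (c \<odot>\<^bsub>QB.TS\<^esub> T) = c \<odot>\<^bsub>VW.TS\<^esub> kp S T"
  by (elim AP.TS_cases QB.TS_cases)
    (simp add: kp_cls QB.TS_smult VW.TS_smult kappa_ext_bilinear)

text \<open>For homogeneous \<open>a2\<close> and \<open>b1\<close> only one of the four summands
  over the parities survives; the others contain a zero factor.\<close>

lemma kp_pure:
  assumes "a1 \<in> carrier A" "a2 \<in> homog P i" "b1 \<in> homog Q j" "b2 \<in> carrier B"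
  shows "kp (AP.pt a1 a2) (QB.pt b1 b2) = parity_sign (i * j) \<odot>\<^bsub>VW.TS\<^esub> VW.pt (f a1 b1) (g a2 b2)"
proof -
  have c: "a2 \<in> carrier P" "b1 \<in> carrier Q"
    using assms P.homog_closed Q.homog_closed by auto
  have z: "f a1 \<zero>\<^bsub>Q\<^esub> = \<zero>\<^bsub>V\<^esub>" "g \<zero>\<^bsub>P\<^esub> b2 = \<zero>\<^bsub>W\<^esub>"
    using f_smult_right[of a1 "\<zero>\<^bsub>Q\<^esub>" 0] g_smult_left[of "\<zero>\<^bsub>P\<^esub>" b2 0] assms
      f_closed[of a1 "\<zero>\<^bsub>Q\<^esub>"] g_closed[of "\<zero>\<^bsub>P\<^esub>" b2]
    by (simp_all add: VW.V.smult_l_null[simplified] VW.W.smult_l_null[simplified]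
        P.smult_l_null[simplified] Q.smult_l_null[simplified])
  show ?thesis
    using assms c
    by (cases i; cases j)
      (simp_all add: AP.pt_conv QB.pt_conv kp_cls kappa_ext_def kappa_def P.homog_part_of_homog
        Q.homog_part_of_homog VW.cls_single TS.smult_r_null[simplified] f_closed g_closed z VW.pt_zero_left VW.pt_zero_right flip: VW.TS_add)
qed

end

text \<open>
  Both bracketings of homogeneous pure tensors carry the sign
  \<open>(-1)^(p(a2) p(b1) + p(a2) p(c1) + p(b2) p(c1))\<close>.
\<close>

lemma koszul_product_assoc:
  assumes 1: "koszul_pairing A1 A2 B1 B2 D1 D2 f g"
    and 2: "koszul_pairing D1 D2 C1 C2 E1 E2 f' g'"
    and 3: "koszul_pairing B1 B2 C1 C2 G1 G2 h k"
    and 4: "koszul_pairing A1 A2 G1 G2 E1 E2 h' k'"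
    and f_assoc: "\<And>a b c. a \<in> carrier A1 \<Longrightarrow> b \<in> carrier B1 \<Longrightarrow> c \<in> carrier C1 \<Longrightarrow>
      f' (f a b) c = h' a (h b c)"
    and g_assoc: "\<And>a b c. a \<in> carrier A2 \<Longrightarrow> b \<in> carrier B2 \<Longrightarrow> c \<in> carrier C2 \<Longrightarrow>
      g' (g a b) c = k' a (k b c)"
    and S: "S \<in> carrier (tensor_space A1 A2)" and T: "T \<in> carrier (tensor_space B1 B2)"
    and U: "U \<in> carrier (tensor_space C1 C2)"
  shows "koszul_product D2 C1 E1 E2 f' g' (koszul_product A2 B1 D1 D2 f g S T) U =
         koszul_product A2 G1 E1 E2 h' k' S (koszul_product B2 C1 G1 G2 h k T U)"
proof -
  interpret K1: koszul_pairing A1 A2 B1 B2 D1 D2 f g by (rule 1)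
  interpret K2: koszul_pairing D1 D2 C1 C2 E1 E2 f' g' by (rule 2)
  interpret K3: koszul_pairing B1 B2 C1 C2 G1 G2 h k by (rule 3)
  interpret K4: koszul_pairing A1 A2 G1 G2 E1 E2 h' k' by (rule 4)
  note closed = super_vector_space.homog_closed
  show ?thesis
    using K1.svs(1) K1.svs(2) S
  proof (induction S rule: tensor_homog_induct)
    case (add x y)
    then show ?case
      using T U by (simp add: K1.kp_add_left K2.kp_add_left K4.kp_add_left)
  next
    case (pure a1 a2 i1 i2)
    show ?case
      using K1.svs(3) K1.svs(4) T
    proof (induction T rule: tensor_homog_induct)
      case (add x y)
      then show ?case
        using U pure closed[OF K1.svs(1)] closed[OF K1.svs(2)]
        by (simp add: K1.kp_add_right K2.kp_add_left K3.kp_add_left K4.kp_add_right)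
    next
      case pureT: (pure b1 b2 j1 j2)
      show ?case
        using K3.svs(3) K3.svs(4) U
      proof (induction U rule: tensor_homog_induct)
        case (add x y)
        then show ?case
          using pure pureT closed[OF K1.svs(1)] closed[OF K1.svs(2)] closed[OF K1.svs(3)] closed[OF K1.svs(4)]
          by (simp add: K2.kp_add_right K3.kp_add_right K4.kp_add_right)
      next
        case pureU: (pure c1 c2 k1 k2)
        have c: "a1 \<in> carrier A1" "a2 \<in> carrier A2" "b1 \<in> carrier B1" "b2 \<in> carrier B2"
          "c1 \<in> carrier C1" "c2 \<in> carrier C2"
          using pure pureT pureU closed[OF K1.svs(1)] closed[OF K1.svs(2)] closed[OF K1.svs(3)]
            closed[OF K1.svs(4)] closed[OF K2.svs(3)] closed[OF K2.svs(4)] by auto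
        have "parity_sign (i2 * j1) * parity_sign ((i2 + j2) * k1) =
          parity_sign (j2 * k1) * parity_sign (i2 * (j1 + k1))"
          by (simp add: distrib_left distrib_right parity_sign_add)
        then show ?case
          using c pure pureT pureU
          by (simp add: K1.kp_pure K3.kp_pure K2.kp_smult_left K4.kp_smult_right
              K2.kp_pure[OF _ K1.g_homog] K4.kp_pure[OF _ _ K3.f_homog] K1.f_closed K1.g_closed
              K3.f_closed K3.g_closed f_assoc g_assoc K2.f_closed K2.g_closed K4.f_closed K4.g_closed
              K2.TS.smult_assoc1[simplified, symmetric])
      qed
    qed
  qed
qed

section \<open>Tensor products of linear maps\<close>

lemma linear_mapD:
  assumes "linear_map V W f"
  shows "v \<in> carrier V \<Longrightarrow> f v \<in> carrier W"
    and "u \<in> carrier V \<Longrightarrow> v \<in> carrier V \<Longrightarrow> f (u \<oplus>\<^bsub>V\<^esub> v) = f u \<oplus>\<^bsub>W\<^esub> f v"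
    and "v \<in> carrier V \<Longrightarrow> f (c \<odot>\<^bsub>V\<^esub> v) = c \<odot>\<^bsub>W\<^esub> f v"
  using assms by (auto simp: linear_map_def)

locale tensor_linear_maps = D: tensor_modules A B + C: tensor_modules V W
  for A :: "(complex, 'a, 'x1) module_scheme" and B :: "(complex, 'b, 'x2) module_scheme"
    and V :: "(complex, 'v, 'x3) module_scheme" and W :: "(complex, 'w, 'x4) module_scheme" +
  fixes f g
  assumes f: "linear_map A V f" and g: "linear_map B W g"
begin

abbreviation "tm \<equiv> tensor_map V W f g"

text \<open>Two representatives differ by an element of \<open>D.TN\<close>, which the linear maps
  send into \<open>C.TN\<close>.\<close>

lemma tensor_map_cls:
  assumes "p \<in> carrier D.TF"
  shows "tm (D.cls p) = C.cls (lext (\<lambda>(a, b). C.tens (f a) (g b)) p)"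
proof -
  let ?L = "lext (\<lambda>(a, b). C.tens (f a) (g b))"
  have conv: "(\<Sum>(a, b)\<in>Poly_Mapping.keys p.
      Poly_Mapping.single (f a, g b) (Poly_Mapping.lookup p (a, b))) = ?L p" for p
    by (simp add: lext_def case_prod_beta)
  have "?L p \<in> C.TN" if "p \<in> D.TN" for p
    by (rule D.lext_TN_mem[OF that])
      (simp_all add: C.TN_add C.TN_scal linear_mapD[OF f] linear_mapD[OF g] C.relator_add_left
        C.relator_add_right C.relator_smult_left C.relator_smult_right)
  then have "C.cls (?L p') = C.cls (?L p)" if "p' \<in> D.cls p" for p'
    using that by (simp add: D.mem_cls_iff C.cls_eq_iff flip: lext_diff)
  moreover have "p \<in> D.cls p" by (rule D.cls_self)
  ultimately show ?thesis
    unfolding tensor_map_def conv by blast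
qed

lemma tm_closed [simp]: "S \<in> carrier D.TS \<Longrightarrow> tm S \<in> carrier C.TS"
proof (elim D.TS_cases)
  fix p assume p: "S = D.cls p" "p \<in> carrier D.TF"
  have "lext (\<lambda>(a, b). C.tens (f a) (g b)) p \<in> carrier C.TF"
    using p(2) by (intro C.lext_TF) (auto simp: D.TF_carrier linear_mapD[OF f] linear_mapD[OF g])
  then show ?thesis using p by (simp add: tensor_map_cls)
qed

lemma tm_add: "S \<in> carrier D.TS \<Longrightarrow> T \<in> carrier D.TS \<Longrightarrow> tm (S \<oplus>\<^bsub>D.TS\<^esub> T) = tm S \<oplus>\<^bsub>C.TS\<^esub> tm T"
  by (elim D.TS_cases) (simp add: D.TS_add C.TS_add tensor_map_cls lext_simps)

lemma tm_smult: "S \<in> carrier D.TS \<Longrightarrow> tm (c \<odot>\<^bsub>D.TS\<^esub> S) = c \<odot>\<^bsub>C.TS\<^esub> tm S"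
  by (elim D.TS_cases) (simp add: D.TS_smult C.TS_smult tensor_map_cls lext_simps)

lemma tm_pure: "a \<in> carrier A \<Longrightarrow> b \<in> carrier B \<Longrightarrow> tm (D.pt a b) = C.pt (f a) (g b)"
  by (simp add: D.pt_conv C.pt_conv tensor_map_cls)

end


section \<open>The algebra \<open>A \<otimes> A\<close> and its actions on \<open>\<Gamma> \<otimes> A\<close>\<close>

lemma tensor_algebra_simps [simp]:
  "carrier (tensor_algebra A B) = carrier (tensor_space A B)"
  "x \<oplus>\<^bsub>tensor_algebra A B\<^esub> y = x \<oplus>\<^bsub>tensor_space A B\<^esub> y"
  "\<zero>\<^bsub>tensor_algebra A B\<^esub> = \<zero>\<^bsub>tensor_space A B\<^esub>"
  "c \<odot>\<^bsub>tensor_algebra A B\<^esub> x = c \<odot>\<^bsub>tensor_space A B\<^esub> x"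
  "\<one>\<^bsub>tensor_algebra A B\<^esub> = pure_tensor A B \<one>\<^bsub>A\<^esub> \<one>\<^bsub>B\<^esub>"
  "monoid.mult (tensor_algebra A B) = koszul_product B A A B (monoid.mult A) (monoid.mult B)"
  by (simp_all add: tensor_algebra_def)

context superalgebra
begin

lemma superspace: "super_vector_space A"
  by (rule super_vector_space_axioms)

lemma superspace_closed: "a \<in> homog A i \<Longrightarrow> a \<in> carrier A"
  by (rule homog_closed)

sublocale mult: koszul_pairing A A A A A A "monoid.mult A" "monoid.mult A"
  by (intro koszul_pairing.intro superspace)
    ((rule homog_mult; assumption) | simp add: l_distr r_distr smult_mult_left smult_mult_right)+

text \<open>The unit is even, so no sign arises on either side; bilinearity extends this from
  homogeneous pure tensors.\<close>

lemma one_kp [simp]: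
  assumes "T \<in> carrier mult.AP.TS"
  shows "mult.kp (mult.AP.pt \<one>\<^bsub>A\<^esub> \<one>\<^bsub>A\<^esub>) T = T" "mult.kp T (mult.AP.pt \<one>\<^bsub>A\<^esub> \<one>\<^bsub>A\<^esub>) = T"
proof -
  have "mult.kp (mult.AP.pt \<one>\<^bsub>A\<^esub> \<one>\<^bsub>A\<^esub>) T = T \<and> mult.kp T (mult.AP.pt \<one>\<^bsub>A\<^esub> \<one>\<^bsub>A\<^esub>) = T"
    using super_vector_space_axioms super_vector_space_axioms assms
  proof (induction T rule: tensor_homog_induct)
    case (add x y)
    then show ?case by (simp add: mult.kp_add_left mult.kp_add_right)
  next
    case (pure v w i j)
    then show ?case
      using mult.kp_pure[OF _ homog_one pure(1), of "\<one>\<^bsub>A\<^esub>" w]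
        mult.kp_pure[OF _ pure(2) homog_one, of v "\<one>\<^bsub>A\<^esub>"] mult.TS.smult_one[simplified]
      by (simp add: homog_closed)
  qed
  then show "mult.kp (mult.AP.pt \<one>\<^bsub>A\<^esub> \<one>\<^bsub>A\<^esub>) T = T" "mult.kp T (mult.AP.pt \<one>\<^bsub>A\<^esub> \<one>\<^bsub>A\<^esub>) = T"
    by auto
qed

lemma tensor_algebra_ring: "ring (tensor_algebra A A)"
proof (rule ringI)
  show "abelian_group (tensor_algebra A A)"
    using mult.TS.abelian_group_axioms
    by (simp add: abelian_group_def abelian_monoid_def abelian_group_axioms_def tensor_algebra_def)
  show "monoid (tensor_algebra A A)"
    by (rule monoidI)
      (simp_all add: koszul_product_assoc[OF mult.koszul_pairing_axioms mult.koszul_pairing_axioms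
          mult.koszul_pairing_axioms mult.koszul_pairing_axioms] m_assoc)
qed (simp_all add: mult.kp_add_left mult.kp_add_right)

lemma tensor_algebra_module: "module complex_ring (tensor_algebra A A)"
  using tensor_algebra_ring mult.TS.module_axioms
  by (simp add: module_def module_axioms_def ring_def)

end

context super_bimodule
begin

text \<open>\<open>left.kp\<close> is the product that occurs in \<open>right_covariant\<close>. It
  and \<open>right.kp\<close> are the left and right actions of A \<otimes> A on M \<otimes>
  A.\<close>

sublocale left: koszul_pairing A A M A M A "lact M" "monoid.mult A"
  by (intro koszul_pairing.intro superspace M.super_vector_space_axioms)
    ((rule homog_mult homog_lact; assumption) | simp add: l_distr r_distr smult_mult_left smult_mult_right
      lact_closed lact_add_left lact_add_right lact_smult_left lact_smult_right)+

sublocale right: koszul_pairing M A A A M A "ract M" "monoid.mult A"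
  by (intro koszul_pairing.intro superspace M.super_vector_space_axioms)
    ((rule homog_mult homog_ract; assumption) | simp add: l_distr r_distr smult_mult_left smult_mult_right
      ract_closed ract_add_left ract_add_right ract_smult_left ract_smult_right)+

lemma left_assoc:
  assumes "S \<in> carrier mult.AP.TS" "T \<in> carrier mult.AP.TS" "U \<in> carrier left.QB.TS"
  shows "left.kp (mult.kp S T) U = left.kp S (left.kp T U)"
  by (rule koszul_product_assoc[OF mult.koszul_pairing_axioms left.koszul_pairing_axioms
      left.koszul_pairing_axioms left.koszul_pairing_axioms _ _ assms]) (simp_all add: m_assoc lact_mult)

lemma right_assoc:
  assumes "U \<in> carrier left.QB.TS" "S \<in> carrier mult.AP.TS" "T \<in> carrier mult.AP.TS"
  shows "right.kp (right.kp U S) T = right.kp U (mult.kp S T)"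
  by (rule koszul_product_assoc[OF right.koszul_pairing_axioms right.koszul_pairing_axioms
      mult.koszul_pairing_axioms right.koszul_pairing_axioms _ _ assms]) (simp_all add: m_assoc ract_mult)

lemma left_right_assoc:
  assumes "S \<in> carrier mult.AP.TS" "U \<in> carrier left.QB.TS" "T \<in> carrier mult.AP.TS"
  shows "right.kp (left.kp S U) T = left.kp S (right.kp U T)"
  by (rule koszul_product_assoc[OF left.koszul_pairing_axioms right.koszul_pairing_axioms
      right.koszul_pairing_axioms left.koszul_pairing_axioms _ _ assms]) (simp_all add: m_assoc lact_ract)

lemma right_one:
  assumes "U \<in> carrier left.QB.TS"
  shows "right.kp U (mult.AP.pt \<one>\<^bsub>A\<^esub> \<one>\<^bsub>A\<^esub>) = U"
  using M.super_vector_space_axioms superspace assms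
proof (induction U rule: tensor_homog_induct)
  case (add x y)
  then show ?case by (simp add: right.kp_add_left)
next
  case (pure v w i j)
  then show ?case
    using right.kp_pure[OF _ pure(2) homog_one, of v "\<one>\<^bsub>A\<^esub>"] left.TS.smult_one[simplified]
    by (simp add: superspace_closed M.homog_closed ract_one)
qed

end

context super_fodc
begin

sublocale diff: tensor_linear_maps A A \<Gamma> A d id
proof (rule tensor_linear_maps.intro)
  show "tensor_linear_maps_axioms A A \<Gamma> A d id"
    by (rule tensor_linear_maps_axioms.intro[OF diff_linear]) (simp add: linear_map_def)
qed (rule mult.AP.tensor_modules_axioms left.QB.tensor_modules_axioms)+

lemma diff_closed [simp]: "a \<in> carrier A \<Longrightarrow> d a \<in> carrier \<Gamma>"
  by (rule linear_mapD[OF diff_linear])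

definition diff_tensor where "diff_tensor = tensor_map \<Gamma> A d id"

lemmas diff_tensor_closed = diff.tm_closed[folded diff_tensor_def]
  and diff_tensor_add = diff.tm_add[folded diff_tensor_def]
  and diff_tensor_smult = diff.tm_smult[folded diff_tensor_def]
  and diff_tensor_pure = diff.tm_pure[folded diff_tensor_def, unfolded id_apply]

text \<open>
  The sign is \<open>(-1)^(p(a1) + p(a2))\<close>: moving \<open>d\<close> past \<open>a1\<close> costs \<open>p(a1)\<close>, and in the second
  summand the sign rule moves \<open>a2\<close> past \<open>db1\<close> rather than past \<open>b1\<close>.
\<close>

lemma diff_tensor_Leibniz:
  assumes a1: "a1 \<in> homog A i" and a2: "a2 \<in> homog A j" and T: "T \<in> carrier mult.AP.TS"
  shows "diff_tensor (mult.kp (mult.AP.pt a1 a2) T) =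
    right.kp (diff_tensor (mult.AP.pt a1 a2)) T
      \<oplus>\<^bsub>left.QB.TS\<^esub> parity_sign (i + j) \<odot>\<^bsub>left.QB.TS\<^esub> left.kp (mult.AP.pt a1 a2) (diff_tensor T)"
proof -
  define e where "e = parity_sign (i + j)"
  have c: "a1 \<in> carrier A" "a2 \<in> carrier A"
    using a1 a2 superspace_closed by auto
  have "diff_tensor (mult.kp (mult.AP.pt a1 a2) T) =
    right.kp (diff_tensor (mult.AP.pt a1 a2)) T
      \<oplus>\<^bsub>left.QB.TS\<^esub> e \<odot>\<^bsub>left.QB.TS\<^esub> left.kp (mult.AP.pt a1 a2) (diff_tensor T)"
    using superspace superspace T
  proof (induction T rule: tensor_homog_induct)
    case (add x y)
    then show ?case
      using c by (simp add: mult.kp_add_right right.kp_add_right left.kp_add_right diff_tensor_add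
          diff_tensor_closed left.TS.smult_r_distr[simplified] left.TS.a_ac)
  next
    case (pure b1 b2 k l)
    have b: "b1 \<in> carrier A" "b2 \<in> carrier A"
      using pure superspace_closed by auto
    define u where "u = parity_sign (j * k)"
    define v where "v = parity_sign (j * (k + 1))"
    define w where "w = parity_sign i"
    have sgn: "e * v = u * w"
      unfolding e_def u_def v_def w_def by (cases i; cases j; cases k) simp_all
    note prods = mult.kp_pure[OF c(1) a2 pure(1) b(2), folded u_def]
      right.kp_pure[OF diff_closed[OF c(1)] a2 pure(1) b(2), folded u_def]
      left.kp_pure[OF c(1) a2 diff_parity[OF pure(1)] b(2), folded v_def]
    show ?case
      using c b
      by (simp add: prods diff_tensor_smult diff_tensor_pure graded_Leibniz[OF a1, folded w_def]
          left.QB.pt_add_left left.QB.pt_smult_left lact_closed ract_closed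
          left.TS.smult_r_distr[simplified] sgn left.TS.smult_assoc1[simplified, symmetric])
  qed
  then show ?thesis by (simp only: e_def)
qed

end

section \<open>Normal forms in the free algebra\<close>

definition qcong :: "complex \<Rightarrow> ncpoly \<Rightarrow> ncpoly \<Rightarrow> bool" where
  "qcong q p p' \<longleftrightarrow> p - p' \<in> qsp_ideal q"

lemma qcong_refl [simp]: "qcong q p p"
  by (simp add: qcong_def)

lemma qcong_sym: "qcong q p p' \<Longrightarrow> qcong q p' p"
  unfolding qcong_def using qsp_ideal_uminus[of "p - p'"] by simp

lemma qcong_trans [trans]: "qcong q p p' \<Longrightarrow> qcong q p' p'' \<Longrightarrow> qcong q p p''"
  unfolding qcong_def using qsp_ideal_add[of "p - p'" q "p' - p''"] by simp

lemma qcong_scal: "qcong q p p' \<Longrightarrow> qcong q (scal c p) (scal c p')"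
  unfolding qcong_def using qsp_ideal_scal[of "p - p'"] by (simp add: scal_distribs)

lemma qcong_add: "qcong q a a' \<Longrightarrow> qcong q b b' \<Longrightarrow> qcong q (a + b) (a' + b')"
  unfolding qcong_def using qsp_ideal_add[of "a - a'" q "b - b'"] by (simp add: algebra_simps)

lemma qcong_mult: "qcong q a a' \<Longrightarrow> qcong q b b' \<Longrightarrow> qcong q (a * b) (a' * b')"
  unfolding qcong_def
  using qsp_ideal_add[OF qsp_ideal_rmult[of "a - a'" q b] qsp_ideal_lmult[of "b - b'" q a']]
  by (simp add: algebra_simps)

lemmas qcong_lmult = qcong_mult[OF qcong_refl] and qcong_rmult = qcong_mult[OF _ qcong_refl]

lemma qcong_relators:
  "qcong q (nc_monom [GX, GXinv]) 1" "qcong q (nc_monom [GXinv, GX]) 1"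
  "qcong q (nc_monom [GY, GYinv]) 1" "qcong q (nc_monom [GYinv, GY]) 1"
  "qcong q (nc_monom [GX, GY]) (nc_monom [GY, GX])"
  "qcong q (nc_monom [GX, GTheta]) (scal q (nc_monom [GTheta, GX]))"
  "qcong q (nc_monom [GY, GTheta]) (scal q (nc_monom [GTheta, GY]))"
  "qcong q (nc_monom [GTheta, GTheta]) 0"
  unfolding qcong_def by (rule qsp_relators_in_ideal; simp add: qsp_relators_def)+

text \<open>Multiplying \<open>gh = c hg\<close> by the inverse \<open>g'\<close> from both sides
  gives \<open>hg' = c g'h\<close>.\<close>

lemma qcong_commute_inverse:
  assumes "qcong q (nc_monom [g, g']) 1" "qcong q (nc_monom [g', g]) 1"
    and c: "qcong q (nc_monom [g, h]) (scal c (nc_monom [h, g]))" "c \<noteq> 0"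
  shows "qcong q (nc_monom [g', h]) (scal (inverse c) (nc_monom [h, g']))"
proof -
  have "qcong q (nc_monom [g', h] * 1) (nc_monom [g', h] * nc_monom [g, g'])"
    by (rule qcong_lmult[OF qcong_sym[OF assms(1)]])
  also have "nc_monom [g', h] * nc_monom [g, g'] = nc_monom [g'] * nc_monom [h, g] * nc_monom [g']"
    by (simp add: nc_monom_mult)
  also have "qcong q \<dots> (nc_monom [g'] * scal (inverse c) (nc_monom [g, h]) * nc_monom [g'])"
    using qcong_scal[OF c(1), of "inverse c"] c(2)
    by (intro qcong_lmult qcong_rmult) (simp add: qcong_sym)
  also have "\<dots> = scal (inverse c) (nc_monom [g', g] * nc_monom [h, g'])"
    by (simp add: nc_monom_mult scal_mult_left scal_mult_right)
  also have "qcong q \<dots> (scal (inverse c) (1 * nc_monom [h, g']))"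
    by (intro qcong_scal qcong_rmult assms)
  finally show ?thesis by simp
qed

lemma qcong_commute_replicate:
  assumes "qcong q (nc_monom [g, h]) (scal c (nc_monom [h, g]))"
  shows "qcong q (nc_monom (g # replicate n h)) (scal (c ^ n) (nc_monom (replicate n h @ [g])))"
proof (induction n)
  case (Suc n)
  have "nc_monom (g # replicate (Suc n) h) = nc_monom [g, h] * nc_monom (replicate n h)"
    by (simp add: nc_monom_mult)
  also have "qcong q \<dots> (scal c (nc_monom [h, g]) * nc_monom (replicate n h))"
    by (rule qcong_rmult[OF assms])
  also have "\<dots> = scal c (nc_monom [h] * nc_monom (g # replicate n h))"
    by (simp add: nc_monom_mult scal_mult_left)
  also have "qcong q \<dots> (scal c (nc_monom [h] * scal (c ^ n) (nc_monom (replicate n h @ [g]))))"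
    by (intro qcong_scal qcong_lmult Suc)
  finally show ?case by (simp add: nc_monom_mult scal_mult_right)
qed simp

text \<open>The word for the integer power \<open>g^i\<close>, with \<open>g'\<close> the letter for
  the inverse of \<open>g\<close>; the exponent 0 gives the empty word.\<close>

definition zpow_word :: "gen \<Rightarrow> gen \<Rightarrow> int \<Rightarrow> gen list" where
  "zpow_word g g' i = (if i \<ge> 0 then replicate (nat i) g else replicate (nat (- i)) g')"

lemma qcong_commute_zpow:
  assumes "qcong q (nc_monom [h, g]) (nc_monom [g, h])" "qcong q (nc_monom [h, g']) (nc_monom [g', h])"
  shows "qcong q (nc_monom (h # zpow_word g g' i)) (nc_monom (zpow_word g g' i @ [h]))"
  using qcong_commute_replicate[of q h _ 1] assms by (simp add: zpow_word_def)

lemma qcong_zpow_Suc: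
  assumes "qcong q (nc_monom [g, g']) 1"
  shows "qcong q (nc_monom (g # zpow_word g g' i)) (nc_monom (zpow_word g g' (i + 1)))"
proof (cases "i \<ge> 0")
  case True
  then have "g # zpow_word g g' i = zpow_word g g' (i + 1)"
    by (simp add: zpow_word_def nat_add_distrib)
  then show ?thesis by simp
next
  case False
  \<comment> \<open>A negative exponent is \<open>-(n + 1)\<close>: the word starts with
    \<open>g'\<close>, which the new letter cancels.\<close>
  then obtain n where i: "i = - int (Suc n)"
    by (metis int_cases not_less of_nat_0_le_iff)
  then have "zpow_word g g' i = g' # replicate n g'" "zpow_word g g' (i + 1) = replicate n g'"
    by (auto simp: zpow_word_def nat_add_distrib simp flip: replicate_Suc)
  then show ?thesis
    using qcong_rmult[OF assms, of "nc_monom (replicate n g')"] by (simp add: nc_monom_mult)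
qed

lemma qcong_zpow_pred:
  assumes "qcong q (nc_monom [g', g]) 1"
  shows "qcong q (nc_monom (g' # zpow_word g g' i)) (nc_monom (zpow_word g g' (i - 1)))"
proof -
  \<comment> \<open>Exchanging the two letters negates the exponent, which reduces the claim to the
    previous lemma.\<close>
  have swap: "zpow_word g g' i = zpow_word g' g (- i)" for i
    by (auto simp: zpow_word_def)
  show ?thesis
    using qcong_zpow_Suc[OF assms, of "- i"] by (simp add: swap)
qed

text \<open>The triple \<open>(k, i, j)\<close> stands for the monomial \<open>\<theta>^k x^i y^j\<close>.\<close>

definition normal_word :: "nat \<times> int \<times> int \<Rightarrow> gen list" where
  "normal_word = (\<lambda>(k, i, j). replicate k GTheta @ zpow_word GX GXinv i @ zpow_word GY GYinv j)"

text \<open>Letters are inserted from the right end of the word. Moving x or y past \<theta>^k costs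
  \<open>q ^ k\<close>, moving an inverse letter costs \<open>inverse q ^ k\<close>. As \<theta>^2 =
  0, a second \<theta> sets the coefficient to 0, and the exponent stays at 1.\<close>

fun nf_word :: "complex \<Rightarrow> gen list \<Rightarrow> complex \<times> nat \<times> int \<times> int" where
  "nf_word q [] = (1, 0, 0, 0)"
| "nf_word q (g # w) = (case nf_word q w of (c, k, i, j) \<Rightarrow>
     (case g of GX \<Rightarrow> (c * q ^ k, k, i + 1, j) | GXinv \<Rightarrow> (c * inverse q ^ k, k, i - 1, j)
      | GY \<Rightarrow> (c * q ^ k, k, i, j + 1) | GYinv \<Rightarrow> (c * inverse q ^ k, k, i, j - 1)
      | GTheta \<Rightarrow> (if k = 0 then c else 0, 1, i, j)))"

text \<open>The letter first moves past \<theta>^k at the price \<open>c ^ k\<close>; the assumption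
  \<open>rest\<close> treats what remains, a product of powers of x and y.\<close>

lemma qcong_normal_word_even:
  assumes theta: "qcong q (nc_monom [g, GTheta]) (scal c (nc_monom [GTheta, g]))"
    and rest: "qcong q (nc_monom (g # normal_word (0, i, j))) (nc_monom (normal_word (0, i', j')))"
  shows "qcong q (nc_monom (g # normal_word (k, i, j))) (scal (c ^ k) (nc_monom (normal_word (k, i', j'))))"
proof -
  have "nc_monom (g # normal_word (k, i, j)) =
      nc_monom (g # replicate k GTheta) * nc_monom (normal_word (0, i, j))"
    by (simp add: normal_word_def nc_monom_mult)
  also have "qcong q \<dots> (scal (c ^ k) (nc_monom (replicate k GTheta @ [g])) * nc_monom (normal_word (0, i, j)))"
    by (intro qcong_rmult qcong_commute_replicate theta)
  also have "\<dots> = scal (c ^ k) (nc_monom (replicate k GTheta) * nc_monom (g # normal_word (0, i, j)))"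
    by (simp add: scal_mult_left nc_monom_mult)
  also have "qcong q \<dots> (scal (c ^ k) (nc_monom (replicate k GTheta) * nc_monom (normal_word (0, i', j'))))"
    by (intro qcong_scal qcong_lmult rest)
  also have "\<dots> = scal (c ^ k) (nc_monom (normal_word (k, i', j')))"
    by (simp add: normal_word_def nc_monom_mult)
  finally show ?thesis .
qed

lemma qcong_normal_word_x:
  assumes "qcong q (nc_monom (g # zpow_word GX GXinv i)) (nc_monom (zpow_word GX GXinv i'))"
  shows "qcong q (nc_monom (g # normal_word (0, i, j))) (nc_monom (normal_word (0, i', j)))"
  using qcong_rmult[OF assms, of "nc_monom (zpow_word GY GYinv j)"]
  by (simp add: normal_word_def nc_monom_mult)

lemma qcong_normal_word_y:
  assumes "qcong q (nc_monom [g, GX]) (nc_monom [GX, g])" "qcong q (nc_monom [g, GXinv]) (nc_monom [GXinv, g])"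
    and "qcong q (nc_monom (g # zpow_word GY GYinv j)) (nc_monom (zpow_word GY GYinv j'))"
  shows "qcong q (nc_monom (g # normal_word (0, i, j))) (nc_monom (normal_word (0, i, j')))"
proof -
  let ?x = "zpow_word GX GXinv i"
  have "nc_monom (g # normal_word (0, i, j)) = nc_monom (g # ?x) * nc_monom (zpow_word GY GYinv j)"
    by (simp add: normal_word_def nc_monom_mult)
  also have "qcong q \<dots> (nc_monom (?x @ [g]) * nc_monom (zpow_word GY GYinv j))"
    by (intro qcong_rmult qcong_commute_zpow assms)
  also have "\<dots> = nc_monom ?x * nc_monom (g # zpow_word GY GYinv j)"
    by (simp add: nc_monom_mult)
  also have "qcong q \<dots> (nc_monom ?x * nc_monom (zpow_word GY GYinv j'))"
    by (intro qcong_lmult assms)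
  finally show ?thesis by (simp add: normal_word_def nc_monom_mult)
qed

lemma qcong_nf_word:
  assumes "q \<noteq> 0"
  shows "case nf_word q w of (c, m) \<Rightarrow> qcong q (nc_monom w) (scal c (nc_monom (normal_word m)))"
proof (induction w)
  case Nil
  show ?case by (simp add: normal_word_def zpow_word_def)
next
  case (Cons g w)
  obtain c k i j where nf: "nf_word q w = (c, k, i, j)"
    by (metis prod_cases4)
  note R = qcong_relators[of q]
  have X: "qcong q (nc_monom [GX, GTheta]) (scal q (nc_monom [GTheta, GX]))"
    "qcong q (nc_monom [GXinv, GTheta]) (scal (inverse q) (nc_monom [GTheta, GXinv]))"
    "qcong q (nc_monom [GY, GTheta]) (scal q (nc_monom [GTheta, GY]))"
    "qcong q (nc_monom [GYinv, GTheta]) (scal (inverse q) (nc_monom [GTheta, GYinv]))"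
    using qcong_commute_inverse[OF R(1,2,6)] qcong_commute_inverse[OF R(3,4,7)] R assms by auto
  have YX: "qcong q (nc_monom [GY, GX]) (nc_monom [GX, GY])"
    using R(5) by (rule qcong_sym)
  have Y'X: "qcong q (nc_monom [GYinv, GX]) (nc_monom [GX, GYinv])"
    using qcong_commute_inverse[OF R(3,4), of GX 1] YX by simp
  have YX': "qcong q (nc_monom [GY, GXinv]) (nc_monom [GXinv, GY])"
    using qcong_commute_inverse[OF R(1,2), of GY 1] R(5) by (simp add: qcong_sym)
  have Y'X': "qcong q (nc_monom [GYinv, GXinv]) (nc_monom [GXinv, GYinv])"
    using qcong_commute_inverse[OF R(3,4), of GXinv 1] YX' by simp
  \<comment> \<open>The tail is already in normal form, so only one letter has to be
    inserted.\<close>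
  have step: "case nf_word q (g # w) of (c', m) \<Rightarrow>
      qcong q (scal c (nc_monom (g # normal_word (k, i, j)))) (scal c' (nc_monom (normal_word m)))"
  proof (cases g)
    case GX
    then show ?thesis
      using qcong_scal[OF qcong_normal_word_even[OF X(1) qcong_normal_word_x[OF qcong_zpow_Suc[OF R(1)]]]]
      by (simp add: nf)
  next
    case GXinv
    then show ?thesis
      using qcong_scal[OF qcong_normal_word_even[OF X(2) qcong_normal_word_x[OF qcong_zpow_pred[OF R(2)]]]]
      by (simp add: nf)
  next
    case GY
    then show ?thesis
      using qcong_scal[OF qcong_normal_word_even[OF X(3) qcong_normal_word_y[OF YX YX' qcong_zpow_Suc[OF R(3)]]]]
      by (simp add: nf)
  next
    case GYinv
    then show ?thesis
      using qcong_scal[OF qcong_normal_word_even[OF X(4) qcong_normal_word_y[OF Y'X Y'X' qcong_zpow_pred[OF R(4)]]]]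
      by (simp add: nf)
  next
    case GTheta
    show ?thesis
    proof (cases k)
      case 0
      then show ?thesis by (simp add: GTheta nf normal_word_def)
    next
      case (Suc n)
      then show ?thesis
        using qcong_scal[OF qcong_rmult[OF R(8), of "nc_monom (normal_word (n, i, j))"], of c]
        by (simp add: GTheta nf normal_word_def nc_monom_mult)
    qed
  qed
  have "qcong q (nc_monom [g] * nc_monom w) (nc_monom [g] * scal c (nc_monom (normal_word (k, i, j))))"
    using Cons by (intro qcong_lmult) (simp add: nf)
  then have "qcong q (nc_monom (g # w)) (scal c (nc_monom (g # normal_word (k, i, j))))"
    by (simp add: nc_monom_mult scal_mult_right)
  from qcong_trans[OF this] step show ?case
    by (simp only: case_prod_unfold)
qed

text \<open>
  Linear independence of the normal words is not needed: equality of normal forms is only used as a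
  sufficient criterion for congruence modulo the ideal, which the simplifier can decide.
\<close>

definition nf :: "complex \<Rightarrow> ncpoly \<Rightarrow> (nat \<times> int \<times> int) \<Rightarrow>\<^sub>0 complex" where
  "nf q = lext (\<lambda>w. case nf_word q (letters w) of (c, m) \<Rightarrow> Poly_Mapping.single m c)"

lemma nf_simps [simp]:
  "nf q (p + p') = nf q p + nf q p'" "nf q (p - p') = nf q p - nf q p'" "nf q (- p) = - nf q p"
  "nf q (scal c p) = scal c (nf q p)" "nf q 0 = 0"
  "nf q (nc_monom w) = (case nf_word q w of (c, m) \<Rightarrow> Poly_Mapping.single m c)"
  by (simp_all add: nf_def lext_simps nc_monom_def)

lemma qcong_nf:
  assumes "q \<noteq> 0"
  shows "qcong q p (lext (\<lambda>m. nc_monom (normal_word m)) (nf q p))"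
proof (induction p rule: ncpoly_induct)
  case (monom c gs)
  then show ?case
    using qcong_scal[OF qcong_nf_word[OF assms, of gs, unfolded case_prod_unfold], of c]
    by (simp add: case_prod_unfold mult.commute)
next
  case (add f g)
  then show ?case by (simp add: lext_add qcong_add)
qed simp

lemma qsp_ideal_nfI: "q \<noteq> 0 \<Longrightarrow> nf q p = 0 \<Longrightarrow> p \<in> qsp_ideal q"
  using qcong_nf[of q p] by (simp add: qcong_def)

lemma qsp_class_nfI: "q \<noteq> 0 \<Longrightarrow> nf q p = nf q p' \<Longrightarrow> qsp_class q p = qsp_class q p'"
  by (simp add: qsp_class_eq_iff qsp_ideal_nfI)

section \<open>The superalgebra structure\<close>

lemma word_parity_simps [simp]:
  "word_parity 0 = 0" "word_parity (u + v) = word_parity u + word_parity v"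
  "word_parity (Word []) = 0"
  "word_parity (Word (g # gs)) = of_bool (g = GTheta) + word_parity (Word gs)"
  by (simp_all add: word_parity_def zero_word_def plus_word_def)

definition hom_poly :: "bit \<Rightarrow> ncpoly \<Rightarrow> bool" where
  "hom_poly i p \<longleftrightarrow> (\<forall>w\<in>Poly_Mapping.keys p. word_parity w = i)"

lemma hom_poly_zero [simp]: "hom_poly i 0"
  by (simp add: hom_poly_def)

lemma hom_poly_one: "hom_poly 0 1"
  by (simp add: hom_poly_def)

lemma hom_poly_monom: "word_parity (Word gs) = i \<Longrightarrow> hom_poly i (nc_monom gs)"
  by (simp add: hom_poly_def nc_monom_def)

lemma hom_poly_add: "hom_poly i p \<Longrightarrow> hom_poly i p' \<Longrightarrow> hom_poly i (p + p')"
  unfolding hom_poly_def using keys_add[of p p'] by blast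

lemma hom_poly_scal: "hom_poly i p \<Longrightarrow> hom_poly i (scal c p)"
  unfolding hom_poly_def using keys_scal_subset[of c p] by blast

lemma hom_poly_uminus: "hom_poly i p \<Longrightarrow> hom_poly i (- p)"
  using hom_poly_scal[of i p "- 1"] by (simp add: scal_distribs)

lemma hom_poly_sum: "(\<And>x. x \<in> S \<Longrightarrow> hom_poly i (f x)) \<Longrightarrow> hom_poly i (sum f S)"
  by (induction S rule: infinite_finite_induct) (auto simp: hom_poly_add)

lemma hom_poly_mult: "hom_poly i p \<Longrightarrow> hom_poly j p' \<Longrightarrow> hom_poly (i + j) (p * p')"
  unfolding hom_poly_def using keys_mult[of p p'] by fastforce

text \<open>The endomorphism of the free algebra that multiplies each generator by a scalar. It
  serves twice: with -1 at \<theta> as the grading automorphism, and as the diagonal entries of the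
  matrices of the calculi.\<close>

definition rescale :: "(gen \<Rightarrow> complex) \<Rightarrow> ncpoly \<Rightarrow> ncpoly" where
  "rescale c = lext (\<lambda>w. scal (\<Prod>g\<leftarrow>letters w. c g) (Poly_Mapping.single w 1))"

lemma rescale_simps:
  "rescale c 0 = 0" "rescale c (p + p') = rescale c p + rescale c p'"
  "rescale c (p - p') = rescale c p - rescale c p'"
  "rescale c (scal a p) = scal a (rescale c p)"
  "rescale c (nc_monom gs) = scal (\<Prod>g\<leftarrow>gs. c g) (nc_monom gs)"
  by (simp_all add: rescale_def lext_simps nc_monom_def)

lemma rescale_one: "rescale c 1 = 1"
  using rescale_simps(5)[of c "[]"] by (simp add: nc_monom_Nil)

lemma rescale_mult: "rescale c (p * p') = rescale c p * rescale c p'"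
proof (induction p rule: ncpoly_induct)
  case (monom a gs)
  show ?case
  proof (induction p' rule: ncpoly_induct)
    case (monom b hs)
    show ?case
      by (simp add: rescale_simps scal_mult_left scal_mult_right nc_monom_mult mult_ac)
  qed (simp_all add: rescale_simps distrib_left)
qed (simp_all add: rescale_simps distrib_right)

lemma rescale_rescale: "rescale c (rescale c' p) = rescale (\<lambda>g. c g * c' g) p"
proof (induction p rule: ncpoly_induct)
  case (monom a gs)
  have "(\<Prod>g\<leftarrow>gs. c g * c' g) = (\<Prod>g\<leftarrow>gs. c g) * (\<Prod>g\<leftarrow>gs. c' g)"
    by (induction gs) simp_all
  then show ?case by (simp add: rescale_simps mult_ac)
qed (simp_all add: rescale_simps)

lemma rescale_ident: "rescale (\<lambda>g. 1) p = p"
proof (induction p rule: ncpoly_induct)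
  case (monom a gs)
  have "(\<Prod>g\<leftarrow>gs. 1) = (1 :: complex)"
    by (induction gs) simp_all
  then show ?case by (simp add: rescale_simps)
qed (simp_all add: rescale_simps)

text \<open>Up to constant terms each relator is homogeneous in every letter, hence merely scaled by
  the product of the scalars along any of its words. The constant terms of the inverse relators ask
  for the two products to be 1.\<close>

lemma rescale_ideal:
  assumes "p \<in> qsp_ideal q" and c: "c GX * c GXinv = 1" "c GY * c GYinv = 1"
  shows "rescale c p \<in> qsp_ideal q"
proof -
  have c': "c GXinv * c GX = 1" "c GYinv * c GY = 1"
    using c by (simp_all add: mult.commute)
  have "r \<in> {p. rescale c p \<in> qsp_ideal q}" if "r \<in> qsp_relators q" for r
  proof -
    have "\<exists>a. rescale c r = scal a r"
      using that c c' unfolding qsp_relators_def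
      by (elim insertE; simp add: rescale_simps rescale_one nc_monom_Nil)
        (rule exI[of _ 1] exI[of _ "c GX * c GY"] exI[of _ "c GX * c GTheta"] exI[of _ "c GY * c GTheta"] exI[of _ "c GTheta * c GTheta"],
          simp add: scal_distribs mult_ac; fail)+
    then show ?thesis
      using qsp_ideal_scal[OF qsp_relators_in_ideal[OF that]] by auto
  qed
  then have "p \<in> {p. rescale c p \<in> qsp_ideal q}"
    by (intro qsp_ideal_minimal[OF assms(1)])
      (auto simp: rescale_simps rescale_mult qsp_ideal_add qsp_ideal_lmult qsp_ideal_rmult)
  then show ?thesis by simp
qed

definition grading :: "ncpoly \<Rightarrow> ncpoly" where
  "grading = rescale (\<lambda>g. if g = GTheta then - 1 else 1)"

definition par :: "bit \<Rightarrow> ncpoly \<Rightarrow> ncpoly" where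
  "par i = lext (\<lambda>w. if word_parity w = i then Poly_Mapping.single w 1 else 0)"

lemma par_simps:
  "par i 0 = 0" "par i (p + p') = par i p + par i p'" "par i (p - p') = par i p - par i p'"
  "par i (scal c p) = scal c (par i p)"
  "par i (nc_monom gs) = (if word_parity (Word gs) = i then nc_monom gs else 0)"
  by (simp_all add: par_def lext_simps nc_monom_def)

text \<open>Expressing the parity projection through the grading automorphism shows that it
  preserves the ideal, since \<open>rescale_ideal\<close> applies to the latter.\<close>

lemma par_conv: "par i p = scal (1 / 2) (p + scal (parity_sign i) (grading p))"
proof (induction p rule: ncpoly_induct)
  case (monom c gs)
  have sgn: "(\<Prod>g\<leftarrow>gs. if g = GTheta then - 1 else 1) = parity_sign (word_parity (Word gs))"
    by (induction gs) (auto simp: parity_sign_add)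
  show ?case
    by (cases i; cases "word_parity (Word gs)")
      (simp_all add: par_simps grading_def rescale_simps sgn scal_distribs flip: scal_distribs(3))
qed (simp_all add: par_simps grading_def rescale_simps scal_distribs)

lemma par_ideal: "p \<in> qsp_ideal q \<Longrightarrow> par i p \<in> qsp_ideal q"
  unfolding par_conv grading_def by (intro qsp_ideal_scal qsp_ideal_add rescale_ideal) simp_all

lemma par_of_hom:
  assumes "hom_poly j p"
  shows "par i p = (if i = j then p else 0)"
proof -
  have "par i p = (\<Sum>k\<in>Poly_Mapping.keys p. if i = j then Poly_Mapping.single k (Poly_Mapping.lookup p k) else 0)"
    unfolding par_def lext_def using assms by (intro sum.cong) (auto simp: hom_poly_def)
  then show ?thesis
    by (simp flip: poly_mapping_sum_single)
qed

lemma par_hom: "hom_poly i (par i p)"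
  unfolding hom_poly_def par_def using keys_lext by (fastforce split: if_splits)

lemma par_sum: "par 0 p + par 1 p = p"
  by (simp add: par_conv flip: scal_distribs(1)) (simp add: scal_distribs flip: scal_distribs(3))

lemma qsp_homog_iff: "a \<in> homog (qsp q) i \<longleftrightarrow> (\<exists>p. hom_poly i p \<and> a = qsp_class q p)"
  by (auto simp: qsp_homog hom_poly_def)

lemma qsp_class_homogI: "hom_poly i p \<Longrightarrow> qsp_class q p \<in> homog (qsp q) i"
  by (auto simp: qsp_homog_iff)

lemma qsp_a_inv: "\<ominus>\<^bsub>qsp q\<^esub> qsp_class q p = qsp_class q (- p)"
proof -
  interpret ring "qsp q" by (rule qsp_ring)
  show ?thesis by (rule minus_equality) (simp_all add: qsp_add qsp_zero)
qed

lemma qsp_superalgebra: "superalgebra (qsp q)"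
proof -
  interpret ring "qsp q" by (rule qsp_ring)
  interpret module complex_ring "qsp q" by (rule qsp_module)
  \<comment> \<open>The parity projections, applied to a difference in the ideal, put its even and
    its odd part into the ideal separately.\<close>
  have unique: "qsp_class q p = qsp_class q p' \<and> qsp_class q r = qsp_class q r'"
    if "hom_poly 0 p" "hom_poly 1 r" "hom_poly 0 p'" "hom_poly 1 r'"
      "qsp_class q (p + r) = qsp_class q (p' + r')" for p r p' r'
  proof -
    have "p + r - (p' + r') \<in> qsp_ideal q"
      using that by (simp add: qsp_class_eq_iff)
    from par_ideal[OF this, of 0] par_ideal[OF this, of 1] that show ?thesis
      by (simp add: par_simps par_of_hom qsp_class_eq_iff)
  qed
  show ?thesis
  proof (intro superalgebra.intro super_vector_space.intro super_vector_space_axioms.intro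
      superalgebra_axioms.intro qsp_module qsp_ring)
    fix i
    show "submodule (homog (qsp q) i) complex_ring (qsp q)"
    proof (rule submoduleI)
      show "homog (qsp q) i \<subseteq> carrier (qsp q)" by (auto simp: qsp_homog_iff)
      show "\<zero>\<^bsub>qsp q\<^esub> \<in> homog (qsp q) i" by (simp add: qsp_zero qsp_class_homogI)
      show "\<ominus>\<^bsub>qsp q\<^esub> a \<in> homog (qsp q) i" if "a \<in> homog (qsp q) i" for a
        using that by (metis qsp_homog_iff qsp_a_inv hom_poly_uminus)
      show "a \<oplus>\<^bsub>qsp q\<^esub> b \<in> homog (qsp q) i" if "a \<in> homog (qsp q) i" "b \<in> homog (qsp q) i" for a b
        using that by (metis qsp_homog_iff qsp_add hom_poly_add)
      show "c \<odot>\<^bsub>qsp q\<^esub> a \<in> homog (qsp q) i" if "a \<in> homog (qsp q) i" for c a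
        using that by (metis qsp_homog_iff qsp_smult hom_poly_scal)
    qed
  next
    fix a assume "a \<in> carrier (qsp q)"
    then obtain p where p: "a = qsp_class q p" by (rule qsp_cases)
    show "\<exists>!pr. fst pr \<in> homog (qsp q) 0 \<and> snd pr \<in> homog (qsp q) 1 \<and> a = fst pr \<oplus>\<^bsub>qsp q\<^esub> snd pr"
    proof (rule ex1I[of _ "(qsp_class q (par 0 p), qsp_class q (par 1 p))"])
      show "pr = (qsp_class q (par 0 p), qsp_class q (par 1 p))"
        if "fst pr \<in> homog (qsp q) 0 \<and> snd pr \<in> homog (qsp q) 1 \<and> a = fst pr \<oplus>\<^bsub>qsp q\<^esub> snd pr" for pr
        using that unique[OF _ _ par_hom[of 0 p] par_hom[of 1 p]]
        by (cases pr) (auto simp: qsp_homog_iff qsp_add p par_sum)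
    qed (simp add: qsp_class_homogI par_hom qsp_add par_sum p)
  next
    show "\<one>\<^bsub>qsp q\<^esub> \<in> homog (qsp q) 0"
      by (simp add: qsp_one qsp_class_homogI hom_poly_one)
    show "a \<otimes>\<^bsub>qsp q\<^esub> b \<in> homog (qsp q) (i + j)"
      if "a \<in> homog (qsp q) i" "b \<in> homog (qsp q) j" for a b i j
      using that by (metis qsp_homog_iff qsp_mult hom_poly_mult)
  qed (elim qsp_cases; simp add: qsp_smult qsp_mult scal_mult_left scal_mult_right)+
qed


section \<open>Matrix representations of the free algebra\<close>

text \<open>Words act as products of matrices with entries in the free algebra. No relation is
  imposed at this level, so multiplicativity holds for every choice of
  \<open>\<gamma>\<close>.\<close>

fun word_mat :: "(gen \<Rightarrow> 'i \<Rightarrow> 'i \<Rightarrow> ncpoly) \<Rightarrow> gen list \<Rightarrow> 'i::finite \<Rightarrow> 'i \<Rightarrow> ncpoly" where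
  "word_mat \<gamma> [] i j = (if i = j then 1 else 0)"
| "word_mat \<gamma> (g # w) i j = (\<Sum>k\<in>UNIV. \<gamma> g i k * word_mat \<gamma> w k j)"

definition mat :: "(gen \<Rightarrow> 'i \<Rightarrow> 'i \<Rightarrow> ncpoly) \<Rightarrow> ncpoly \<Rightarrow> 'i::finite \<Rightarrow> 'i \<Rightarrow> ncpoly" where
  "mat \<gamma> p i j = lext (\<lambda>w. word_mat \<gamma> (letters w) i j) p"

lemma mat_simps:
  "mat \<gamma> 0 i j = 0" "mat \<gamma> (p + p') i j = mat \<gamma> p i j + mat \<gamma> p' i j"
  "mat \<gamma> (p - p') i j = mat \<gamma> p i j - mat \<gamma> p' i j"
  "mat \<gamma> (scal c p) i j = scal c (mat \<gamma> p i j)"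
  "mat \<gamma> (nc_monom w) i j = word_mat \<gamma> w i j"
  by (simp_all add: mat_def lext_simps nc_monom_def)

lemma mat_one: "mat \<gamma> 1 i j = (if i = j then 1 else 0)"
  using mat_simps(5)[of \<gamma> "[]"] by (simp add: nc_monom_Nil)

lemma word_mat_append: "word_mat \<gamma> (u @ v) i j = (\<Sum>k\<in>UNIV. word_mat \<gamma> u i k * word_mat \<gamma> v k j)"
proof (induction u arbitrary: i)
  case (Cons g u)
  have "word_mat \<gamma> ((g # u) @ v) i j = (\<Sum>l\<in>UNIV. \<Sum>k\<in>UNIV. \<gamma> g i l * word_mat \<gamma> u l k * word_mat \<gamma> v k j)"
    by (simp add: Cons sum_distrib_left mult.assoc)
  also have "\<dots> = (\<Sum>k\<in>UNIV. \<Sum>l\<in>UNIV. \<gamma> g i l * word_mat \<gamma> u l k * word_mat \<gamma> v k j)"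
    by (rule sum.swap)
  finally show ?case by (simp add: sum_distrib_right)
qed (simp add: if_distrib[of "\<lambda>x. x * _"] cong: if_cong)

lemma mat_mult: "mat \<gamma> (p * p') i j = (\<Sum>k\<in>UNIV. mat \<gamma> p i k * mat \<gamma> p' k j)"
proof (induction p rule: ncpoly_induct)
  case (monom a u)
  show ?case
  proof (induction p' rule: ncpoly_induct)
    case (monom b v)
    show ?case
      by (simp add: mat_simps scal_mult_left scal_mult_right nc_monom_mult word_mat_append scal_sum)
  qed (simp_all add: mat_simps distrib_left sum.distrib)
qed (simp_all add: mat_simps distrib_right sum.distrib)

text \<open>By \<open>mat_mult\<close>, the polynomials whose matrix has all entries in the ideal
  form a two-sided ideal; so testing the relators is enough.\<close>

lemma mat_ideal:
  assumes "p \<in> qsp_ideal q" "\<And>r i j. r \<in> qsp_relators q \<Longrightarrow> mat \<gamma> r i j \<in> qsp_ideal q"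
  shows "mat \<gamma> p i j \<in> qsp_ideal q"
proof -
  have "p \<in> {p. \<forall>i j. mat \<gamma> p i j \<in> qsp_ideal q}"
  proof (rule qsp_ideal_minimal[OF assms(1)])
    fix x y assume x: "x \<in> {p. \<forall>i j. mat \<gamma> p i j \<in> qsp_ideal q}"
    show "y * x \<in> {p. \<forall>i j. mat \<gamma> p i j \<in> qsp_ideal q}"
      using x by (simp add: mat_mult qsp_ideal_sum qsp_ideal_lmult)
    show "x * y \<in> {p. \<forall>i j. mat \<gamma> p i j \<in> qsp_ideal q}"
      using x by (simp add: mat_mult qsp_ideal_sum qsp_ideal_rmult)
  qed (use assms(2) in \<open>auto simp: mat_simps qsp_ideal_add\<close>)
  then show ?thesis by simp
qed

text \<open>In a product of supermatrices the parity of the inner index occurs twice and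
  cancels.\<close>

lemma mat_hom:
  assumes "hom_poly e p" "\<And>g i j. hom_poly (of_bool (g = GTheta) + \<pi> i + \<pi> j) (\<gamma> g i j)"
  shows "hom_poly (e + \<pi> i + \<pi> j) (mat \<gamma> p i j)"
proof -
  have word: "hom_poly (word_parity (Word w) + \<pi> i + \<pi> j) (word_mat \<gamma> w i j)" for w i j
  proof (induction w arbitrary: i)
    case Nil
    show ?case by (cases "i = j"; cases "\<pi> j") (simp_all add: hom_poly_one)
  next
    case (Cons g w)
    have eq: "of_bool (g = GTheta) + \<pi> i + \<pi> k + (word_parity (Word w) + \<pi> k + \<pi> j) =
      word_parity (Word (g # w)) + \<pi> i + \<pi> j" for k
      by (simp only: word_parity_simps add_ac bit_add_self bit_add_self_left)
    show ?case
      unfolding word_mat.simps by (rule hom_poly_sum) (metis eq hom_poly_mult[OF assms(2) Cons])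
  qed
  show ?thesis
    unfolding mat_def lext_def using assms(1) word[of "letters w" for w]
    by (intro hom_poly_sum hom_poly_scal) (auto simp: hom_poly_def)
qed

section \<open>The two calculi\<close>

text \<open>
  The index \<open>IS\<close> adjoins to the basis \<open>dx, dy, d\<theta>\<close> an element \<open>e\<close> with \<open>e a = (-1)^p(a) a e + da\<close>,
  so that \<open>d\<close> becomes an inner derivation and a single matrix representation encodes both the
  right action and the differential: row \<open>IS\<close> of the matrix of \<open>a\<close> holds \<open>(-1)^p(a) a\<close> and the
  coordinates of \<open>da\<close>, and row \<open>i\<close> the coordinates of the product of the \<open>i\<close>-th basis element by \<open>a\<close>.
\<close>

datatype ix = IS | IX | IY | IT

lemma UNIV_ix: "UNIV = {IS, IX, IY, IT}"
  using ix.exhaust by auto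

instance ix :: finite
  by standard (simp add: UNIV_ix)

lemma sum_ix: "(\<Sum>i\<in>UNIV. f i) = f IS + f IX + f IY + f IT"
  by (simp add: UNIV_ix add.assoc)

text \<open>The parities of dx, dy, d\<theta>; \<open>IS\<close> is odd because the adjoined element
  e implements the odd map d.\<close>

fun ix_parity :: "ix \<Rightarrow> bit" where
  "ix_parity IT = 0"
| "ix_parity _ = 1"

text \<open>
  The parameter \<open>b\<close> selects the first (\<^const>\<open>True\<close>) or the second calculus. The rows of \<open>GX\<close>,
  \<open>GY\<close>, \<open>GTheta\<close> transcribe the commutation relations; those of the inverses are then forced.
\<close>

fun calc_entries :: "bool \<Rightarrow> complex \<Rightarrow> complex \<Rightarrow> complex \<Rightarrow> gen \<Rightarrow> ((ix \<times> ix) \<times> complex \<times> gen list) list" where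
  "calc_entries b q r s GX =
     [((IS, IS), 1, [GX]), ((IS, IX), 1, []), ((IX, IX), r, [GX]), ((IY, IY), if b then r else 1, [GX]),
      ((IY, IX), if b then 0 else s - 1, [GY]), ((IT, IT), inverse q * r, [GX])]"
| "calc_entries b q r s GY =
     [((IS, IS), 1, [GY]), ((IS, IY), 1, []), ((IX, IX), if b then 1 else s, [GY]),
      ((IX, IY), if b then r - 1 else 0, [GX]), ((IY, IY), s, [GY]), ((IT, IT), inverse q * s, [GY])]"
| "calc_entries b q r s GTheta =
     [((IS, IS), - 1, [GTheta]), ((IS, IT), 1, []), ((IX, IX), - q, [GTheta]), ((IX, IT), r - 1, [GX]),
      ((IY, IY), - q, [GTheta]), ((IY, IT), s - 1, [GY]), ((IT, IT), 1, [GTheta])]"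
| "calc_entries b q r s GXinv =
     [((IS, IS), 1, [GXinv]), ((IS, IX), - inverse r, [GXinv, GXinv]), ((IX, IX), inverse r, [GXinv]),
      ((IY, IY), if b then inverse r else 1, [GXinv]),
      ((IY, IX), if b then 0 else - (s - 1) * inverse r, [GY, GXinv, GXinv]),
      ((IT, IT), q * inverse r, [GXinv])]"
| "calc_entries b q r s GYinv =
     [((IS, IS), 1, [GYinv]), ((IS, IY), - inverse s, [GYinv, GYinv]),
      ((IX, IX), if b then 1 else inverse s, [GYinv]),
      ((IX, IY), if b then - (r - 1) * inverse s else 0, [GX, GYinv, GYinv]),
      ((IY, IY), inverse s, [GYinv]), ((IT, IT), q * inverse s, [GYinv])]"

text \<open>Every entry is zero or a multiple of one monomial, a form on which
  \<open>entry_weight\<close> relies.\<close>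

definition calc_gen :: "bool \<Rightarrow> complex \<Rightarrow> complex \<Rightarrow> complex \<Rightarrow> gen \<Rightarrow> ix \<Rightarrow> ix \<Rightarrow> ncpoly" where
  "calc_gen b q r s g i j =
     (case map_of (calc_entries b q r s g) (i, j) of None \<Rightarrow> 0 | Some (c, w) \<Rightarrow> scal c (nc_monom w))"

locale calc =
  fixes b :: bool and q r s :: complex
  assumes nonzero: "q \<noteq> 0" "r \<noteq> 0" "s \<noteq> 0"
begin

abbreviation "\<gamma> \<equiv> calc_gen b q r s"

lemma mat_gen: "mat \<gamma> (nc_monom [g]) i j = \<gamma> g i j"
  by (simp add: mat_simps if_distrib[of "\<lambda>x. _ * x"] cong: if_cong)

text \<open>Well-definedness of the right action and of d rests on this finite check: eight
  relators, sixteen entries, both calculi. For the relators with inverses it confirms the rows of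
  \<open>GXinv\<close> and \<open>GYinv\<close>.\<close>

lemma mat_relators:
  assumes "p \<in> qsp_relators q"
  shows "mat \<gamma> p i j \<in> qsp_ideal q"
proof -
  have "nf q (mat \<gamma> p i j) = 0"
    using assms nonzero unfolding qsp_relators_def
    by (elim insertE emptyE; cases i; cases j; cases b;
      simp add: mat_simps mat_one sum_ix calc_gen_def nc_monom_mult scal_mult_left scal_mult_right
        flip: nc_monom_Nil single_add single_diff;
      simp add: field_simps)
  then show ?thesis by (rule qsp_ideal_nfI[OF nonzero(1)])
qed

lemma gen_parity: "hom_poly (of_bool (g = GTheta) + ix_parity i + ix_parity j) (\<gamma> g i j)"
  by (cases g; cases i; cases j; simp add: calc_gen_def hom_poly_scal hom_poly_monom)

end

text \<open>A chosen representative turns the matrices of polynomials into operations on cosets;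
  \<open>ract_tri\<close> and \<open>d_class\<close> show independence of the choice.\<close>

definition coset_rep :: "ncpoly set \<Rightarrow> ncpoly" where
  "coset_rep S = (SOME p. p \<in> S)"

lemma coset_rep_class: "coset_rep (qsp_class q p) - p \<in> qsp_ideal q"
  unfolding coset_rep_def mem_qsp_class_iff[symmetric] using qsp_class_self by (rule someI)

section \<open>The bimodule of left coordinates and its differential\<close>

context calc
begin

abbreviation "A \<equiv> qsp q"
abbreviation "cl \<equiv> qsp_class q"
abbreviation "N \<equiv> mat \<gamma>"

sublocale A: superalgebra A
  by (rule qsp_superalgebra)

text \<open>Right multiplication of dx, dy, d\<theta> by a generator never produces e, and block
  triangular matrices of this shape are closed under products.\<close>

lemma N_lower: "i \<noteq> IS \<Longrightarrow> N p i IS = 0"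
proof (induction p rule: ncpoly_induct)
  case (monom c w)
  have \<gamma>: "\<gamma> g i IS = 0" if "i \<noteq> IS" for g i
    using that by (cases g; cases i) (simp_all add: calc_gen_def)
  have "i \<noteq> IS \<Longrightarrow> word_mat \<gamma> w i IS = 0" for i
    by (induction w arbitrary: i) (simp_all add: \<gamma> sum_ix)
  with monom show ?case by (simp add: mat_simps)
qed (simp_all add: mat_simps)

text \<open>The corner entry is multiplicative because the rest of its column vanishes. It carries
  the sign of the graded Leibniz rule.\<close>

lemma N_star:
  assumes "hom_poly e p"
  shows "N p IS IS = scal (parity_sign e) p"
proof -
  have \<gamma>: "\<gamma> g IS IS = scal (parity_sign (word_parity (Word [g]))) (nc_monom [g])" for g
    by (cases g) (simp_all add: calc_gen_def)
  have lower: "word_mat \<gamma> w i IS = 0" if "i \<noteq> IS" for w i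
    using N_lower[OF that, of "nc_monom w"] by (simp add: mat_simps)
  have word: "word_mat \<gamma> w IS IS = scal (parity_sign (word_parity (Word w))) (nc_monom w)" for w
  proof (induction w)
    case (Cons g w)
    have "word_parity (Word (g # w)) = word_parity (Word [g]) + word_parity (Word w)"
      by (simp only: word_parity_simps add_0_right)
    then have "parity_sign (word_parity (Word (g # w))) =
        parity_sign (word_parity (Word [g])) * parity_sign (word_parity (Word w))"
      by (simp only: parity_sign_add)
    then show ?case
      by (simp only: word_mat.simps sum_ix lower Cons \<gamma>)
        (simp add: lower scal_mult_left scal_mult_right nc_monom_mult mult.commute)
  qed (simp add: nc_monom_Nil)
  have "N p IS IS = (\<Sum>w\<in>Poly_Mapping.keys p. scal (parity_sign e) (Poly_Mapping.single w (Poly_Mapping.lookup p w)))"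
    unfolding mat_def lext_def using assms word
    by (intro sum.cong) (auto simp: hom_poly_def nc_monom_def mult.commute)
  then show ?thesis
    by (simp only: scal_sum[symmetric] poly_mapping_sum_single[symmetric])
qed

text \<open>Row vector times the 3 by 3 block; the coordinate at \<open>IS\<close> is left out here
  and in \<open>tri\<close>.\<close>

definition row :: "(ix \<Rightarrow> ncpoly) \<Rightarrow> ncpoly \<Rightarrow> ix \<Rightarrow> ncpoly" where
  "row v p j = v IX * N p IX j + v IY * N p IY j + v IT * N p IT j"

definition tri :: "(ix \<Rightarrow> ncpoly) \<Rightarrow> ncpoly set \<times> ncpoly set \<times> ncpoly set" where
  "tri v = (cl (v IX), cl (v IY), cl (v IT))"

text \<open>A triple holds the left coordinates with respect to dx, dy, d\<theta>. In parity
  \<open>i\<close> the first two lie in parity \<open>i + 1\<close>, because dx and dy are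
  odd.\<close>

definition \<Gamma> :: "(ncpoly set, ncpoly set \<times> ncpoly set \<times> ncpoly set) superbimodule" where
  "\<Gamma> = \<lparr>carrier = carrier A \<times> carrier A \<times> carrier A,
    monoid.mult = undefined, one = undefined, ring.zero = tri (\<lambda>_. 0),
    add = (\<lambda>(u1, u2, u3) (v1, v2, v3). (u1 \<oplus>\<^bsub>A\<^esub> v1, u2 \<oplus>\<^bsub>A\<^esub> v2, u3 \<oplus>\<^bsub>A\<^esub> v3)),
    module.smult = (\<lambda>c (u1, u2, u3). (c \<odot>\<^bsub>A\<^esub> u1, c \<odot>\<^bsub>A\<^esub> u2, c \<odot>\<^bsub>A\<^esub> u3)),
    homog = (\<lambda>i. homog A (i + 1) \<times> homog A (i + 1) \<times> homog A i),
    lact = (\<lambda>a (u1, u2, u3). (a \<otimes>\<^bsub>A\<^esub> u1, a \<otimes>\<^bsub>A\<^esub> u2, a \<otimes>\<^bsub>A\<^esub> u3)),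
    ract = (\<lambda>(u1, u2, u3) a. tri (row (case_ix 0 (coset_rep u1) (coset_rep u2) (coset_rep u3)) (coset_rep a)))\<rparr>"

definition d :: "ncpoly set \<Rightarrow> ncpoly set \<times> ncpoly set \<times> ncpoly set" where
  "d a = tri (N (coset_rep a) IS)"

lemma tri_eq_iff: "tri u = tri v \<longleftrightarrow> (\<forall>j. j \<noteq> IS \<longrightarrow> u j - v j \<in> qsp_ideal q)"
proof -
  have "(\<forall>j. j \<noteq> IS \<longrightarrow> P j) \<longleftrightarrow> P IX \<and> P IY \<and> P IT" for P
    by (metis ix.exhaust ix.distinct)
  then show ?thesis by (simp add: tri_def qsp_class_eq_iff)
qed

lemma tri_cong: "(\<And>j. j \<noteq> IS \<Longrightarrow> u j = v j) \<Longrightarrow> tri u = tri v"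
  by (simp add: tri_eq_iff)

lemma \<Gamma>_carrier: "carrier \<Gamma> = carrier A \<times> carrier A \<times> carrier A"
  by (simp add: \<Gamma>_def)

lemma tri_closed [simp]: "tri v \<in> carrier \<Gamma>"
  by (simp add: \<Gamma>_carrier tri_def)

lemma tri_cases [cases set]:
  assumes "\<omega> \<in> carrier \<Gamma>"
  obtains v where "\<omega> = tri v"
proof -
  obtain p1 p2 p3 where "\<omega> = (cl p1, cl p2, cl p3)"
    using assms by (auto simp: \<Gamma>_carrier elim!: qsp_cases)
  then have "\<omega> = tri (case_ix 0 p1 p2 p3)"
    by (simp add: tri_def)
  then show thesis by (rule that)
qed

lemma N_ideal: "p \<in> qsp_ideal q \<Longrightarrow> N p i j \<in> qsp_ideal q"
  by (rule mat_ideal[OF _ mat_relators])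

lemma \<Gamma>_simps:
  "tri u \<oplus>\<^bsub>\<Gamma>\<^esub> tri v = tri (\<lambda>j. u j + v j)"
  "c \<odot>\<^bsub>\<Gamma>\<^esub> tri v = tri (\<lambda>j. scal c (v j))"
  "\<zero>\<^bsub>\<Gamma>\<^esub> = tri (\<lambda>j. 0)"
  "cl p \<triangleright>\<^bsub>\<Gamma>\<^esub> tri v = tri (\<lambda>j. p * v j)"
  by (simp_all add: \<Gamma>_def tri_def qsp_add qsp_smult qsp_mult)

lemma mult_ideal_cong:
  assumes "u' - u \<in> qsp_ideal q" "v' - v \<in> qsp_ideal q"
  shows "u' * v' - u * v \<in> qsp_ideal q"
  using qcong_mult[of q u' u v' v] assms by (simp add: qcong_def)

lemma ract_tri: "tri v \<triangleleft>\<^bsub>\<Gamma>\<^esub> cl p = tri (row v p)"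
proof -
  have "row (case_ix 0 (coset_rep (cl (v IX))) (coset_rep (cl (v IY))) (coset_rep (cl (v IT)))) (coset_rep (cl p)) j - row v p j
      \<in> qsp_ideal q" for j
  proof -
    have *: "coset_rep (cl (v i)) * N (coset_rep (cl p)) i j - v i * N p i j \<in> qsp_ideal q" for i
      using N_ideal[OF coset_rep_class[of q p], of i j]
      by (intro mult_ideal_cong coset_rep_class) (simp add: mat_simps)
    show ?thesis
      using qsp_ideal_add[OF qsp_ideal_add[OF *[of IX] *[of IY]] *[of IT]]
      by (simp add: row_def algebra_simps)
  qed
  then have "tri (row (case_ix 0 (coset_rep (cl (v IX))) (coset_rep (cl (v IY))) (coset_rep (cl (v IT)))) (coset_rep (cl p))) = tri (row v p)"
    by (simp add: tri_eq_iff)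
  then show ?thesis
    by (simp add: \<Gamma>_def tri_def[of v])
qed

lemma d_class: "d (cl p) = tri (N p IS)"
  using N_ideal[OF coset_rep_class[of q p]] by (simp add: d_def tri_eq_iff mat_simps)

lemma tri_homogI:
  assumes "\<And>j. j \<noteq> IS \<Longrightarrow> hom_poly (i + ix_parity j) (v j)"
  shows "tri v \<in> homog \<Gamma> i"
  using assms[of IX] assms[of IY] assms[of IT]
  by (simp add: \<Gamma>_def tri_def qsp_class_homogI del: add_bit_eq_xor)

lemma tri_homogE:
  assumes "\<omega> \<in> homog \<Gamma> i"
  obtains v where "\<omega> = tri v" "\<And>j. j \<noteq> IS \<Longrightarrow> hom_poly (i + ix_parity j) (v j)"
proof -
  obtain p1 p2 p3 where p: "\<omega> = (cl p1, cl p2, cl p3)" "hom_poly (i + 1) p1" "hom_poly (i + 1) p2" "hom_poly i p3"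
    using assms by (auto simp: \<Gamma>_def qsp_homog_iff)
  show thesis
  proof (rule that[of "case_ix 0 p1 p2 p3"])
    show "hom_poly (i + ix_parity j) (case j of IS \<Rightarrow> 0 | IX \<Rightarrow> p1 | IY \<Rightarrow> p2 | IT \<Rightarrow> p3)" if "j \<noteq> IS" for j
      using p that by (cases j; cases i) simp_all
  qed (simp add: tri_def p)
qed

lemma \<Gamma>_module: "module complex_ring \<Gamma>"
proof -
  have "abelian_group \<Gamma>"
  proof (rule abelian_groupI)
    fix x assume "x \<in> carrier \<Gamma>"
    then show "\<exists>y\<in>carrier \<Gamma>. y \<oplus>\<^bsub>\<Gamma>\<^esub> x = \<zero>\<^bsub>\<Gamma>\<^esub>"
    proof (cases rule: tri_cases)
      case (1 v)
      then show ?thesis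
        by (intro bexI[of _ "tri (\<lambda>j. - v j)"]) (simp_all add: \<Gamma>_simps)
    qed
  qed ((elim tri_cases; simp add: \<Gamma>_simps algebra_simps) | simp add: \<Gamma>_simps)+
  then show ?thesis
    by (intro moduleI complex_ring_cring)
      (assumption | (elim tri_cases; simp add: \<Gamma>_simps scal_distribs))+
qed

lemma \<Gamma>_superspace: "super_vector_space \<Gamma>"
proof (intro super_vector_space.intro super_vector_space_axioms.intro \<Gamma>_module)
  interpret module complex_ring \<Gamma> by (rule \<Gamma>_module)
  fix i
  show "submodule (homog \<Gamma> i) complex_ring \<Gamma>"
  proof (rule submoduleI)
    show "\<zero>\<^bsub>\<Gamma>\<^esub> \<in> homog \<Gamma> i"
      by (simp add: \<Gamma>_simps tri_homogI)
    show add: "a \<oplus>\<^bsub>\<Gamma>\<^esub> c \<in> homog \<Gamma> i" if "a \<in> homog \<Gamma> i" "c \<in> homog \<Gamma> i" for a c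
      using that by (elim tri_homogE) (simp add: \<Gamma>_simps tri_homogI hom_poly_add)
    show smult: "c \<odot>\<^bsub>\<Gamma>\<^esub> a \<in> homog \<Gamma> i" if "a \<in> homog \<Gamma> i" for c a
      using that by (elim tri_homogE) (simp add: \<Gamma>_simps tri_homogI hom_poly_scal)
    show sub: "homog \<Gamma> i \<subseteq> carrier \<Gamma>"
      by (auto elim: tri_homogE)
    have inv: "\<ominus>\<^bsub>\<Gamma>\<^esub> tri v = tri (\<lambda>j. - v j)" for v
      by (intro minus_equality) (simp_all add: \<Gamma>_simps)
    show "\<ominus>\<^bsub>\<Gamma>\<^esub> a \<in> homog \<Gamma> i" if "a \<in> homog \<Gamma> i" for a
      using that by (elim tri_homogE) (simp add: inv tri_homogI hom_poly_uminus)
  qed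
next
  fix \<omega> assume "\<omega> \<in> carrier \<Gamma>"
  then obtain u1 u2 u3 where u: "\<omega> = (u1, u2, u3)" "u1 \<in> carrier A" "u2 \<in> carrier A" "u3 \<in> carrier A"
    by (auto simp: \<Gamma>_carrier)
  let ?P = "\<lambda>p. fst p \<in> homog \<Gamma> 0 \<and> snd p \<in> homog \<Gamma> 1 \<and> \<omega> = fst p \<oplus>\<^bsub>\<Gamma>\<^esub> snd p"
  let ?h = "homog_part A"
  have swap: "v = ?h 1 v \<oplus>\<^bsub>A\<^esub> ?h 0 v" if "v \<in> carrier A" for v
    using A.homog_part_sum[OF that] that by (simp add: A.M.a_comm)
  have parts: "?h 0 (v \<oplus>\<^bsub>A\<^esub> w) = v" "?h 1 (v \<oplus>\<^bsub>A\<^esub> w) = w"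
    "?h 0 (w \<oplus>\<^bsub>A\<^esub> v) = v" "?h 1 (w \<oplus>\<^bsub>A\<^esub> v) = w" if "v \<in> homog A 0" "w \<in> homog A 1" for v w
    using A.homog_part_eqI[of v 0 w] A.homog_part_eqI[of w 1 v] that
    by (simp_all add: A.M.a_comm A.superspace_closed)
  show "\<exists>!p. ?P p"
  proof (rule ex1I)
    show "?P ((?h 1 u1, ?h 1 u2, ?h 0 u3), (?h 0 u1, ?h 0 u2, ?h 1 u3))"
      using u A.homog_part_homog A.homog_part_sum swap by (simp add: \<Gamma>_def)
    fix p assume "?P p"
    then show "p = ((?h 1 u1, ?h 1 u2, ?h 0 u3), (?h 0 u1, ?h 0 u2, ?h 1 u3))"
      using u by (cases p) (auto simp: \<Gamma>_def parts)
  qed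
qed

text \<open>The summand for the inner index \<open>IS\<close> drops out by \<open>N_lower\<close>,
  so the 3 by 3 block alone is multiplicative. This is associativity of the right action.\<close>

lemma N_mult_lower: "i \<noteq> IS \<Longrightarrow> N (p * p') i j = row (N p i) p' j"
  by (simp add: mat_mult sum_ix row_def N_lower)

lemma \<Gamma>_bimodule: "super_bimodule A \<Gamma>"
proof (intro super_bimodule.intro super_bimodule_axioms.intro qsp_superalgebra \<Gamma>_superspace)
  fix a c m assume *: "a \<in> carrier A" "c \<in> carrier A" "m \<in> carrier \<Gamma>"
  obtain v where "m = tri v" using *(3) by (rule tri_cases)
  moreover obtain p where "a = cl p" using *(1) by (rule qsp_cases)
  moreover obtain p' where "c = cl p'" using *(2) by (rule qsp_cases)
  ultimately have m: "m = tri v" "a = cl p" "c = cl p'" by auto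
  show "m \<triangleleft>\<^bsub>\<Gamma>\<^esub> (a \<otimes>\<^bsub>A\<^esub> c) = m \<triangleleft>\<^bsub>\<Gamma>\<^esub> a \<triangleleft>\<^bsub>\<Gamma>\<^esub> c"
    unfolding m ract_tri qsp_mult by (rule tri_cong) (simp add: row_def N_mult_lower algebra_simps)
next
  fix m assume "m \<in> carrier \<Gamma>"
  then obtain v where m: "m = tri v" by (rule tri_cases)
  show "m \<triangleleft>\<^bsub>\<Gamma>\<^esub> \<one>\<^bsub>A\<^esub> = m"
    unfolding m ract_tri qsp_one
  proof (rule tri_cong)
    show "row v 1 j = v j" if "j \<noteq> IS" for j
      using that by (cases j) (simp_all add: row_def mat_one)
  qed
next
  fix a m i e assume "a \<in> homog A i" "m \<in> homog \<Gamma> e"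
  then obtain v p where m: "m = tri v" "a = cl p" "hom_poly i p"
    and v: "\<And>j. j \<noteq> IS \<Longrightarrow> hom_poly (e + ix_parity j) (v j)"
    by (elim tri_homogE) (auto simp: qsp_homog_iff)
  have "hom_poly (i + e + ix_parity j) (p * v j)" if "j \<noteq> IS" for j
    using hom_poly_mult[OF m(3) v[OF that]] by (simp only: add.assoc)
  then show "a \<triangleright>\<^bsub>\<Gamma>\<^esub> m \<in> homog \<Gamma> (i + e)"
    unfolding m \<Gamma>_simps by (rule tri_homogI)
next
  fix a m i e assume "m \<in> homog \<Gamma> i" "a \<in> homog A e"
  then obtain v p where m: "m = tri v" "a = cl p" "hom_poly e p"
    and v: "\<And>j. j \<noteq> IS \<Longrightarrow> hom_poly (i + ix_parity j) (v j)"
    by (elim tri_homogE) (auto simp: qsp_homog_iff)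
  have "hom_poly (i + e + ix_parity j) (v k * N p k j)" if "k \<noteq> IS" for k j
  proof -
    have eq: "i + ix_parity k + (e + ix_parity k + ix_parity j) = i + e + ix_parity j"
      by (simp only: add_ac bit_add_self bit_add_self_left add_0)
    then show ?thesis
      using hom_poly_mult[OF v[OF that] mat_hom[of e p ix_parity \<gamma> k j, OF m(3) gen_parity]]
      by (simp only: eq)
  qed
  then show "m \<triangleleft>\<^bsub>\<Gamma>\<^esub> a \<in> homog \<Gamma> (i + e)"
    unfolding m ract_tri row_def[abs_def] by (intro tri_homogI hom_poly_add) simp_all
qed (elim tri_cases qsp_cases; simp only: \<Gamma>_simps ract_tri qsp_add qsp_smult qsp_mult qsp_one;
    (rule tri_closed | rule tri_cong; simp add: row_def mat_simps scal_mult_left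
      scal_mult_right scal_distribs(1) distrib_left distrib_right mult.assoc add_ac))+

lemma d_x: "d (qsp_gen q GX) = (cl 1, cl 0, cl 0)"
  and d_y: "d (qsp_gen q GY) = (cl 0, cl 1, cl 0)"
  and d_theta: "d (qsp_gen q GTheta) = (cl 0, cl 0, cl 1)"
  by (simp_all add: qsp_gen_def d_class mat_gen calc_gen_def tri_def nc_monom_Nil)

lemma \<Gamma>_coordinates:
  assumes "u1 \<in> carrier A" "u2 \<in> carrier A" "u3 \<in> carrier A"
  shows "(u1, u2, u3) = u1 \<triangleright>\<^bsub>\<Gamma>\<^esub> d (qsp_gen q GX) \<oplus>\<^bsub>\<Gamma>\<^esub> u2 \<triangleright>\<^bsub>\<Gamma>\<^esub> d (qsp_gen q GY)
    \<oplus>\<^bsub>\<Gamma>\<^esub> u3 \<triangleright>\<^bsub>\<Gamma>\<^esub> d (qsp_gen q GTheta)"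
  using assms by (elim qsp_cases) (simp add: d_x d_y d_theta \<Gamma>_def qsp_mult qsp_add)

lemma \<Gamma>_fodc: "super_fodc A \<Gamma> d"
proof (intro super_fodc.intro super_fodc_axioms.intro \<Gamma>_bimodule)
  show "linear_map A \<Gamma> d"
    unfolding linear_map_def
    by (auto elim!: qsp_cases simp: d_class qsp_add qsp_smult \<Gamma>_simps mat_simps intro!: tri_cong)
next
  fix a i assume "a \<in> homog A i"
  then obtain p where p: "hom_poly i p" "a = cl p" by (auto simp: qsp_homog_iff)
  show "d a \<in> homog \<Gamma> (i + 1)"
    unfolding p d_class using mat_hom[of i p ix_parity \<gamma> IS, OF p(1) gen_parity]
    by (intro tri_homogI) (simp only: ix_parity.simps)
next
  fix a c i assume "a \<in> homog A i" "c \<in> carrier A"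
  then obtain p p' where p: "hom_poly i p" "a = cl p" "c = cl p'"
    by (auto simp: qsp_homog_iff qsp_carrier)
  show "d (a \<otimes>\<^bsub>A\<^esub> c) = d a \<triangleleft>\<^bsub>\<Gamma>\<^esub> c \<oplus>\<^bsub>\<Gamma>\<^esub> parity_sign i \<odot>\<^bsub>\<Gamma>\<^esub> (a \<triangleright>\<^bsub>\<Gamma>\<^esub> d c)"
    \<comment> \<open>This is the \<open>IS\<close> row of a matrix product: the inner index
      \<open>IS\<close> gives the signed term, the other three give \<open>row\<close>.\<close>
    unfolding p qsp_mult d_class ract_tri \<Gamma>_simps
    by (rule tri_cong) (simp add: mat_mult sum_ix row_def N_star[OF p(1)] scal_mult_left algebra_simps)
next
  interpret super_bimodule A \<Gamma> by (rule \<Gamma>_bimodule)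
  let ?S = "{a \<triangleright>\<^bsub>\<Gamma>\<^esub> d c | a c. a \<in> carrier A \<and> c \<in> carrier A}"
  have S: "?S \<subseteq> carrier \<Gamma>"
    by (auto elim!: qsp_cases simp: d_class \<Gamma>_simps)
  note sub = lin_span_submodule[OF \<Gamma>_module S]
  have "\<omega> \<in> lin_span \<Gamma> ?S" if "\<omega> \<in> carrier \<Gamma>" for \<omega>
  proof -
    obtain u1 u2 u3 where u: "\<omega> = (u1, u2, u3)" "u1 \<in> carrier A" "u2 \<in> carrier A" "u3 \<in> carrier A"
      using \<open>\<omega> \<in> carrier \<Gamma>\<close> by (auto simp: \<Gamma>_carrier)
    \<comment> \<open>By \<open>\<Gamma>_coordinates\<close> it is enough to have the left multiples
      of the differentials of the generators in the span.\<close>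
    have "u \<triangleright>\<^bsub>\<Gamma>\<^esub> d (qsp_gen q g) \<in> lin_span \<Gamma> ?S" if "u \<in> carrier A" for u g
      by (rule subsetD[OF lin_span_incl]) (use that qsp_class_closed in \<open>unfold qsp_gen_def, blast\<close>)
    then show ?thesis
      unfolding u(1) \<Gamma>_coordinates[OF u(2-4)] using u(2-4)
      by (intro module.submoduleE(5)[OF \<Gamma>_module sub]) auto
  qed
  then show "carrier \<Gamma> = lin_span \<Gamma> ?S"
    using module.submoduleE(1)[OF \<Gamma>_module sub] by auto
qed

end

section \<open>Free bases and the commutation relations\<close>

text \<open>Serves to replace the coefficient functions on \<open>{..<3}\<close> in the definition
  of a free basis by triples.\<close>

lemma ex1_bij_betw:
  assumes g: "bij_betw g U V" and f: "\<And>c. c \<in> U \<Longrightarrow> f c = h (g c)"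
  shows "(\<exists>!c. c \<in> U \<and> \<omega> = f c) \<longleftrightarrow> (\<exists>!p. p \<in> V \<and> \<omega> = h p)"
proof -
  have "(\<exists>!p. p \<in> V \<and> \<omega> = h p) \<longleftrightarrow> (\<exists>!c. c \<in> U \<and> \<omega> = h (g c))"
  proof
    assume "\<exists>!p. p \<in> V \<and> \<omega> = h p"
    then obtain p where p: "p \<in> V \<and> \<omega> = h p" and unique: "\<forall>p'. p' \<in> V \<and> \<omega> = h p' \<longrightarrow> p' = p"
      by (rule ex1E)
    obtain c where c: "c \<in> U" "g c = p"
      using p bij_betw_imp_surj_on[OF g] by blast
    show "\<exists>!c. c \<in> U \<and> \<omega> = h (g c)"
    proof (rule ex1I)
      show "c \<in> U \<and> \<omega> = h (g c)" using c p by simp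
      fix c' assume "c' \<in> U \<and> \<omega> = h (g c')"
      then show "c' = c"
        using unique bij_betwE[OF g] c inj_onD[OF bij_betw_imp_inj_on[OF g], of c' c] by simp
    qed
  next
    assume "\<exists>!c. c \<in> U \<and> \<omega> = h (g c)"
    then obtain c where c: "c \<in> U \<and> \<omega> = h (g c)" and unique: "\<forall>c'. c' \<in> U \<and> \<omega> = h (g c') \<longrightarrow> c' = c"
      by (rule ex1E)
    show "\<exists>!p. p \<in> V \<and> \<omega> = h p"
    proof (rule ex1I)
      show "g c \<in> V \<and> \<omega> = h (g c)" using c bij_betwE[OF g] by simp
      fix p assume p: "p \<in> V \<and> \<omega> = h p"
      then obtain c' where "c' \<in> U" "p = g c'"
        using bij_betw_imp_surj_on[OF g] by blast
      with p unique show "p = g c" by simp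
    qed
  qed
  moreover have "c \<in> U \<and> \<omega> = f c \<longleftrightarrow> c \<in> U \<and> \<omega> = h (g c)" for c
    using f by auto
  ultimately show ?thesis by simp
qed

lemma bij_betw_triple:
  "bij_betw (\<lambda>c. (c 0, c 1, c (2::nat))) ({..<3} \<rightarrow>\<^sub>E S) (S \<times> S \<times> S)"
proof (rule bij_betw_byWitness[where f' = "\<lambda>(u, v, w). \<lambda>k\<in>{..<3}. [u, v, w] ! k"])
  show "\<forall>c\<in>{..<3} \<rightarrow>\<^sub>E S. (case (c 0, c 1, c (2::nat)) of (u, v, w) \<Rightarrow> \<lambda>k\<in>{..<3}. [u, v, w] ! k) = c"
  proof
    fix c :: "nat \<Rightarrow> 'a" assume "c \<in> {..<3} \<rightarrow>\<^sub>E S"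
    then have "c \<in> extensional {..<3}" by (simp add: PiE_def)
    moreover have "[c 0, c 1, c 2] ! k = c k" if "k < 3" for k
    proof -
      have "k = 0 \<or> k = 1 \<or> k = 2" using that by arith
      then show ?thesis by auto
    qed
    ultimately show "(case (c 0, c 1, c 2) of (u, v, w) \<Rightarrow> \<lambda>k\<in>{..<3}. [u, v, w] ! k) = c"
      by (intro extensionalityI[of _ "{..<3}"]) simp_all
  qed
  show "(\<lambda>(u, v, w). \<lambda>k\<in>{..<3}. [u, v, w] ! k) ` (S \<times> S \<times> S) \<subseteq> {..<3} \<rightarrow>\<^sub>E S"
  proof (rule image_subsetI)
    fix p assume "p \<in> S \<times> S \<times> S"
    then obtain u v w where p: "p = (u, v, w)" "u \<in> S" "v \<in> S" "w \<in> S" by auto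
    have "[u, v, w] ! k \<in> S" if "k < 3" for k
    proof -
      have "k = 0 \<or> k = 1 \<or> k = 2" using that by arith
      then show ?thesis using p by auto
    qed
    then show "(case p of (u, v, w) \<Rightarrow> \<lambda>k\<in>{..<3}. [u, v, w] ! k) \<in> {..<3} \<rightarrow>\<^sub>E S"
      by (simp add: p restrict_PiE_iff)
  qed
  show "(\<lambda>c. (c 0, c 1, c (2::nat))) ` ({..<3} \<rightarrow>\<^sub>E S) \<subseteq> S \<times> S \<times> S"
  proof (rule image_subsetI)
    fix c :: "nat \<Rightarrow> 'a" assume c: "c \<in> {..<3} \<rightarrow>\<^sub>E S"
    have "c 0 \<in> S" "c 1 \<in> S" "c 2 \<in> S"
      using PiE_mem[OF c, of 0] PiE_mem[OF c, of 1] PiE_mem[OF c, of 2] by simp_all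
    then show "(c 0, c 1, c 2) \<in> S \<times> S \<times> S" by simp
  qed
  show "\<forall>p\<in>S \<times> S \<times> S. (\<lambda>c. (c 0, c 1, c (2::nat)))
      (case p of (u, v, w) \<Rightarrow> \<lambda>k\<in>{..<3}. [u, v, w] ! k) = p"
    by (simp add: case_prod_unfold)
qed

lemma (in super_bimodule) free_right_basis_3:
  "free_right_basis A M [e1, e2, e3] \<longleftrightarrow> e1 \<in> carrier M \<and> e2 \<in> carrier M \<and> e3 \<in> carrier M \<and>
    (\<forall>\<omega>\<in>carrier M. \<exists>!p. p \<in> carrier A \<times> carrier A \<times> carrier A \<and>
      \<omega> = (case p of (u, v, w) \<Rightarrow> e1 \<triangleleft>\<^bsub>M\<^esub> u \<oplus>\<^bsub>M\<^esub> e2 \<triangleleft>\<^bsub>M\<^esub> v \<oplus>\<^bsub>M\<^esub> e3 \<triangleleft>\<^bsub>M\<^esub> w))"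
proof (cases "e1 \<in> carrier M \<and> e2 \<in> carrier M \<and> e3 \<in> carrier M")
  case True
  have len: "length [e1, e2, e3] = 3" by simp
  have "(\<Oplus>\<^bsub>M\<^esub>k\<in>{..<3}. ([e1, e2, e3] ! k) \<triangleleft>\<^bsub>M\<^esub> c k) = (case (c 0, c 1, c 2) of (u, v, w) \<Rightarrow> e1 \<triangleleft>\<^bsub>M\<^esub> u \<oplus>\<^bsub>M\<^esub> e2 \<triangleleft>\<^bsub>M\<^esub> v \<oplus>\<^bsub>M\<^esub> e3 \<triangleleft>\<^bsub>M\<^esub> w)"
    if "c \<in> {..<3} \<rightarrow>\<^sub>E carrier A" for c
  proof -
    have "c 0 \<in> carrier A" "c 1 \<in> carrier A" "c 2 \<in> carrier A"
      using that by (auto simp: PiE_def Pi_def)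
    moreover have "{..<3::nat} = {0, 1, 2}" by auto
    ultimately show ?thesis
      using True by (simp add: ract_closed M.a_assoc)
  qed
  from ex1_bij_betw[where f = "\<lambda>c. \<Oplus>\<^bsub>M\<^esub>k\<in>{..<3}. ([e1, e2, e3] ! k) \<triangleleft>\<^bsub>M\<^esub> c k"
      and h = "\<lambda>(u, v, w). e1 \<triangleleft>\<^bsub>M\<^esub> u \<oplus>\<^bsub>M\<^esub> e2 \<triangleleft>\<^bsub>M\<^esub> v \<oplus>\<^bsub>M\<^esub> e3 \<triangleleft>\<^bsub>M\<^esub> w", OF bij_betw_triple this] True
  show ?thesis
    unfolding free_right_basis_def len by simp
next
  case False
  then show ?thesis by (auto simp: free_right_basis_def)
qed

lemma (in super_bimodule) free_left_basis_3:
  "free_left_basis A M [e1, e2, e3] \<longleftrightarrow> e1 \<in> carrier M \<and> e2 \<in> carrier M \<and> e3 \<in> carrier M \<and>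
    (\<forall>\<omega>\<in>carrier M. \<exists>!p. p \<in> carrier A \<times> carrier A \<times> carrier A \<and>
      \<omega> = (case p of (u, v, w) \<Rightarrow> u \<triangleright>\<^bsub>M\<^esub> e1 \<oplus>\<^bsub>M\<^esub> v \<triangleright>\<^bsub>M\<^esub> e2 \<oplus>\<^bsub>M\<^esub> w \<triangleright>\<^bsub>M\<^esub> e3))"
proof (cases "e1 \<in> carrier M \<and> e2 \<in> carrier M \<and> e3 \<in> carrier M")
  case True
  have len: "length [e1, e2, e3] = 3" by simp
  have "(\<Oplus>\<^bsub>M\<^esub>k\<in>{..<3}. c k \<triangleright>\<^bsub>M\<^esub> ([e1, e2, e3] ! k)) = (case (c 0, c 1, c 2) of (u, v, w) \<Rightarrow> u \<triangleright>\<^bsub>M\<^esub> e1 \<oplus>\<^bsub>M\<^esub> v \<triangleright>\<^bsub>M\<^esub> e2 \<oplus>\<^bsub>M\<^esub> w \<triangleright>\<^bsub>M\<^esub> e3)"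
    if "c \<in> {..<3} \<rightarrow>\<^sub>E carrier A" for c
  proof -
    have "c 0 \<in> carrier A" "c 1 \<in> carrier A" "c 2 \<in> carrier A"
      using that by (auto simp: PiE_def Pi_def)
    moreover have "{..<3::nat} = {0, 1, 2}" by auto
    ultimately show ?thesis
      using True by (simp add: lact_closed M.a_assoc)
  qed
  from ex1_bij_betw[where f = "\<lambda>c. \<Oplus>\<^bsub>M\<^esub>k\<in>{..<3}. c k \<triangleright>\<^bsub>M\<^esub> ([e1, e2, e3] ! k)"
      and h = "\<lambda>(u, v, w). u \<triangleright>\<^bsub>M\<^esub> e1 \<oplus>\<^bsub>M\<^esub> v \<triangleright>\<^bsub>M\<^esub> e2 \<oplus>\<^bsub>M\<^esub> w \<triangleright>\<^bsub>M\<^esub> e3", OF bij_betw_triple this] True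
  show ?thesis
    unfolding free_left_basis_def len by simp
next
  case False
  then show ?thesis by (auto simp: free_left_basis_def)
qed

section \<open>Freeness on both sides, and the commutation relations\<close>

context calc
begin

sublocale \<Gamma>: super_fodc A \<Gamma> d
  by (rule \<Gamma>_fodc)

lemma \<Gamma>_free_left: "free_left_basis A \<Gamma> (qsp_differentials q d)"
  unfolding qsp_differentials_def \<Gamma>.free_left_basis_3
proof (intro conjI ballI)
  fix \<omega> assume "\<omega> \<in> carrier \<Gamma>"
  then have "\<omega> \<in> carrier A \<times> carrier A \<times> carrier A" by (simp add: \<Gamma>_carrier)
  then show "\<exists>!p. p \<in> carrier A \<times> carrier A \<times> carrier A \<and> \<omega> = (case p of (u, v, w) \<Rightarrow>
      u \<triangleright>\<^bsub>\<Gamma>\<^esub> d (qsp_gen q GX) \<oplus>\<^bsub>\<Gamma>\<^esub> v \<triangleright>\<^bsub>\<Gamma>\<^esub> d (qsp_gen q GY) \<oplus>\<^bsub>\<Gamma>\<^esub> w \<triangleright>\<^bsub>\<Gamma>\<^esub> d (qsp_gen q GTheta))"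
    \<comment> \<open>The left coordinates of a triple are its components.\<close>
    by (intro ex1I[of _ \<omega>]) (auto simp flip: \<Gamma>_coordinates)
qed (simp_all add: qsp_gen_def)

definition diag :: "ix \<Rightarrow> gen \<Rightarrow> complex" where
  "diag i g = fst (the (map_of (calc_entries b q r s g) (i, i)))"

text \<open>An order of the indices that makes all matrices upper triangular. In the first calculus
  \<open>dx \<cdot> y\<close> involves dy, in the second \<open>dy \<cdot> x\<close> involves dx,
  hence the exchange of \<open>IX\<close> and \<open>IY\<close>.\<close>

definition rank :: "ix \<Rightarrow> nat" where
  "rank i = (case i of IS \<Rightarrow> 0 | IX \<Rightarrow> (if b then 1 else 2) | IY \<Rightarrow> (if b then 2 else 1) | IT \<Rightarrow> 3)"

lemma rank_inj: "rank i = rank j \<longleftrightarrow> i = j"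
  by (cases i; cases j; simp add: rank_def)

lemma gen_triangular: "rank j < rank i \<Longrightarrow> \<gamma> g i j = 0"
  by (cases g; cases i; cases j; simp add: rank_def calc_gen_def split: if_splits)

lemma gen_diag: "\<gamma> g i i = scal (diag i g) (nc_monom [g])"
  by (cases g; cases i; simp add: diag_def calc_gen_def)

lemma diag_nonzero: "diag i g \<noteq> 0"
  using nonzero by (cases g; cases i; simp add: diag_def)

lemma diag_inverse: "diag i GX * diag i GXinv = 1" "diag i GY * diag i GYinv = 1"
  using nonzero by (cases i; simp add: diag_def field_simps)+

lemma N_triangular: "rank j < rank i \<Longrightarrow> N p i j = 0"
proof (induction p rule: ncpoly_induct)
  case (monom c w)
  have "rank j < rank i \<Longrightarrow> word_mat \<gamma> w i j = 0" for i
  proof (induction w arbitrary: i)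
    case (Cons g w)
    have "\<gamma> g i k * word_mat \<gamma> w k j = 0" for k
      using Cons.IH[of k] Cons.prems gen_triangular[of k i g]
      by (cases "rank k < rank i") simp_all
    then show ?case by simp
  next
    case Nil
    then show ?case by (cases "i = j") simp_all
  qed
  with monom show ?case by (simp add: mat_simps)
qed (simp_all add: mat_simps)

text \<open>Diagonal entries of triangular matrices multiply, so they are given by the endomorphism
  that scales each generator.\<close>

lemma N_diag: "N p i i = rescale (diag i) p"
proof (induction p rule: ncpoly_induct)
  case (monom c w)
  have "word_mat \<gamma> w i i = scal (\<Prod>g\<leftarrow>w. diag i g) (nc_monom w)"
  proof (induction w)
    case (Cons g w)
    have "\<gamma> g i k * word_mat \<gamma> w k i = 0" if "k \<noteq> i" for k
      using gen_triangular[of k i g] N_triangular[of i k "nc_monom w"] that rank_inj[of i k]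
      by (cases "rank k < rank i") (simp_all add: mat_simps)
    then have "word_mat \<gamma> (g # w) i i = (\<Sum>k\<in>{i}. \<gamma> g i k * word_mat \<gamma> w k i)"
      unfolding word_mat.simps by (intro sum.mono_neutral_right) auto
    then show ?case
      by (simp add: gen_diag Cons scal_mult_left scal_mult_right nc_monom_mult mult.commute)
  qed (simp add: nc_monom_Nil)
  then show ?case by (simp add: mat_simps rescale_simps)
qed (simp_all add: mat_simps rescale_simps)

lemma N_diag_surj: "\<exists>p. N p i i = v"
  by (rule exI[of _ "rescale (\<lambda>g. inverse (diag i g)) v"])
    (simp add: N_diag rescale_rescale diag_nonzero rescale_ident)

text \<open>The inverse rescaling preserves the ideal as well, since by \<open>diag_inverse\<close>
  the scalars at a letter and at its inverse have product 1.\<close>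

lemma N_diag_inj:
  assumes "N p i i \<in> qsp_ideal q"
  shows "p \<in> qsp_ideal q"
proof -
  have "inverse (diag i GX) * inverse (diag i GXinv) = 1" "inverse (diag i GY) * inverse (diag i GYinv) = 1"
    using diag_inverse(1,2)[of i] by (simp_all flip: inverse_mult_distrib)
  with rescale_ideal[OF assms, of "\<lambda>g. inverse (diag i g)"] show ?thesis
    by (simp add: N_diag rescale_rescale diag_nonzero rescale_ident)
qed

text \<open>
  Since the matrix of \<open>p\<close> is triangular for \<open>rank\<close> with automorphisms on the diagonal, the
  coordinates with respect to the right basis are found one after the other.
\<close>

lemma right_coordinates_exist:
  "\<exists>p1 p2 p3. \<forall>j. j \<noteq> IS \<longrightarrow> N p1 IX j + N p2 IY j + N p3 IT j = v j"
proof -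
  have T: "N p IT IX = 0" "N p IT IY = 0" for p
    by (auto intro!: N_triangular simp: rank_def)
  have all: "(\<forall>j. j \<noteq> IS \<longrightarrow> P j) \<longleftrightarrow> P IX \<and> P IY \<and> P IT" for P
    by (metis ix.exhaust ix.distinct)
  have "\<exists>p1 p2. N p1 IX IX + N p2 IY IX = v IX \<and> N p1 IX IY + N p2 IY IY = v IY"
  proof (cases b)
    case True
    then have "N p IY IX = 0" for p by (intro N_triangular; unfold rank_def; simp)
    moreover obtain p1 where "N p1 IX IX = v IX" using N_diag_surj by blast
    moreover obtain p2 where "N p2 IY IY = v IY - N p1 IX IY" using N_diag_surj by blast
    ultimately show ?thesis by (intro exI[of _ p1] exI[of _ p2]) simp
  next
    case False
    then have "N p IX IY = 0" for p by (intro N_triangular; unfold rank_def; simp)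
    moreover obtain p2 where "N p2 IY IY = v IY" using N_diag_surj by blast
    moreover obtain p1 where "N p1 IX IX = v IX - N p2 IY IX" using N_diag_surj by blast
    ultimately show ?thesis by (intro exI[of _ p1] exI[of _ p2]) simp
  qed
  then obtain p1 p2 where "N p1 IX IX + N p2 IY IX = v IX" "N p1 IX IY + N p2 IY IY = v IY" by blast
  moreover obtain p3 where "N p3 IT IT = v IT - (N p1 IX IT + N p2 IY IT)" using N_diag_surj by blast
  ultimately show ?thesis
    unfolding all by (intro exI[of _ p1] exI[of _ p2] exI[of _ p3]) (simp add: T)
qed

text \<open>The columns are treated in the order of \<open>rank\<close>: once a coordinate lies in
  the ideal, \<open>N_ideal\<close> removes its contributions to the later columns.\<close>

lemma right_coordinates_unique:
  assumes "\<And>j. j \<noteq> IS \<Longrightarrow> N p1 IX j + N p2 IY j + N p3 IT j \<in> qsp_ideal q"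
  shows "p1 \<in> qsp_ideal q \<and> p2 \<in> qsp_ideal q \<and> p3 \<in> qsp_ideal q"
proof -
  have T: "N p IT IX = 0" "N p IT IY = 0" for p
    by (auto intro!: N_triangular simp: rank_def)
  have X: "N p1 IX IX + N p2 IY IX \<in> qsp_ideal q" and Y: "N p1 IX IY + N p2 IY IY \<in> qsp_ideal q"
    using assms[of IX] assms[of IY] by (simp_all add: T)
  have cancel: "u \<in> qsp_ideal q \<Longrightarrow> v + u \<in> qsp_ideal q \<Longrightarrow> v \<in> qsp_ideal q"
    "u \<in> qsp_ideal q \<Longrightarrow> u + v \<in> qsp_ideal q \<Longrightarrow> v \<in> qsp_ideal q" for u v
    using qsp_ideal_diff[of "v + u" q u] qsp_ideal_diff[of "u + v" q u] by simp_all
  have 12: "p1 \<in> qsp_ideal q \<and> p2 \<in> qsp_ideal q"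
  proof (cases b)
    case True
    then have "N p IY IX = 0" for p by (intro N_triangular; unfold rank_def; simp)
    with X have "p1 \<in> qsp_ideal q" by (simp add: N_diag_inj)
    with cancel(2)[OF N_ideal[OF this] Y] show ?thesis by (simp add: N_diag_inj)
  next
    case False
    then have "N p IX IY = 0" for p by (intro N_triangular; unfold rank_def; simp)
    with Y have "p2 \<in> qsp_ideal q" by (simp add: N_diag_inj)
    with cancel(1)[OF N_ideal[OF this] X] show ?thesis by (simp add: N_diag_inj)
  qed
  then have "N p1 IX IT + N p2 IY IT \<in> qsp_ideal q"
    by (intro qsp_ideal_add N_ideal) auto
  from cancel(2)[OF this assms[of IT]] 12 show ?thesis by (simp add: N_diag_inj)
qed

lemma right_combination:
  "d (qsp_gen q GX) \<triangleleft>\<^bsub>\<Gamma>\<^esub> cl p1 \<oplus>\<^bsub>\<Gamma>\<^esub> d (qsp_gen q GY) \<triangleleft>\<^bsub>\<Gamma>\<^esub> cl p2 \<oplus>\<^bsub>\<Gamma>\<^esub> d (qsp_gen q GTheta) \<triangleleft>\<^bsub>\<Gamma>\<^esub> cl p3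
    = tri (\<lambda>j. N p1 IX j + N p2 IY j + N p3 IT j)"
  by (simp add: qsp_gen_def d_class ract_tri \<Gamma>_simps row_def mat_gen calc_gen_def nc_monom_Nil)

lemma \<Gamma>_free_right: "free_right_basis A \<Gamma> (qsp_differentials q d)"
  unfolding qsp_differentials_def \<Gamma>.free_right_basis_3
proof (intro conjI ballI)
  fix \<omega> assume "\<omega> \<in> carrier \<Gamma>"
  then obtain v where \<omega>: "\<omega> = tri v" by (rule tri_cases)
  obtain p1 p2 p3 where p: "\<And>j. j \<noteq> IS \<Longrightarrow> N p1 IX j + N p2 IY j + N p3 IT j = v j"
    using right_coordinates_exist by blast
  show "\<exists>!p. p \<in> carrier A \<times> carrier A \<times> carrier A \<and> \<omega> = (case p of (u, v, w) \<Rightarrow>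
      d (qsp_gen q GX) \<triangleleft>\<^bsub>\<Gamma>\<^esub> u \<oplus>\<^bsub>\<Gamma>\<^esub> d (qsp_gen q GY) \<triangleleft>\<^bsub>\<Gamma>\<^esub> v \<oplus>\<^bsub>\<Gamma>\<^esub> d (qsp_gen q GTheta) \<triangleleft>\<^bsub>\<Gamma>\<^esub> w)"
  proof (rule ex1I[of _ "(cl p1, cl p2, cl p3)"], goal_cases)
    case 1
    show ?case by (simp add: right_combination \<omega> tri_eq_iff p)
  next
    case (2 p')
    then obtain r1 r2 r3 where r: "p' = (cl r1, cl r2, cl r3)"
      by (auto elim!: qsp_cases)
    \<comment> \<open>Both coordinate vectors give the same element, so their difference satisfies
      the hypothesis of \<open>right_coordinates_unique\<close>.\<close>
    have "N (r1 - p1) IX j + N (r2 - p2) IY j + N (r3 - p3) IT j \<in> qsp_ideal q" if "j \<noteq> IS" for j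
    proof -
      have "v j - (N r1 IX j + N r2 IY j + N r3 IT j) \<in> qsp_ideal q"
        using 2 that by (simp add: r right_combination \<omega> tri_eq_iff)
      from qsp_ideal_uminus[OF this] p[OF that] show ?thesis
        by (simp add: mat_simps algebra_simps)
    qed
    from right_coordinates_unique[OF this] show ?case
      by (simp add: r qsp_class_eq_iff)
  qed
qed (simp_all add: qsp_gen_def)

lemma first_relations_hold: "b \<Longrightarrow> first_relations q r s \<Gamma> d"
  unfolding first_relations_def Let_def qsp_gen_def d_class ract_tri \<Gamma>_simps row_def[abs_def]
    mat_gen calc_gen_def
  by (intro conjI tri_cong; rename_tac j; case_tac j)
    (simp_all add: nc_monom_mult scal_mult_left scal_mult_right)

lemma second_relations_hold: "\<not> b \<Longrightarrow> second_relations q r s \<Gamma> d"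
  unfolding second_relations_def Let_def qsp_gen_def d_class ract_tri \<Gamma>_simps row_def[abs_def]
    mat_gen calc_gen_def
  by (intro conjI tri_cong; rename_tac j; case_tac j)
    (simp_all add: nc_monom_mult scal_mult_left scal_mult_right)

end

section \<open>Evaluation of free polynomials and the comultiplication\<close>

text \<open>The target of the comultiplication, \<open>tensor_algebra\<close>, is a plain module
  record without a grading, so evaluation is set up for algebras of this kind.\<close>

locale complex_algebra = T: module complex_ring T + T: ring T for T :: "(complex, 'a, 'x) module_scheme" +
  assumes smult_mult_l: "a \<in> carrier T \<Longrightarrow> c \<in> carrier T \<Longrightarrow> (k \<odot>\<^bsub>T\<^esub> a) \<otimes>\<^bsub>T\<^esub> c = k \<odot>\<^bsub>T\<^esub> (a \<otimes>\<^bsub>T\<^esub> c)"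
    and smult_mult_r: "a \<in> carrier T \<Longrightarrow> c \<in> carrier T \<Longrightarrow> a \<otimes>\<^bsub>T\<^esub> (k \<odot>\<^bsub>T\<^esub> c) = k \<odot>\<^bsub>T\<^esub> (a \<otimes>\<^bsub>T\<^esub> c)"

locale free_evaluation = complex_algebra T for T :: "(complex, 'a, 'x) module_scheme" +
  fixes v :: "gen \<Rightarrow> 'a"
  assumes v_closed [simp]: "v g \<in> carrier T"
begin

abbreviation "ev \<equiv> nc_eval T v"

definition word_ev :: "gen list \<Rightarrow> 'a" where
  "word_ev w = foldr (\<lambda>g a. v g \<otimes>\<^bsub>T\<^esub> a) w \<one>\<^bsub>T\<^esub>"

lemma word_ev_simps [simp]: "word_ev [] = \<one>\<^bsub>T\<^esub>" "word_ev (g # w) = v g \<otimes>\<^bsub>T\<^esub> word_ev w"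
  by (simp_all add: word_ev_def)

lemma word_ev_closed [simp]: "word_ev w \<in> carrier T"
  by (induction w) simp_all

lemma word_ev_append: "word_ev (u @ w) = word_ev u \<otimes>\<^bsub>T\<^esub> word_ev w"
  by (induction u) (simp_all add: T.m_assoc)

lemma ev_superset:
  assumes "finite S" "Poly_Mapping.keys p \<subseteq> S"
  shows "ev p = (\<Oplus>\<^bsub>T\<^esub>w\<in>S. Poly_Mapping.lookup p w \<odot>\<^bsub>T\<^esub> word_ev (letters w))"
  unfolding nc_eval_def word_ev_def[symmetric]
  using assms by (intro T.add.finprod_mono_neutral_cong_left)
    (simp_all add: in_keys_iff T.smult_l_null[simplified])

lemma ev_closed [simp]: "ev p \<in> carrier T"
  by (simp add: ev_superset[OF finite_keys order_refl])

lemma ev_add: "ev (p + p') = ev p \<oplus>\<^bsub>T\<^esub> ev p'"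
proof -
  let ?S = "Poly_Mapping.keys p \<union> Poly_Mapping.keys p'"
  have "ev r = (\<Oplus>\<^bsub>T\<^esub>w\<in>?S. Poly_Mapping.lookup r w \<odot>\<^bsub>T\<^esub> word_ev (letters w))" if "r \<in> {p, p', p + p'}" for r
    using that keys_add[of p p'] by (intro ev_superset) auto
  then show ?thesis
    by (simp add: lookup_add T.smult_l_distr[simplified])
qed

lemma ev_zero [simp]: "ev 0 = \<zero>\<^bsub>T\<^esub>"
  by (simp add: nc_eval_def)

lemma ev_mono: "ev (scal c (nc_monom w)) = c \<odot>\<^bsub>T\<^esub> word_ev w"
proof -
  have "ev (scal c (nc_monom w)) = (\<Oplus>\<^bsub>T\<^esub>u\<in>{Word w}. c \<odot>\<^bsub>T\<^esub> word_ev (letters u))"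
    by (subst ev_superset[of "{Word w}"]) (simp_all add: nc_monom_def cong: T.finsum_cong')
  then show ?thesis by simp
qed

lemma ev_monom: "ev (nc_monom w) = word_ev w"
  using ev_mono[of 1 w] by (simp add: T.smult_one[simplified])

lemma ev_scal: "ev (scal c p) = c \<odot>\<^bsub>T\<^esub> ev p"
proof (induction p rule: ncpoly_induct)
  case (monom a w)
  then show ?case by (simp add: ev_mono T.smult_assoc1[simplified])
qed (simp_all add: ev_add scal_distribs T.smult_r_distr[simplified])

lemma ev_diff: "ev (p - p') = ev p \<ominus>\<^bsub>T\<^esub> ev p'"
proof -
  have "ev p = ev (p - p') \<oplus>\<^bsub>T\<^esub> ev p'"
    by (simp flip: ev_add)
  then show ?thesis
    by (simp add: T.minus_eq T.a_assoc T.r_neg)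
qed

lemma ev_mult: "ev (p * p') = ev p \<otimes>\<^bsub>T\<^esub> ev p'"
proof (induction p rule: ncpoly_induct)
  case (monom a u)
  show ?case
  proof (induction p' rule: ncpoly_induct)
    case (monom c w)
    then show ?case
      by (simp add: scal_mult_left scal_mult_right nc_monom_mult ev_mono word_ev_append
          smult_mult_l smult_mult_r T.smult_assoc1[simplified])
  qed (simp_all add: ev_add distrib_left T.r_distr)
qed (simp_all add: ev_add distrib_right T.l_distr)

lemma ev_one: "ev 1 = \<one>\<^bsub>T\<^esub>"
  using ev_monom[of "[]"] by (simp add: nc_monom_Nil)

lemma ev_ideal:
  assumes "p \<in> qsp_ideal q" "\<And>r. r \<in> qsp_relators q \<Longrightarrow> ev r = \<zero>\<^bsub>T\<^esub>"
  shows "ev p = \<zero>\<^bsub>T\<^esub>"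
proof -
  have "p \<in> {p. ev p = \<zero>\<^bsub>T\<^esub>}"
    using assms(2) by (intro qsp_ideal_minimal[OF assms(1)]) (auto simp: ev_add ev_mult)
  then show ?thesis by simp
qed

end

lemma superalgebra_tensor_complex_algebra:
  assumes "superalgebra A"
  shows "complex_algebra (tensor_algebra A A)"
proof -
  interpret superalgebra A by (rule assms)
  show ?thesis
    by (intro complex_algebra.intro complex_algebra_axioms.intro tensor_algebra_ring tensor_algebra_module)
      (simp_all add: mult.kp_smult_left mult.kp_smult_right)
qed

section \<open>The comultiplication on cosets\<close>

locale quantum_superspace =
  fixes q :: complex
  assumes q_nonzero: "q \<noteq> 0"
begin

abbreviation "A \<equiv> qsp q"
abbreviation "cl \<equiv> qsp_class q"
abbreviation "mo w \<equiv> cl (nc_monom w)"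
abbreviation "AA \<equiv> tensor_algebra A A"

sublocale A: superalgebra A
  by (rule qsp_superalgebra)

sublocale AA: complex_algebra AA
  by (rule superalgebra_tensor_complex_algebra[OF qsp_superalgebra])

abbreviation "P u w \<equiv> A.mult.AP.pt (mo u) (mo w)"

lemma mo_mult: "mo u \<otimes>\<^bsub>A\<^esub> mo w = mo (u @ w)"
  by (simp add: qsp_mult nc_monom_mult)

lemma mo_homog: "mo w \<in> homog A (word_parity (Word w))"
  by (simp add: qsp_class_homogI hom_poly_monom)

lemma mo_Nil: "\<one>\<^bsub>A\<^esub> = mo []"
  by (simp add: qsp_one nc_monom_Nil)

lemma P_mult:
  "A.mult.kp (P u w) (P u' w') =
    parity_sign (word_parity (Word w) * word_parity (Word u')) \<odot>\<^bsub>A.mult.AP.TS\<^esub> P (u @ u') (w @ w')"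
  using A.mult.kp_pure[OF qsp_class_closed mo_homog mo_homog qsp_class_closed]
  by (simp only: mo_mult)

lemma mo_nfI: "nf q (nc_monom u) = nf q (scal c (nc_monom w)) \<Longrightarrow> mo u = c \<odot>\<^bsub>A\<^esub> mo w"
  unfolding qsp_smult by (rule qsp_class_nfI[OF q_nonzero])

abbreviation "cg \<equiv> qsp_comult_gen q"

declare qsp_comult_gen.simps [simp del]

lemma cg_even: "g \<noteq> GTheta \<Longrightarrow> cg g = P [g] [g]"
  by (cases g) (simp_all add: qsp_comult_gen.simps qsp_gen_def)

lemma cg_theta: "cg GTheta = P [GTheta] [GXinv, GY] \<oplus>\<^bsub>A.mult.AP.TS\<^esub> P [] [GTheta]"
  by (simp add: qsp_comult_gen.simps qsp_gen_def mo_mult mo_Nil)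

sublocale ev: free_evaluation AA cg
proof
  show "cg g \<in> carrier AA" for g
    by (cases "g = GTheta") (simp_all add: cg_theta cg_even)
qed

lemma ev_closed_TS [simp]: "ev.ev p \<in> carrier A.mult.AP.TS"
  using ev.ev_closed by simp

text \<open>The coproducts of the generators satisfy the defining relations, which makes
  \<open>qsp_comult\<close> independent of the representative.\<close>

lemma ev_relators:
  assumes "r \<in> qsp_relators q"
  shows "ev.ev r = \<zero>\<^bsub>AA\<^esub>"
proof -
  note pt_smult = A.mult.AP.pt_smult_left A.mult.AP.pt_smult_right
  have two: "ev.ev (nc_monom [g, h]) = A.mult.kp (cg g) (cg h)" for g h
    using ev.v_closed by (simp add: ev.ev_monom)
  have one: "ev.ev 1 = P [] []"
    by (simp add: ev.ev_one mo_Nil)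
  have eq: "ev.ev (p - p') = \<zero>\<^bsub>AA\<^esub>" if "ev.ev p = ev.ev p'" for p p'
    by (simp only: ev.ev_diff that AA.T.r_right_minus_eq ev.ev_closed)
  have unit: "A.mult.kp (cg g) (cg h) = P [] []"
    if "g \<noteq> GTheta" "h \<noteq> GTheta" "mo [g, h] = mo []" for g h
    using that by (simp add: cg_even P_mult A.mult.TS.smult_one[simplified])
  have xy: "A.mult.kp (cg GX) (cg GY) = A.mult.kp (cg GY) (cg GX)"
  proof -
    have "mo [GX, GY] = 1 \<odot>\<^bsub>A\<^esub> mo [GY, GX]" by (rule mo_nfI) simp
    then have "mo [GX, GY] = mo [GY, GX]" by (simp add: qsp_smult)
    then show ?thesis by (simp add: cg_even P_mult)
  qed
  \<comment> \<open>Here \<open>g\<close> commutes with x^{-1} y, so in each summand the factor q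
    arises from the single \<theta>.\<close>
  have theta: "A.mult.kp (cg g) (cg GTheta) = q \<odot>\<^bsub>AA\<^esub> A.mult.kp (cg GTheta) (cg g)" if "g \<in> {GX, GY}" for g
  proof -
    have g: "g \<noteq> GTheta" using that by auto
    have 1: "mo [g, GTheta] = q \<odot>\<^bsub>A\<^esub> mo [GTheta, g]"
      by (rule mo_nfI) (use that in auto)
    have "mo [g, GXinv, GY] = 1 \<odot>\<^bsub>A\<^esub> mo [GXinv, GY, g]"
      by (rule mo_nfI) (use that in auto)
    then have 2: "mo [g, GXinv, GY] = mo [GXinv, GY, g]" by (simp add: qsp_smult)
    have par: "word_parity (Word [g]) = 0" using g by simp
    show ?thesis
      by (simp add: cg_theta cg_even[OF g] A.mult.kp_add_left A.mult.kp_add_right P_mult 1 2 g pt_smult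
          A.mult.TS.smult_r_distr[simplified] A.mult.TS.smult_one[simplified])
  qed
  \<comment> \<open>The squares of both summands vanish. The mixed products cancel: \<theta>
    commutes with x^{-1} y, as q and its inverse compensate, and one of the two products carries the
    sign -1.\<close>
  have theta_theta: "A.mult.kp (cg GTheta) (cg GTheta) = \<zero>\<^bsub>AA\<^esub>"
  proof -
    have "mo [GTheta, GTheta] = 0 \<odot>\<^bsub>A\<^esub> mo []"
      by (rule mo_nfI) simp
    then have 1: "mo [GTheta, GTheta] = \<zero>\<^bsub>A\<^esub>" by (simp add: qsp_smult qsp_zero)
    have "mo [GXinv, GY, GTheta] = 1 \<odot>\<^bsub>A\<^esub> mo [GTheta, GXinv, GY]"
      by (rule mo_nfI) (use q_nonzero in simp)
    then have 2: "mo [GXinv, GY, GTheta] = mo [GTheta, GXinv, GY]" by (simp add: qsp_smult)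
    let ?Z = "P [GTheta] [GTheta, GXinv, GY]"
    have "?Z \<oplus>\<^bsub>A.mult.AP.TS\<^esub> (- 1) \<odot>\<^bsub>A.mult.AP.TS\<^esub> ?Z = (1 + - 1) \<odot>\<^bsub>A.mult.AP.TS\<^esub> ?Z"
      by (subst A.mult.TS.smult_l_distr[simplified]) (simp_all add: A.mult.TS.smult_one[simplified])
    then have Z: "?Z \<oplus>\<^bsub>A.mult.AP.TS\<^esub> (- 1) \<odot>\<^bsub>A.mult.AP.TS\<^esub> ?Z = \<zero>\<^bsub>A.mult.AP.TS\<^esub>"
      by (simp add: A.mult.TS.smult_l_null[simplified])
    then have Z': "(- 1) \<odot>\<^bsub>A.mult.AP.TS\<^esub> ?Z \<oplus>\<^bsub>A.mult.AP.TS\<^esub> ?Z = \<zero>\<^bsub>A.mult.AP.TS\<^esub>"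
      by (simp add: A.mult.TS.a_comm)
    show ?thesis
      by (simp add: cg_theta A.mult.kp_add_left A.mult.kp_add_right P_mult 1 2 Z Z' A.mult.AP.pt_zero_left
          A.mult.AP.pt_zero_right A.mult.TS.smult_r_null[simplified] A.mult.TS.smult_one[simplified])
  qed
  have inv: "mo [GX, GXinv] = mo []" "mo [GXinv, GX] = mo []" "mo [GY, GYinv] = mo []" "mo [GYinv, GY] = mo []"
    by (rule qsp_class_nfI[OF q_nonzero]; simp)+
  have inverses: "ev.ev (nc_monom [g, h] - 1) = \<zero>\<^bsub>AA\<^esub>"
    if "g \<noteq> GTheta" "h \<noteq> GTheta" "mo [g, h] = mo []" for g h
    by (rule eq) (simp only: two one unit[OF that])
  have commute: "ev.ev (nc_monom [GX, GY] - nc_monom [GY, GX]) = \<zero>\<^bsub>AA\<^esub>"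
    by (rule eq) (simp only: two xy)
  have odd: "ev.ev (nc_monom [g, GTheta] - q \<odot>\<^bsub>free_algebra\<^esub> nc_monom [GTheta, g]) = \<zero>\<^bsub>AA\<^esub>"
    if "g \<in> {GX, GY}" for g
    by (rule eq) (simp only: two theta[OF that] ev.ev_scal free_algebra_simps)
  show ?thesis
    using assms inverses[OF _ _ inv(1)] inverses[OF _ _ inv(2)] inverses[OF _ _ inv(3)]
      inverses[OF _ _ inv(4)] commute odd[of GX] odd[of GY] two[of GTheta GTheta] theta_theta
    unfolding qsp_relators_def by (elim insertE emptyE) simp_all
qed

text \<open>Evaluation is constant on a coset, so its image is a singleton and
  \<open>the_elem\<close> returns the value.\<close>

lemma comult_class: "qsp_comult q (cl p) = ev.ev p"
proof -
  have "ev.ev p' = ev.ev p" if "p' \<in> cl p" for p'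
  proof -
    have "p' - p \<in> qsp_ideal q"
      using that by (simp only: mem_qsp_class_iff)
    then have "ev.ev (p' - p) = \<zero>\<^bsub>AA\<^esub>"
      by (rule ev.ev_ideal[OF _ ev_relators])
    then show ?thesis
      using ev.ev_add[of "p' - p" p] by simp
  qed
  then have "ev.ev ` cl p = (\<lambda>_. ev.ev p) ` cl p"
    by (rule image_cong[OF refl])
  also have "\<dots> = {ev.ev p}"
    by (rule image_constant[OF qsp_class_self])
  finally show ?thesis by (simp add: qsp_comult_def)
qed

lemma word_parity_even: "GTheta \<notin> set w \<Longrightarrow> word_parity (Word w) = 0"
  by (induction w) auto

text \<open>Monomials without \<theta> are group-like, being products of even group-like
  generators.\<close>

lemma ev_even_monom: "GTheta \<notin> set w \<Longrightarrow> ev.ev (nc_monom w) = P w w"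
proof (induction w)
  case (Cons g w)
  then have "cg g = P [g] [g]" by (intro cg_even) auto
  with Cons show ?case
    by (simp add: ev.ev_monom P_mult word_parity_even A.mult.TS.smult_one[simplified])
qed (simp add: ev.ev_monom mo_Nil)

end

section \<open>Right covariance\<close>

context calc
begin

sublocale Q: quantum_superspace q
  by unfold_locales (rule nonzero)

abbreviation "AT \<equiv> A.mult.AP.TS"
abbreviation "GT \<equiv> \<Gamma>.left.QB.TS"
abbreviation "E \<equiv> Q.ev.ev"
abbreviation "kL \<equiv> \<Gamma>.left.kp"
abbreviation "kR \<equiv> \<Gamma>.right.kp"
abbreviation "gpt \<equiv> \<Gamma>.left.QB.pt"

lemma E_simps:
  "E p \<in> carrier AT" "E (p + p') = E p \<oplus>\<^bsub>AT\<^esub> E p'" "E (scal c p) = c \<odot>\<^bsub>AT\<^esub> E p"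
  "E (p * p') = A.mult.kp (E p) (E p')" "E 0 = \<zero>\<^bsub>AT\<^esub>" "E 1 = A.mult.AP.pt \<one>\<^bsub>A\<^esub> \<one>\<^bsub>A\<^esub>"
  by (simp_all add: Q.ev.ev_add Q.ev.ev_scal Q.ev.ev_mult Q.ev.ev_one)

text \<open>
  The coaction sends the basis element with index \<open>i\<close> to its tensor product with the monomial
  \<open>weight i\<close>; the extra index \<open>IS\<close> gets weight \<open>1\<close>.
\<close>

fun weight :: "ix \<Rightarrow> gen list" where
  "weight IS = []"
| "weight IX = [GX]"
| "weight IY = [GY]"
| "weight IT = [GXinv, GY]"

definition unit_vec :: "ix \<Rightarrow> ncpoly set \<times> ncpoly set \<times> ncpoly set" where
  "unit_vec i = tri (\<lambda>k. if k = i then 1 else 0)"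

definition base :: "ix \<Rightarrow> ((ncpoly set \<times> ncpoly set \<times> ncpoly set) \<times> ncpoly set \<Rightarrow>\<^sub>0 complex) set" where
  "base i = gpt (unit_vec i) (Q.mo (weight i))"

definition coact where
  "coact = (\<lambda>(u1, u2, u3). kL (qsp_comult q u1) (base IX) \<oplus>\<^bsub>GT\<^esub> kL (qsp_comult q u2) (base IY)
    \<oplus>\<^bsub>GT\<^esub> kL (qsp_comult q u3) (base IT))"

lemma unit_vec_closed [simp]: "unit_vec i \<in> carrier \<Gamma>"
  by (simp add: unit_vec_def)

lemma base_closed [simp]: "base i \<in> carrier GT"
  by (simp add: base_def)

lemma coact_tri: "coact (tri v) =
    kL (E (v IX)) (base IX) \<oplus>\<^bsub>GT\<^esub> kL (E (v IY)) (base IY) \<oplus>\<^bsub>GT\<^esub> kL (E (v IT)) (base IT)"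
  by (simp add: coact_def tri_def Q.comult_class)

lemma kL_zero: "T \<in> carrier GT \<Longrightarrow> kL \<zero>\<^bsub>AT\<^esub> T = \<zero>\<^bsub>GT\<^esub>"
  using \<Gamma>.left.kp_smult_left[of "\<zero>\<^bsub>AT\<^esub>" T 0]
  by (simp add: A.mult.TS.smult_l_null[simplified] \<Gamma>.left.TS.smult_l_null[simplified])

lemma kL_closed [simp]: "kL (E p) (base i) \<in> carrier GT"
  by (simp add: E_simps)

lemma coact_closed: "\<omega> \<in> carrier \<Gamma> \<Longrightarrow> coact \<omega> \<in> carrier GT"
  by (elim tri_cases) (simp add: coact_tri)

lemma coact_add: "\<omega> \<in> carrier \<Gamma> \<Longrightarrow> \<omega>' \<in> carrier \<Gamma> \<Longrightarrow> coact (\<omega> \<oplus>\<^bsub>\<Gamma>\<^esub> \<omega>') = coact \<omega> \<oplus>\<^bsub>GT\<^esub> coact \<omega>'"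
  by (elim tri_cases) (simp add: coact_tri \<Gamma>_simps E_simps \<Gamma>.left.kp_add_left \<Gamma>.left.TS.a_ac)

lemma coact_smult: "\<omega> \<in> carrier \<Gamma> \<Longrightarrow> coact (c \<odot>\<^bsub>\<Gamma>\<^esub> \<omega>) = c \<odot>\<^bsub>GT\<^esub> coact \<omega>"
  by (elim tri_cases) (simp add: coact_tri \<Gamma>_simps E_simps \<Gamma>.left.kp_smult_left
      \<Gamma>.left.TS.smult_r_distr[simplified])

lemma coact_lact: "\<omega> \<in> carrier \<Gamma> \<Longrightarrow> coact (cl p \<triangleright>\<^bsub>\<Gamma>\<^esub> \<omega>) = kL (E p) (coact \<omega>)"
  by (elim tri_cases) (simp add: coact_tri \<Gamma>_simps E_simps \<Gamma>.left.kp_add_right \<Gamma>.left_assoc)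

lemma coact_unit_vec: "i \<noteq> IS \<Longrightarrow> coact (cl p \<triangleright>\<^bsub>\<Gamma>\<^esub> unit_vec i) = kL (E p) (base i)"
  by (cases i) (simp_all add: unit_vec_def coact_tri \<Gamma>_simps if_distrib[of "\<lambda>x. p * x"] E_simps kL_zero cong: if_cong)

lemma tri_decompose:
  "tri v = cl (v IX) \<triangleright>\<^bsub>\<Gamma>\<^esub> unit_vec IX \<oplus>\<^bsub>\<Gamma>\<^esub> cl (v IY) \<triangleright>\<^bsub>\<Gamma>\<^esub> unit_vec IY \<oplus>\<^bsub>\<Gamma>\<^esub> cl (v IT) \<triangleright>\<^bsub>\<Gamma>\<^esub> unit_vec IT"
  unfolding unit_vec_def \<Gamma>_simps
proof (rule tri_cong)
  show "v j = v IX * (if j = IX then 1 else 0) + v IY * (if j = IY then 1 else 0)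
      + v IT * (if j = IT then 1 else 0)" if "j \<noteq> IS" for j
    using that by (cases j) simp_all
qed

text \<open>Scalars are absorbed into the left coefficient, so sums and left multiples of basis
  vectors suffice.\<close>

lemma tri_linear_induct:
  assumes "\<omega> \<in> carrier \<Gamma>"
    and "\<And>\<omega> \<omega>'. \<omega> \<in> carrier \<Gamma> \<Longrightarrow> \<omega>' \<in> carrier \<Gamma> \<Longrightarrow> R \<omega> \<Longrightarrow> R \<omega>' \<Longrightarrow> R (\<omega> \<oplus>\<^bsub>\<Gamma>\<^esub> \<omega>')"
    and "\<And>p i. i \<noteq> IS \<Longrightarrow> R (cl p \<triangleright>\<^bsub>\<Gamma>\<^esub> unit_vec i)"
  shows "R \<omega>"
proof -
  obtain v where v: "\<omega> = tri v" using assms(1) by (rule tri_cases)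
  show ?thesis
    unfolding v by (subst tri_decompose) (intro assms(2,3) \<Gamma>.lact_closed \<Gamma>.M.a_closed; simp)
qed

section \<open>The coaction and right multiplication\<close>

lemma unit_vec_homog: "unit_vec i \<in> homog \<Gamma> (ix_parity i)"
  unfolding unit_vec_def by (rule tri_homogI) (cases "ix_parity i"; simp add: hom_poly_one)

text \<open>Such a monomial is group-like and even, so its coproduct multiplies both tensor factors
  by it without a sign.\<close>

lemma gpt_single:
  assumes "GTheta \<notin> set w"
  shows "kL (E (scal c (nc_monom w))) (base j) =
    gpt (cl (scal c (nc_monom w)) \<triangleright>\<^bsub>\<Gamma>\<^esub> unit_vec j) (Q.mo (w @ weight j))"
proof -
  have w: "Q.mo w \<in> homog A 0"
    using Q.mo_homog[of w] Q.word_parity_even[OF assms] by simp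
  show ?thesis
    using \<Gamma>.left.kp_pure[OF qsp_class_closed w unit_vec_homog qsp_class_closed]
    by (simp add: E_simps Q.ev_even_monom[OF assms] \<Gamma>.left.kp_smult_left base_def Q.mo_mult
        \<Gamma>.left.TS.smult_one[simplified] \<Gamma>.left.QB.pt_smult_left \<Gamma>.lact_closed
        \<Gamma>.lact_smult_left flip: qsp_smult)
qed

text \<open>The second tensor factor of that summand of the coproduct of \<open>g\<close> whose
  first factor is \<open>g\<close>.\<close>

fun gen_weight :: "gen \<Rightarrow> gen list" where
  "gen_weight GTheta = [GXinv, GY]"
| "gen_weight g = [g]"

text \<open>
  The coaction is compatible with right multiplication because all products of a matrix entry and
  the weight of its column agree along a row; only the diagonal entries of \<open>GTheta\<close>, whose
  coproduct has two terms, need a separate computation.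
\<close>

lemma entry_weight:
  assumes "j \<noteq> IS" "g \<noteq> GTheta \<or> i \<noteq> j"
  shows "\<gamma> g i j = 0 \<or> (\<exists>c w. \<gamma> g i j = scal c (nc_monom w) \<and> GTheta \<notin> set w \<and>
    Q.mo (w @ weight j) = Q.mo (weight i @ gen_weight g))"
proof (cases "map_of (calc_entries b q r s g) (i, j)")
  case None
  then show ?thesis by (simp add: calc_gen_def)
next
  case (Some e)
  obtain c w where e: "e = (c, w)" by (cases e)
  have "GTheta \<notin> set w \<and> nf q (nc_monom (w @ weight j)) = nf q (nc_monom (weight i @ gen_weight g))"
    using assms Some unfolding e by (cases g; cases i; cases j; cases b; force)
  then have "GTheta \<notin> set w" "Q.mo (w @ weight j) = Q.mo (weight i @ gen_weight g)"
    using qsp_class_nfI[OF nonzero(1), of "nc_monom (w @ weight j)"] by (simp_all del: nf_simps)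
  moreover have "\<gamma> g i j = scal c (nc_monom w)"
    using Some e by (simp add: calc_gen_def)
  ultimately show ?thesis by blast
qed

lemma coact_entry:
  assumes "j \<noteq> IS" "g \<noteq> GTheta \<or> i \<noteq> j"
  shows "kL (E (\<gamma> g i j)) (base j) = gpt (cl (\<gamma> g i j) \<triangleright>\<^bsub>\<Gamma>\<^esub> unit_vec j) (Q.mo (weight i @ gen_weight g))"
proof (cases "\<gamma> g i j = 0")
  case True
  have "cl 0 \<triangleright>\<^bsub>\<Gamma>\<^esub> unit_vec j = \<zero>\<^bsub>\<Gamma>\<^esub>"
    by (simp add: unit_vec_def \<Gamma>_simps)
  then show ?thesis
    by (simp add: True E_simps kL_zero \<Gamma>.left.QB.pt_zero_left)
next
  case False
  then obtain c w where cw: "\<gamma> g i j = scal c (nc_monom w)" "GTheta \<notin> set w"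
      "Q.mo (w @ weight j) = Q.mo (weight i @ gen_weight g)"
    using entry_weight[OF assms] by auto
  show ?thesis
    unfolding cw(1) gpt_single[OF cw(2)] cw(3) ..
qed

lemma gpt_tri:
  assumes "a \<in> carrier A"
  shows "gpt (tri v) a = gpt (cl (v IX) \<triangleright>\<^bsub>\<Gamma>\<^esub> unit_vec IX) a \<oplus>\<^bsub>GT\<^esub> gpt (cl (v IY) \<triangleright>\<^bsub>\<Gamma>\<^esub> unit_vec IY) a
    \<oplus>\<^bsub>GT\<^esub> gpt (cl (v IT) \<triangleright>\<^bsub>\<Gamma>\<^esub> unit_vec IT) a"
  using assms by (subst tri_decompose) (simp add: \<Gamma>.left.QB.pt_add_left \<Gamma>.lact_closed)

text \<open>All entries of the row lead to the same total weight, so the second tensor factor can be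
  pulled out of the sum. For \<open>GTheta\<close> this is restricted to \<open>i = IS\<close>,
  where \<open>tri\<close> discards the exceptional diagonal entry.\<close>

lemma coact_row:
  assumes "g \<noteq> GTheta \<or> i = IS"
  shows "coact (tri (\<gamma> g i)) = gpt (tri (\<gamma> g i)) (Q.mo (weight i @ gen_weight g))"
  unfolding coact_tri gpt_tri[OF qsp_class_closed]
  using assms coact_entry[of IX g i] coact_entry[of IY g i] coact_entry[of IT g i] by auto

lemma unit_vec_ract: "i \<noteq> IS \<Longrightarrow> unit_vec i \<triangleleft>\<^bsub>\<Gamma>\<^esub> Q.mo [g] = tri (\<gamma> g i)"
  unfolding unit_vec_def ract_tri by (rule tri_cong) (cases i; simp add: row_def mat_gen)

lemma weight_homog: "Q.mo (weight i) \<in> homog A 0"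
  using Q.mo_homog[of "weight i"] by (cases i) simp_all

lemma base_mult:
  assumes "a \<in> homog A j" "a' \<in> carrier A"
  shows "kR (base i) (A.mult.AP.pt a a') = gpt (unit_vec i \<triangleleft>\<^bsub>\<Gamma>\<^esub> a) (Q.mo (weight i) \<otimes>\<^bsub>A\<^esub> a')"
  unfolding base_def using \<Gamma>.right.kp_pure[OF unit_vec_closed weight_homog assms]
  by (simp add: \<Gamma>.left.TS.smult_one[simplified] \<Gamma>.ract_closed A.superspace_closed[OF assms(1)] assms(2))

lemma coact_unit_vec_even:
  assumes "g \<noteq> GTheta" "i \<noteq> IS"
  shows "coact (unit_vec i \<triangleleft>\<^bsub>\<Gamma>\<^esub> Q.mo [g]) = kR (base i) (Q.cg g)"
proof -
  have "gen_weight g = [g]" using assms(1) by (cases g) simp_all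
  then show ?thesis
    using assms coact_row[of g i] Q.mo_homog[of "[g]"]
    by (simp add: unit_vec_ract Q.cg_even base_mult[OF Q.mo_homog qsp_class_closed] Q.mo_mult)
qed

lemma mo_Nil_lact: "Q.mo [] \<triangleright>\<^bsub>\<Gamma>\<^esub> unit_vec i = unit_vec i"
  using \<Gamma>.lact_one[OF unit_vec_closed] by (simp only: Q.mo_Nil)

lemma mo_Nil_ract: "unit_vec i \<triangleleft>\<^bsub>\<Gamma>\<^esub> Q.mo [] = unit_vec i"
  using \<Gamma>.ract_one[OF unit_vec_closed] by (simp only: Q.mo_Nil)

text \<open>The first summand of \<Delta>(\<theta>) behaves as for the other generators; the second,
  1 \<otimes> \<theta>, passes the basis element and then its weight, which yields the extra
  term.\<close>

lemma coact_theta_diag: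
  assumes "i \<noteq> IS"
  shows "kL (E (\<gamma> GTheta i i)) (base i) =
    gpt (cl (\<gamma> GTheta i i) \<triangleright>\<^bsub>\<Gamma>\<^esub> unit_vec i) (Q.mo (weight i @ [GXinv, GY]))
      \<oplus>\<^bsub>GT\<^esub> gpt (unit_vec i) (Q.mo (weight i @ [GTheta]))"
proof -
  define a where "a = diag i GTheta"
  \<comment> \<open>The diagonal coefficient is the commutation factor of the weight with \<theta>
    times the parity sign of the basis element: \<open>-q\<close> for \<open>IX\<close> and
    \<open>IY\<close>, \<open>1\<close> for \<open>IT\<close>.\<close>
  have weight: "Q.mo (weight i @ [GTheta]) = (a * parity_sign (ix_parity i)) \<odot>\<^bsub>A\<^esub> Q.mo ([GTheta] @ weight i)"
    by (rule Q.mo_nfI) (use assms nonzero in \<open>cases i; simp add: a_def diag_def\<close>)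
  have "Q.mo ([GXinv, GY] @ weight i) = Q.mo (weight i @ [GXinv, GY])"
    by (rule qsp_class_nfI[OF nonzero(1)]) (cases i; simp)
  moreover have even: "Q.mo [GXinv, GY] \<in> homog A 0" and odd: "Q.mo [GTheta] \<in> homog A 1"
    using Q.mo_homog[of "[GXinv, GY]"] Q.mo_homog[of "[GTheta]"] by simp_all
  ultimately have
    "kL (Q.P [GTheta] [GXinv, GY]) (base i) = gpt (Q.mo [GTheta] \<triangleright>\<^bsub>\<Gamma>\<^esub> unit_vec i) (Q.mo (weight i @ [GXinv, GY]))"
    unfolding base_def using \<Gamma>.left.kp_pure[OF qsp_class_closed even unit_vec_homog qsp_class_closed]
    by (simp add: Q.mo_mult \<Gamma>.left.TS.smult_one[simplified] \<Gamma>.lact_closed)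
  moreover have "kL (Q.P [] [GTheta]) (base i) =
      parity_sign (ix_parity i) \<odot>\<^bsub>GT\<^esub> gpt (unit_vec i) (Q.mo ([GTheta] @ weight i))"
    unfolding base_def using \<Gamma>.left.kp_pure[OF qsp_class_closed odd unit_vec_homog qsp_class_closed]
    by (simp only: mult_1 Q.mo_mult mo_Nil_lact append_Nil)
  moreover have "E (\<gamma> GTheta i i) = a \<odot>\<^bsub>AT\<^esub> (Q.P [GTheta] [GXinv, GY] \<oplus>\<^bsub>AT\<^esub> Q.P [] [GTheta])"
    unfolding gen_diag a_def by (simp add: E_simps Q.ev.ev_monom Q.cg_theta)
  ultimately show ?thesis
    unfolding weight
    by (simp add: gen_diag flip: a_def qsp_smult)
      (simp add: \<Gamma>.left.kp_smult_left \<Gamma>.left.kp_add_left \<Gamma>.left.TS.smult_r_distr[simplified]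
        \<Gamma>.left.TS.smult_assoc1[simplified, symmetric] \<Gamma>.left.QB.pt_smult_left \<Gamma>.left.QB.pt_smult_right
        \<Gamma>.lact_smult_left \<Gamma>.lact_closed)
qed

lemma coact_unit_vec_theta:
  assumes "i \<noteq> IS"
  shows "coact (unit_vec i \<triangleleft>\<^bsub>\<Gamma>\<^esub> Q.mo [GTheta]) = kR (base i) (Q.cg GTheta)"
proof -
  let ?a = "Q.mo (weight i @ [GXinv, GY])" and ?T = "gpt (unit_vec i) (Q.mo (weight i @ [GTheta]))"
  have "kR (base i) (Q.cg GTheta) = gpt (tri (\<gamma> GTheta i)) ?a \<oplus>\<^bsub>GT\<^esub> ?T"
    using assms
    by (simp add: Q.cg_theta \<Gamma>.right.kp_add_right base_mult[OF Q.mo_homog qsp_class_closed] Q.mo_mult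
        unit_vec_ract mo_Nil_ract)
  moreover have "coact (tri (\<gamma> GTheta i)) = gpt (tri (\<gamma> GTheta i)) ?a \<oplus>\<^bsub>GT\<^esub> ?T"
    unfolding coact_tri gpt_tri[OF qsp_class_closed]
    using assms coact_theta_diag[OF assms] coact_entry[of IX GTheta i] coact_entry[of IY GTheta i]
      coact_entry[of IT GTheta i]
    by (cases i) (simp_all add: \<Gamma>.left.TS.a_ac \<Gamma>.lact_closed)
  ultimately show ?thesis by (simp add: unit_vec_ract assms)
qed

text \<open>Left-linearity of the coaction and commutation of the left and right actions reduce this
  to the basis vectors.\<close>

lemma coact_ract_gen:
  assumes "\<omega> \<in> carrier \<Gamma>"
  shows "coact (\<omega> \<triangleleft>\<^bsub>\<Gamma>\<^esub> Q.mo [g]) = kR (coact \<omega>) (Q.cg g)"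
  using assms
proof (rule tri_linear_induct)
  have cg: "Q.cg g \<in> carrier AT" using Q.ev.v_closed by simp
  show "coact ((\<omega> \<oplus>\<^bsub>\<Gamma>\<^esub> \<omega>') \<triangleleft>\<^bsub>\<Gamma>\<^esub> Q.mo [g]) = kR (coact (\<omega> \<oplus>\<^bsub>\<Gamma>\<^esub> \<omega>')) (Q.cg g)"
    if "\<omega> \<in> carrier \<Gamma>" "\<omega>' \<in> carrier \<Gamma>" "coact (\<omega> \<triangleleft>\<^bsub>\<Gamma>\<^esub> Q.mo [g]) = kR (coact \<omega>) (Q.cg g)"
      "coact (\<omega>' \<triangleleft>\<^bsub>\<Gamma>\<^esub> Q.mo [g]) = kR (coact \<omega>') (Q.cg g)" for \<omega> \<omega>'
    using that cg by (simp add: \<Gamma>.ract_add_left coact_add \<Gamma>.ract_closed \<Gamma>.right.kp_add_left coact_closed)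
  show "coact ((cl p \<triangleright>\<^bsub>\<Gamma>\<^esub> unit_vec i) \<triangleleft>\<^bsub>\<Gamma>\<^esub> Q.mo [g]) = kR (coact (cl p \<triangleright>\<^bsub>\<Gamma>\<^esub> unit_vec i)) (Q.cg g)"
    if "i \<noteq> IS" for p i
  proof -
    have "coact (unit_vec i \<triangleleft>\<^bsub>\<Gamma>\<^esub> Q.mo [g]) = kR (base i) (Q.cg g)"
      using that coact_unit_vec_even coact_unit_vec_theta by (cases "g = GTheta") blast+
    then show ?thesis
      using that cg unfolding coact_unit_vec[OF that]
      by (simp only: \<Gamma>.lact_ract qsp_class_closed unit_vec_closed coact_lact \<Gamma>.ract_closed
          \<Gamma>.left_right_assoc E_simps(1) base_closed)
  qed
qed

lemma coact_ract:
  assumes "\<omega> \<in> carrier \<Gamma>"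
  shows "coact (\<omega> \<triangleleft>\<^bsub>\<Gamma>\<^esub> cl p) = kR (coact \<omega>) (E p)"
proof (induction p rule: ncpoly_induct)
  case zero
  have "\<omega> \<triangleleft>\<^bsub>\<Gamma>\<^esub> cl 0 = 0 \<odot>\<^bsub>\<Gamma>\<^esub> (\<omega> \<triangleleft>\<^bsub>\<Gamma>\<^esub> cl 0)"
    using \<Gamma>.ract_smult_right[OF qsp_class_closed assms, of 0 0] by (simp add: qsp_smult)
  moreover have "kR (coact \<omega>) (E 0) = 0 \<odot>\<^bsub>GT\<^esub> kR (coact \<omega>) (E 0)"
    using \<Gamma>.right.kp_smult_right[of "coact \<omega>" "E 0" 0] assms E_simps(1)[of 0] E_simps(3)[of 0 0]
    by (simp add: coact_closed)
  ultimately show ?case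
    using assms coact_smult[of "\<omega> \<triangleleft>\<^bsub>\<Gamma>\<^esub> cl 0" 0] coact_closed[of "\<omega> \<triangleleft>\<^bsub>\<Gamma>\<^esub> cl 0"]
      \<Gamma>.right.kp_closed[of "coact \<omega>" "E 0"] E_simps(1)[of 0] coact_closed[OF assms]
    by (simp add: \<Gamma>.ract_closed \<Gamma>.left.TS.smult_l_null[simplified])
next
  case (monom c w)
  have "coact (\<omega> \<triangleleft>\<^bsub>\<Gamma>\<^esub> Q.mo w) = kR (coact \<omega>) (E (nc_monom w))" if "\<omega> \<in> carrier \<Gamma>" for \<omega>
    using that
  proof (induction w arbitrary: \<omega>)
    case Nil
    then show ?case
      using \<Gamma>.right_one[OF coact_closed[OF Nil]] by (simp add: \<Gamma>.ract_one nc_monom_Nil E_simps flip: qsp_one)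
  next
    case (Cons g w)
    have cg: "Q.cg g \<in> carrier AT" using Q.ev.v_closed by simp
    have "\<omega> \<triangleleft>\<^bsub>\<Gamma>\<^esub> Q.mo (g # w) = \<omega> \<triangleleft>\<^bsub>\<Gamma>\<^esub> Q.mo [g] \<triangleleft>\<^bsub>\<Gamma>\<^esub> Q.mo w"
      using Cons.prems Q.mo_mult[of "[g]" w] \<Gamma>.ract_mult[of "Q.mo [g]" "Q.mo w" \<omega>] by simp
    moreover have "E (nc_monom (g # w)) = A.mult.kp (Q.cg g) (E (nc_monom w))"
      by (simp add: Q.ev.ev_monom)
    ultimately show ?case
      using Cons.prems Cons.IH[of "\<omega> \<triangleleft>\<^bsub>\<Gamma>\<^esub> Q.mo [g]"]
        \<Gamma>.right_assoc[OF coact_closed[OF Cons.prems] cg E_simps(1)[of "nc_monom w"]]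
      by (simp only: coact_ract_gen \<Gamma>.ract_closed qsp_class_closed)
  qed
  from this[OF assms] show ?case
    using assms by (simp only: E_simps(1,3) \<Gamma>.right.kp_smult_right coact_closed \<Gamma>.ract_smult_right
        coact_smult \<Gamma>.ract_closed qsp_class_closed qsp_smult[symmetric])
next
  case (add f g)
  then show ?case
    using assms by (simp only: E_simps(1,2) \<Gamma>.right.kp_add_right coact_closed \<Gamma>.ract_add_right
        coact_add \<Gamma>.ract_closed qsp_class_closed qsp_add[symmetric])
qed

text \<open>\<open>\<Gamma>.diff_tensor_Leibniz\<close> asks for a homogeneous pure tensor on the
  left. Both summands of the coproduct of \<theta> have total parity 1, so they share one sign and
  can be added.\<close>

lemma diff_cg:
  assumes "T \<in> carrier AT"
  shows "\<Gamma>.diff_tensor (A.mult.kp (Q.cg g) T) = kR (\<Gamma>.diff_tensor (Q.cg g)) T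
    \<oplus>\<^bsub>GT\<^esub> parity_sign (word_parity (Word [g])) \<odot>\<^bsub>GT\<^esub> kL (Q.cg g) (\<Gamma>.diff_tensor T)"
proof -
  have pure: "\<Gamma>.diff_tensor (A.mult.kp (Q.P u w) T) = kR (\<Gamma>.diff_tensor (Q.P u w)) T
      \<oplus>\<^bsub>GT\<^esub> parity_sign (word_parity (Word u) + word_parity (Word w)) \<odot>\<^bsub>GT\<^esub> kL (Q.P u w) (\<Gamma>.diff_tensor T)" for u w
    by (rule \<Gamma>.diff_tensor_Leibniz[OF Q.mo_homog Q.mo_homog assms])
  show ?thesis
  proof (cases "g = GTheta")
    case False
    then show ?thesis
      using pure[of "[g]" "[g]"] by (simp add: Q.cg_even)
  next
    case True
    have pure': "\<Gamma>.diff_tensor (A.mult.kp (Q.P u w) T) = kR (\<Gamma>.diff_tensor (Q.P u w)) T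
        \<oplus>\<^bsub>GT\<^esub> (- 1) \<odot>\<^bsub>GT\<^esub> kL (Q.P u w) (\<Gamma>.diff_tensor T)"
      if "word_parity (Word u) + word_parity (Word w) = 1" for u w
      using pure[of u w] unfolding that by simp
    have closed: "\<Gamma>.diff_tensor T \<in> carrier GT" "\<Gamma>.diff_tensor (Q.P u w) \<in> carrier GT" for u w
      using assms by (simp_all add: \<Gamma>.diff_tensor_closed)
    have "\<Gamma>.diff_tensor (A.mult.kp (Q.cg GTheta) T) =
        \<Gamma>.diff_tensor (A.mult.kp (Q.P [GTheta] [GXinv, GY]) T) \<oplus>\<^bsub>GT\<^esub> \<Gamma>.diff_tensor (A.mult.kp (Q.P [] [GTheta]) T)"
      using assms by (simp add: Q.cg_theta A.mult.kp_add_left \<Gamma>.diff_tensor_add)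
    also have "\<dots> = kR (\<Gamma>.diff_tensor (Q.cg GTheta)) T \<oplus>\<^bsub>GT\<^esub> (- 1) \<odot>\<^bsub>GT\<^esub> kL (Q.cg GTheta) (\<Gamma>.diff_tensor T)"
      using assms closed
      by (subst (1 2) pure')
        (simp_all add: Q.cg_theta \<Gamma>.diff_tensor_add \<Gamma>.right.kp_add_left \<Gamma>.left.kp_add_left
          \<Gamma>.left.TS.smult_r_distr[simplified] \<Gamma>.left.TS.a_ac)
    finally show ?thesis by (simp add: True)
  qed
qed

lemma d_gen: "d (Q.mo [g]) = tri (\<gamma> g IS)"
  unfolding d_class by (rule tri_cong) (simp add: mat_gen)

text \<open>As d(1) = 0, a single summand of the coproduct contributes, and \<open>coact_row\<close>
  with \<open>i = IS\<close> gives the same value.\<close>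

lemma coact_d_gen: "coact (d (Q.mo [g])) = \<Gamma>.diff_tensor (Q.cg g)"
proof -
  have "d (Q.mo []) = \<zero>\<^bsub>\<Gamma>\<^esub>"
    unfolding d_class \<Gamma>_simps by (rule tri_cong) (simp add: mat_one nc_monom_Nil)
  then have "\<Gamma>.diff_tensor (Q.cg g) = gpt (d (Q.mo [g])) (Q.mo (gen_weight g))"
    by (cases g) (simp_all add: Q.cg_even Q.cg_theta \<Gamma>.diff_tensor_add \<Gamma>.diff_tensor_pure
        \<Gamma>.left.QB.pt_zero_left)
  then show ?thesis
    using coact_row[of g IS] by (simp add: d_gen)
qed

text \<open>Both sides agree on generators and obey the same Leibniz rule along words, by
  \<open>coact_ract\<close> and \<open>diff_cg\<close>.\<close>

lemma coact_d: "coact (d (cl p)) = \<Gamma>.diff_tensor (E p)"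
proof (induction p rule: ncpoly_induct)
  case zero
  have "\<Gamma>.diff_tensor \<zero>\<^bsub>AT\<^esub> = \<zero>\<^bsub>GT\<^esub>"
    using \<Gamma>.diff_tensor_smult[of "\<zero>\<^bsub>AT\<^esub>" 0] \<Gamma>.diff_tensor_closed[of "\<zero>\<^bsub>AT\<^esub>"]
    by (simp add: A.mult.TS.smult_l_null[simplified] \<Gamma>.left.TS.smult_l_null[simplified])
  moreover have "coact (d (cl 0)) = \<zero>\<^bsub>GT\<^esub>"
    unfolding d_class by (simp add: coact_tri mat_simps E_simps kL_zero)
  ultimately show ?case by (simp add: E_simps)
next
  case (monom c w)
  have "coact (d (Q.mo w)) = \<Gamma>.diff_tensor (E (nc_monom w))"
  proof (induction w)
    case Nil
    have "d (Q.mo []) = \<zero>\<^bsub>\<Gamma>\<^esub>"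
      unfolding d_class \<Gamma>_simps by (rule tri_cong) (simp add: mat_one nc_monom_Nil)
    moreover have "coact \<zero>\<^bsub>\<Gamma>\<^esub> = \<zero>\<^bsub>GT\<^esub>"
      by (simp add: \<Gamma>_simps coact_tri E_simps kL_zero)
    moreover have "E (nc_monom []) = Q.P [] []"
      by (rule Q.ev_even_monom) simp
    ultimately show ?case
      by (simp add: \<Gamma>.diff_tensor_pure \<Gamma>.left.QB.pt_zero_left)
  next
    case (Cons g w)
    have cg: "Q.cg g \<in> carrier AT" using Q.ev.v_closed by simp
    have "d (Q.mo (g # w)) = d (Q.mo [g]) \<triangleleft>\<^bsub>\<Gamma>\<^esub> Q.mo w
        \<oplus>\<^bsub>\<Gamma>\<^esub> parity_sign (word_parity (Word [g])) \<odot>\<^bsub>\<Gamma>\<^esub> (Q.mo [g] \<triangleright>\<^bsub>\<Gamma>\<^esub> d (Q.mo w))"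
      using \<Gamma>.graded_Leibniz[OF Q.mo_homog[of "[g]"] qsp_class_closed[of q "nc_monom w"]] Q.mo_mult[of "[g]" w]
      by simp
    moreover have "E (nc_monom (g # w)) = A.mult.kp (Q.cg g) (E (nc_monom w))"
      by (simp add: Q.ev.ev_monom)
    moreover have "E (nc_monom [g]) = Q.cg g"
      using Q.ev.v_closed by (simp add: Q.ev.ev_monom)
    ultimately show ?case
      using cg
      by (simp only: coact_add coact_smult coact_ract coact_lact Cons.IH coact_d_gen diff_cg E_simps(1)
          \<Gamma>.diff_closed qsp_class_closed \<Gamma>.ract_closed \<Gamma>.lact_closed \<Gamma>.smult_closed UNIV_I
          complex_ring_simps)
  qed
  then show ?case
    using linear_mapD(3)[OF \<Gamma>.diff_linear qsp_class_closed, of c "nc_monom w"]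
    by (simp only: qsp_smult[symmetric] coact_smult \<Gamma>.diff_closed qsp_class_closed E_simps(1,3)
        \<Gamma>.diff_tensor_smult)
next
  case (add f g)
  then show ?case
    using linear_mapD(2)[OF \<Gamma>.diff_linear qsp_class_closed qsp_class_closed, of f g]
    by (simp only: qsp_add[symmetric] coact_add \<Gamma>.diff_closed qsp_class_closed E_simps(1,2)
        \<Gamma>.diff_tensor_add)
qed

lemma \<Gamma>_right_covariant: "right_covariant A (qsp_comult q) \<Gamma> d"
  unfolding right_covariant_def
proof (intro exI[of _ coact] conjI ballI)
  show "linear_map \<Gamma> GT coact"
    by (simp add: linear_map_def coact_closed coact_add coact_smult)
  fix a c assume a: "a \<in> carrier A" and c: "c \<in> carrier A"
  obtain p where p: "a = cl p" using a by (rule qsp_cases)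
  obtain p' where p': "c = cl p'" using c by (rule qsp_cases)
  have "coact (a \<triangleright>\<^bsub>\<Gamma>\<^esub> d c) = kL (qsp_comult q a) (\<Gamma>.diff_tensor (qsp_comult q c))"
    unfolding p p' by (simp only: coact_lact \<Gamma>.diff_closed qsp_class_closed coact_d Q.comult_class)
  then show "coact (a \<triangleright>\<^bsub>\<Gamma>\<^esub> d c) =
      kL (qsp_comult q a) (tensor_map \<Gamma> A d id (qsp_comult q c))"
    by (simp only: \<Gamma>.diff_tensor_def)
qed

end

section \<open>Uniqueness\<close>

text \<open>The comparison map below starts at the constructed calculus, while the theorem asks for
  an isomorphism onto it.\<close>

lemma calculus_isomorphic_sym:
  assumes \<Gamma>: "super_fodc A \<Gamma> d" and iso: "calculus_isomorphic A \<Gamma> d \<Gamma>' d'"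
  shows "calculus_isomorphic A \<Gamma>' d' \<Gamma> d"
proof -
  interpret super_fodc A \<Gamma> d by (rule \<Gamma>)
  obtain f where bij: "bij_betw f (carrier \<Gamma>) (carrier \<Gamma>')" and lin: "linear_map \<Gamma> \<Gamma>' f"
    and homog: "\<And>i. f ` homog \<Gamma> i = homog \<Gamma>' i"
    and act: "\<And>a \<omega>. a \<in> carrier A \<Longrightarrow> \<omega> \<in> carrier \<Gamma> \<Longrightarrow>
      f (a \<triangleright>\<^bsub>\<Gamma>\<^esub> \<omega>) = a \<triangleright>\<^bsub>\<Gamma>'\<^esub> f \<omega> \<and> f (\<omega> \<triangleleft>\<^bsub>\<Gamma>\<^esub> a) = f \<omega> \<triangleleft>\<^bsub>\<Gamma>'\<^esub> a"
    and d: "\<And>a. a \<in> carrier A \<Longrightarrow> f (d a) = d' a"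
    using iso unfolding calculus_isomorphic_def by blast
  define g where "g = inv_into (carrier \<Gamma>) f"
  have gf: "g (f u) = u" if "u \<in> carrier \<Gamma>" for u
    unfolding g_def using bij_betw_imp_inj_on[OF bij] that by (rule inv_into_f_f)
  have ex: "\<exists>u\<in>carrier \<Gamma>. v = f u" if "v \<in> carrier \<Gamma>'" for v
    using bij_betw_imp_surj_on[OF bij] that by blast
  have "linear_map \<Gamma>' \<Gamma> g"
    unfolding linear_map_def
  proof (intro conjI ballI allI funcsetI)
    fix v assume "v \<in> carrier \<Gamma>'"
    then obtain u where u: "u \<in> carrier \<Gamma>" "v = f u" using ex by blast
    show "g v \<in> carrier \<Gamma>" using u by (simp add: gf)
    show "g (c \<odot>\<^bsub>\<Gamma>'\<^esub> v) = c \<odot>\<^bsub>\<Gamma>\<^esub> g v" for c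
      using u gf[of "c \<odot>\<^bsub>\<Gamma>\<^esub> u"] by (simp add: gf linear_mapD(3)[OF lin])
    fix w assume "w \<in> carrier \<Gamma>'"
    then obtain t where t: "t \<in> carrier \<Gamma>" "w = f t" using ex by blast
    show "g (v \<oplus>\<^bsub>\<Gamma>'\<^esub> w) = g v \<oplus>\<^bsub>\<Gamma>\<^esub> g w"
      using u t gf[of "u \<oplus>\<^bsub>\<Gamma>\<^esub> t"] by (simp add: gf linear_mapD(2)[OF lin])
  qed
  moreover have "g ` homog \<Gamma>' i = homog \<Gamma> i" for i
  proof -
    have "g ` f ` homog \<Gamma> i = id ` homog \<Gamma> i"
      unfolding image_image by (rule image_cong) (simp_all add: gf M.homog_closed)
    then show ?thesis by (simp add: homog)
  qed
  moreover have "g (a \<triangleright>\<^bsub>\<Gamma>'\<^esub> v) = a \<triangleright>\<^bsub>\<Gamma>\<^esub> g v \<and> g (v \<triangleleft>\<^bsub>\<Gamma>'\<^esub> a) = g v \<triangleleft>\<^bsub>\<Gamma>\<^esub> a"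
    if "a \<in> carrier A" "v \<in> carrier \<Gamma>'" for a v
  proof -
    obtain u where u: "u \<in> carrier \<Gamma>" "v = f u" using ex \<open>v \<in> carrier \<Gamma>'\<close> by blast
    show ?thesis
      using act[OF that(1) u(1)] gf[OF lact_closed[OF that(1) u(1)]] gf[OF ract_closed[OF that(1) u(1)]] gf[OF u(1)]
      by (simp add: u(2))
  qed
  moreover have "g (d' a) = d a" if "a \<in> carrier A" for a
    using d[OF that] gf[OF diff_closed[OF that]] by simp
  moreover have "bij_betw g (carrier \<Gamma>') (carrier \<Gamma>)"
    unfolding g_def by (rule bij_betw_inv_into[OF bij])
  ultimately show ?thesis
    unfolding calculus_isomorphic_def by blast
qed

lemma (in super_bimodule) zero_lact:
  assumes m: "m \<in> carrier M"
  shows "\<zero>\<^bsub>A\<^esub> \<triangleright>\<^bsub>M\<^esub> m = \<zero>\<^bsub>M\<^esub>"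
proof -
  have "0 \<odot>\<^bsub>A\<^esub> \<zero>\<^bsub>A\<^esub> = \<zero>\<^bsub>A\<^esub>"
    using module.smult_r_null[OF super_vector_space.axioms(1)[OF superspace], of 0] by simp
  moreover have "0 \<odot>\<^bsub>M\<^esub> (\<zero>\<^bsub>A\<^esub> \<triangleright>\<^bsub>M\<^esub> m) = \<zero>\<^bsub>M\<^esub>"
    using module.smult_l_null[OF super_vector_space.axioms(1)[OF M.super_vector_space_axioms], of "\<zero>\<^bsub>A\<^esub> \<triangleright>\<^bsub>M\<^esub> m"] m
    by (simp add: lact_closed)
  ultimately show ?thesis
    using lact_smult_left[of "\<zero>\<^bsub>A\<^esub>" m 0] m by simp
qed

text \<open>The Leibniz rule for the product of 1 with itself gives d(1) = d(1) + d(1).\<close>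

lemma (in super_fodc) diff_one: "d \<one>\<^bsub>A\<^esub> = \<zero>\<^bsub>\<Gamma>\<^esub>"
proof -
  have c: "d \<one>\<^bsub>A\<^esub> \<in> carrier \<Gamma>" by simp
  have "d \<one>\<^bsub>A\<^esub> = d \<one>\<^bsub>A\<^esub> \<oplus>\<^bsub>\<Gamma>\<^esub> d \<one>\<^bsub>A\<^esub>"
    using graded_Leibniz[OF homog_one, of "\<one>\<^bsub>A\<^esub>"] c
    by (simp add: ract_one lact_one M.smult_one[simplified])
  then show ?thesis
    using c M.add.r_cancel_one'[of "d \<one>\<^bsub>A\<^esub>" "d \<one>\<^bsub>A\<^esub>"] by simp
qed

context calc
begin

lemma unit_vec_d: "unit_vec IX = d (Q.mo [GX])" "unit_vec IY = d (Q.mo [GY])" "unit_vec IT = d (Q.mo [GTheta])"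
  unfolding d_gen unit_vec_def by (rule tri_cong; case_tac j; simp add: calc_gen_def nc_monom_Nil)+

lemma mo_inverses:
  "Q.mo [GX] \<otimes>\<^bsub>A\<^esub> Q.mo [GXinv] = \<one>\<^bsub>A\<^esub>" "Q.mo [GXinv] \<otimes>\<^bsub>A\<^esub> Q.mo [GX] = \<one>\<^bsub>A\<^esub>"
  "Q.mo [GY] \<otimes>\<^bsub>A\<^esub> Q.mo [GYinv] = \<one>\<^bsub>A\<^esub>" "Q.mo [GYinv] \<otimes>\<^bsub>A\<^esub> Q.mo [GY] = \<one>\<^bsub>A\<^esub>"
  unfolding Q.mo_Nil Q.mo_mult by (rule qsp_class_nfI[OF nonzero(1)]; simp)+

end

section \<open>Comparison with an arbitrary calculus satisfying the relations\<close>

locale calc_comparison = calc b q r s + G: super_fodc "qsp q" G \<delta>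
  for b q r s and G :: "(ncpoly set, 'g) superbimodule" and \<delta> :: "ncpoly set \<Rightarrow> 'g" +
  assumes basis: "free_right_basis (qsp q) G (qsp_differentials q \<delta>)"
    and relations: "if b then first_relations q r s G \<delta> else second_relations q r s G \<delta>"
begin

abbreviation "dx \<equiv> \<delta> (Q.mo [GX])"
abbreviation "dy \<equiv> \<delta> (Q.mo [GY])"
abbreviation "dt \<equiv> \<delta> (Q.mo [GTheta])"

text \<open>Defined through the left coordinates of the constructed calculus. What is assumed of
  \<open>G\<close> is right freeness, so bijectivity is obtained separately, from right
  coordinates.\<close>

definition \<psi> :: "ncpoly set \<times> ncpoly set \<times> ncpoly set \<Rightarrow> 'g" where
  "\<psi> = (\<lambda>(u1, u2, u3). u1 \<triangleright>\<^bsub>G\<^esub> dx \<oplus>\<^bsub>G\<^esub> u2 \<triangleright>\<^bsub>G\<^esub> dy \<oplus>\<^bsub>G\<^esub> u3 \<triangleright>\<^bsub>G\<^esub> dt)"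

lemma \<psi>_tri: "\<psi> (tri v) = cl (v IX) \<triangleright>\<^bsub>G\<^esub> dx \<oplus>\<^bsub>G\<^esub> cl (v IY) \<triangleright>\<^bsub>G\<^esub> dy \<oplus>\<^bsub>G\<^esub> cl (v IT) \<triangleright>\<^bsub>G\<^esub> dt"
  by (simp add: \<psi>_def tri_def)

lemma \<psi>_closed [simp]: "\<omega> \<in> carrier \<Gamma> \<Longrightarrow> \<psi> \<omega> \<in> carrier G"
  by (elim tri_cases) (simp add: \<psi>_tri G.lact_closed)

lemma \<psi>_add: "\<omega> \<in> carrier \<Gamma> \<Longrightarrow> \<omega>' \<in> carrier \<Gamma> \<Longrightarrow> \<psi> (\<omega> \<oplus>\<^bsub>\<Gamma>\<^esub> \<omega>') = \<psi> \<omega> \<oplus>\<^bsub>G\<^esub> \<psi> \<omega>'"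
  by (elim tri_cases) (simp add: \<psi>_tri \<Gamma>_simps G.lact_closed G.lact_add_left G.M.a_ac flip: qsp_add)

lemma \<psi>_smult: "\<omega> \<in> carrier \<Gamma> \<Longrightarrow> \<psi> (c \<odot>\<^bsub>\<Gamma>\<^esub> \<omega>) = c \<odot>\<^bsub>G\<^esub> \<psi> \<omega>"
  by (elim tri_cases) (simp add: \<psi>_tri \<Gamma>_simps G.lact_closed G.lact_smult_left
      G.M.smult_r_distr[simplified] flip: qsp_smult)

lemma \<psi>_lact: "a \<in> carrier A \<Longrightarrow> \<omega> \<in> carrier \<Gamma> \<Longrightarrow> \<psi> (a \<triangleright>\<^bsub>\<Gamma>\<^esub> \<omega>) = a \<triangleright>\<^bsub>G\<^esub> \<psi> \<omega>"
  by (elim tri_cases qsp_cases) (simp add: \<psi>_tri \<Gamma>_simps G.lact_closed G.lact_mult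
      G.lact_add_right flip: qsp_mult)

lemma \<psi>_d_basis: "\<psi> (d (Q.mo [GX])) = dx" "\<psi> (d (Q.mo [GY])) = dy" "\<psi> (d (Q.mo [GTheta])) = dt"
proof -
  have zero: "cl 0 \<triangleright>\<^bsub>G\<^esub> m = \<zero>\<^bsub>G\<^esub>" if "m \<in> carrier G" for m
    using G.zero_lact[OF that] by (simp only: qsp_zero)
  have one: "cl 1 \<triangleright>\<^bsub>G\<^esub> m = m" if "m \<in> carrier G" for m
    using G.lact_one[OF that] by (simp only: qsp_one)
  show "\<psi> (d (Q.mo [GX])) = dx" "\<psi> (d (Q.mo [GY])) = dy" "\<psi> (d (Q.mo [GTheta])) = dt"
    unfolding unit_vec_d[symmetric] unit_vec_def \<psi>_tri by (simp_all add: zero one)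
qed

text \<open>Both calculi express these products by the same combination of left multiples of the
  basis, and the map respects such combinations.\<close>

lemma \<psi>_ract_basis:
  assumes "i \<in> {GX, GY, GTheta}" "g \<in> {GX, GY, GTheta}"
  shows "\<psi> (d (Q.mo [i]) \<triangleleft>\<^bsub>\<Gamma>\<^esub> Q.mo [g]) = \<delta> (Q.mo [i]) \<triangleleft>\<^bsub>G\<^esub> Q.mo [g]"
proof -
  note maps = \<psi>_add \<psi>_smult \<psi>_lact \<psi>_d_basis \<Gamma>.diff_closed \<Gamma>.lact_closed \<Gamma>.smult_closed
    qsp_class_closed UNIV_I complex_ring_simps
  show ?thesis
  proof (cases b)
    case True
    with relations have rel: "first_relations q r s G \<delta>" by simp
    show ?thesis
      using assms first_relations_hold[OF True, unfolded first_relations_def Let_def qsp_gen_def]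
        rel[unfolded first_relations_def Let_def qsp_gen_def]
      by (elim insertE emptyE conjE) (simp_all only: maps)
  next
    case False
    with relations have rel: "second_relations q r s G \<delta>" by simp
    show ?thesis
      using assms second_relations_hold[OF False, unfolded second_relations_def Let_def qsp_gen_def]
        rel[unfolded second_relations_def Let_def qsp_gen_def]
      by (elim insertE emptyE conjE) (simp_all only: maps)
  qed
qed

lemma \<psi>_ract_noninverse:
  assumes "\<omega> \<in> carrier \<Gamma>" "g \<in> {GX, GY, GTheta}"
  shows "\<psi> (\<omega> \<triangleleft>\<^bsub>\<Gamma>\<^esub> Q.mo [g]) = \<psi> \<omega> \<triangleleft>\<^bsub>G\<^esub> Q.mo [g]"
  using assms(1)
proof (rule tri_linear_induct)
  fix p i assume "i \<noteq> IS"
  then obtain h where h: "unit_vec i = d (Q.mo [h])" "h \<in> {GX, GY, GTheta}" "\<psi> (d (Q.mo [h])) = \<delta> (Q.mo [h])"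
    by (cases i) (auto simp: unit_vec_d \<psi>_d_basis)
  show "\<psi> ((cl p \<triangleright>\<^bsub>\<Gamma>\<^esub> unit_vec i) \<triangleleft>\<^bsub>\<Gamma>\<^esub> Q.mo [g]) = \<psi> (cl p \<triangleright>\<^bsub>\<Gamma>\<^esub> unit_vec i) \<triangleleft>\<^bsub>G\<^esub> Q.mo [g]"
    using \<psi>_ract_basis[OF h(2) assms(2)] unfolding h(1)
    by (simp add: \<Gamma>.lact_ract \<psi>_lact \<Gamma>.ract_closed h(3) G.lact_ract)
qed (simp add: \<Gamma>.ract_add_left \<psi>_add \<Gamma>.ract_closed G.ract_add_left)

text \<open>The relations do not mention inverse letters; there the claim holds because right
  multiplication by the inverse letter inverts right multiplication by the letter, in both
  modules.\<close>

lemma \<psi>_ract_gen: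
  assumes "\<omega> \<in> carrier \<Gamma>"
  shows "\<psi> (\<omega> \<triangleleft>\<^bsub>\<Gamma>\<^esub> Q.mo [g]) = \<psi> \<omega> \<triangleleft>\<^bsub>G\<^esub> Q.mo [g]"
proof -
  have inverse: "\<psi> (\<omega> \<triangleleft>\<^bsub>\<Gamma>\<^esub> Q.mo [h']) = \<psi> \<omega> \<triangleleft>\<^bsub>G\<^esub> Q.mo [h']"
    if h: "h \<in> {GX, GY, GTheta}" "Q.mo [h] \<otimes>\<^bsub>A\<^esub> Q.mo [h'] = \<one>\<^bsub>A\<^esub>" "Q.mo [h'] \<otimes>\<^bsub>A\<^esub> Q.mo [h] = \<one>\<^bsub>A\<^esub>" for h h'
  proof -
    have "\<psi> (\<omega> \<triangleleft>\<^bsub>\<Gamma>\<^esub> Q.mo [h']) \<triangleleft>\<^bsub>G\<^esub> Q.mo [h] = \<psi> (\<omega> \<triangleleft>\<^bsub>\<Gamma>\<^esub> Q.mo [h'] \<triangleleft>\<^bsub>\<Gamma>\<^esub> Q.mo [h])"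
      using assms h(1) by (simp add: \<psi>_ract_noninverse \<Gamma>.ract_closed)
    also have "\<dots> = \<psi> \<omega>"
      using \<Gamma>.ract_mult[OF qsp_class_closed qsp_class_closed assms] \<Gamma>.ract_one[OF assms] h(3) by metis
    finally have "\<psi> \<omega> \<triangleleft>\<^bsub>G\<^esub> Q.mo [h'] = \<psi> (\<omega> \<triangleleft>\<^bsub>\<Gamma>\<^esub> Q.mo [h']) \<triangleleft>\<^bsub>G\<^esub> (Q.mo [h] \<otimes>\<^bsub>A\<^esub> Q.mo [h'])"
      using assms by (simp add: G.ract_mult \<Gamma>.ract_closed)
    then show ?thesis
      using assms by (simp add: h(2) G.ract_one \<Gamma>.ract_closed)
  qed
  show ?thesis
    using assms \<psi>_ract_noninverse inverse[OF _ mo_inverses(1,2)] inverse[OF _ mo_inverses(3,4)]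
    by (cases g) auto
qed

lemma \<psi>_ract:
  assumes "\<omega> \<in> carrier \<Gamma>" "a \<in> carrier A"
  shows "\<psi> (\<omega> \<triangleleft>\<^bsub>\<Gamma>\<^esub> a) = \<psi> \<omega> \<triangleleft>\<^bsub>G\<^esub> a"
proof -
  obtain p where p: "a = cl p" using assms(2) by (rule qsp_cases)
  have word: "\<psi> (\<omega> \<triangleleft>\<^bsub>\<Gamma>\<^esub> Q.mo w) = \<psi> \<omega> \<triangleleft>\<^bsub>G\<^esub> Q.mo w" if "\<omega> \<in> carrier \<Gamma>" for \<omega> w
    using that
  proof (induction w arbitrary: \<omega>)
    case Nil
    then show ?case by (simp add: \<Gamma>.ract_one G.ract_one flip: Q.mo_Nil)
  next
    case (Cons g w)
    then show ?case
      using Cons.IH[of "\<omega> \<triangleleft>\<^bsub>\<Gamma>\<^esub> Q.mo [g]"] Q.mo_mult[of "[g]" w, symmetric]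
      by (simp add: \<Gamma>.ract_mult G.ract_mult \<Gamma>.ract_closed \<psi>_ract_gen)
  qed
  have mono: "\<psi> (\<omega> \<triangleleft>\<^bsub>\<Gamma>\<^esub> cl (scal c (nc_monom w))) = \<psi> \<omega> \<triangleleft>\<^bsub>G\<^esub> cl (scal c (nc_monom w))" for c w
    using assms by (simp add: word \<Gamma>.ract_smult_right G.ract_smult_right \<psi>_smult \<Gamma>.ract_closed flip: qsp_smult)
  show ?thesis
    unfolding p
  proof (induction p rule: ncpoly_induct)
    case zero
    then show ?case using mono[of 0 "[]"] by simp
  next
    case (add f g)
    then show ?case
      using assms by (simp add: \<Gamma>.ract_add_right G.ract_add_right \<psi>_add \<Gamma>.ract_closed flip: qsp_add)
  qed (rule mono)
qed

lemma \<psi>_zero: "\<psi> \<zero>\<^bsub>\<Gamma>\<^esub> = \<zero>\<^bsub>G\<^esub>"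
  using \<psi>_smult[of "\<zero>\<^bsub>\<Gamma>\<^esub>" 0] by (simp add: \<Gamma>.M.smult_l_null[simplified] G.M.smult_l_null[simplified])

text \<open>For an inverse letter, the Leibniz rule applied to \<open>h h' = 1\<close> determines
  the differential of \<open>h'\<close>, by the same formula in both calculi.\<close>

lemma \<psi>_d_gen: "\<psi> (d (Q.mo [g])) = \<delta> (Q.mo [g])"
proof -
  have inverse: "\<psi> (d (Q.mo [h'])) = \<delta> (Q.mo [h'])"
    if h: "\<psi> (d (Q.mo [h])) = \<delta> (Q.mo [h])" "word_parity (Word [h]) = 0"
      "Q.mo [h] \<otimes>\<^bsub>A\<^esub> Q.mo [h'] = \<one>\<^bsub>A\<^esub>" "Q.mo [h'] \<otimes>\<^bsub>A\<^esub> Q.mo [h] = \<one>\<^bsub>A\<^esub>" for h h'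
  proof -
    let ?D = "d (Q.mo [h']) " and ?\<Delta> = "\<delta> (Q.mo [h'])"
    have even: "Q.mo [h] \<in> homog A 0" using Q.mo_homog[of "[h]"] h(2) by simp
    have "\<zero>\<^bsub>\<Gamma>\<^esub> = d (Q.mo [h]) \<triangleleft>\<^bsub>\<Gamma>\<^esub> Q.mo [h'] \<oplus>\<^bsub>\<Gamma>\<^esub> Q.mo [h] \<triangleright>\<^bsub>\<Gamma>\<^esub> ?D"
      using \<Gamma>.graded_Leibniz[OF even, of "Q.mo [h']"] \<Gamma>.diff_one h(3)
      by (simp add: \<Gamma>.M.smult_one[simplified] \<Gamma>.lact_closed)
    then have "\<psi> \<zero>\<^bsub>\<Gamma>\<^esub> = \<psi> (d (Q.mo [h]) \<triangleleft>\<^bsub>\<Gamma>\<^esub> Q.mo [h'] \<oplus>\<^bsub>\<Gamma>\<^esub> Q.mo [h] \<triangleright>\<^bsub>\<Gamma>\<^esub> ?D)"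
      by simp
    then have 1: "\<zero>\<^bsub>G\<^esub> = \<delta> (Q.mo [h]) \<triangleleft>\<^bsub>G\<^esub> Q.mo [h'] \<oplus>\<^bsub>G\<^esub> Q.mo [h] \<triangleright>\<^bsub>G\<^esub> \<psi> ?D"
      by (simp add: \<psi>_add \<psi>_zero \<psi>_lact \<psi>_ract \<Gamma>.ract_closed \<Gamma>.lact_closed h(1))
    have 2: "\<zero>\<^bsub>G\<^esub> = \<delta> (Q.mo [h]) \<triangleleft>\<^bsub>G\<^esub> Q.mo [h'] \<oplus>\<^bsub>G\<^esub> Q.mo [h] \<triangleright>\<^bsub>G\<^esub> ?\<Delta>"
      using G.graded_Leibniz[OF even, of "Q.mo [h']"] G.diff_one h(3)
      by (simp add: G.M.smult_one[simplified] G.lact_closed)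
    have "\<delta> (Q.mo [h]) \<triangleleft>\<^bsub>G\<^esub> Q.mo [h'] \<oplus>\<^bsub>G\<^esub> Q.mo [h] \<triangleright>\<^bsub>G\<^esub> \<psi> ?D
        = \<delta> (Q.mo [h]) \<triangleleft>\<^bsub>G\<^esub> Q.mo [h'] \<oplus>\<^bsub>G\<^esub> Q.mo [h] \<triangleright>\<^bsub>G\<^esub> ?\<Delta>"
      by (rule trans[OF 1[symmetric] 2])
    then have "Q.mo [h] \<triangleright>\<^bsub>G\<^esub> \<psi> ?D = Q.mo [h] \<triangleright>\<^bsub>G\<^esub> ?\<Delta>"
      by (simp add: G.lact_closed G.ract_closed)
    then have "(Q.mo [h'] \<otimes>\<^bsub>A\<^esub> Q.mo [h]) \<triangleright>\<^bsub>G\<^esub> \<psi> ?D = (Q.mo [h'] \<otimes>\<^bsub>A\<^esub> Q.mo [h]) \<triangleright>\<^bsub>G\<^esub> ?\<Delta>"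
      by (simp only: G.lact_mult \<psi>_closed \<Gamma>.diff_closed G.diff_closed qsp_class_closed)
    then show ?thesis by (simp add: h(4) G.lact_one)
  qed
  show ?thesis
    using \<psi>_d_basis inverse[OF _ _ mo_inverses(1,2)] inverse[OF _ _ mo_inverses(3,4)]
    by (cases g) simp_all
qed

lemma \<psi>_d:
  assumes "a \<in> carrier A"
  shows "\<psi> (d a) = \<delta> a"
proof -
  obtain p where p: "a = cl p" using assms by (rule qsp_cases)
  have word: "\<psi> (d (Q.mo w)) = \<delta> (Q.mo w)" for w
  proof (induction w)
    case Nil
    then show ?case by (simp add: \<psi>_zero \<Gamma>.diff_one G.diff_one flip: Q.mo_Nil)
  next
    case (Cons g w)
    note \<Gamma>.graded_Leibniz[OF Q.mo_homog[of "[g]"] qsp_class_closed[of q "nc_monom w"]]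
      G.graded_Leibniz[OF Q.mo_homog[of "[g]"] qsp_class_closed[of q "nc_monom w"]]
    moreover have "Q.mo (g # w) = Q.mo [g] \<otimes>\<^bsub>A\<^esub> Q.mo w"
      by (simp add: Q.mo_mult)
    ultimately show ?case
      by (simp only: \<psi>_add \<psi>_smult \<psi>_lact \<psi>_ract \<psi>_d_gen Cons \<Gamma>.diff_closed \<Gamma>.lact_closed \<Gamma>.ract_closed
          \<Gamma>.smult_closed qsp_class_closed UNIV_I complex_ring_simps)
  qed
  note lin = linear_mapD[OF \<Gamma>.diff_linear] linear_mapD[OF G.diff_linear]
  have mono: "\<psi> (d (cl (scal c (nc_monom w)))) = \<delta> (cl (scal c (nc_monom w)))" for c w
    by (simp only: qsp_smult[symmetric] lin qsp_class_closed \<psi>_smult word)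
  show ?thesis
    unfolding p
  proof (induction p rule: ncpoly_induct)
    case zero
    then show ?case using mono[of 0 "[]"] by simp
  next
    case (add f g)
    then show ?case
      by (simp only: qsp_add[symmetric] lin qsp_class_closed \<psi>_add)
  qed (rule mono)
qed

text \<open>The map respects the right action, so it keeps right coordinates; and both modules are
  free on the right.\<close>

lemma \<psi>_bij: "bij_betw \<psi> (carrier \<Gamma>) (carrier G)"
proof -
  let ?c = "\<lambda>(u, v, w). d (Q.mo [GX]) \<triangleleft>\<^bsub>\<Gamma>\<^esub> u \<oplus>\<^bsub>\<Gamma>\<^esub> d (Q.mo [GY]) \<triangleleft>\<^bsub>\<Gamma>\<^esub> v \<oplus>\<^bsub>\<Gamma>\<^esub> d (Q.mo [GTheta]) \<triangleleft>\<^bsub>\<Gamma>\<^esub> w"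
  let ?k = "\<lambda>(u, v, w). dx \<triangleleft>\<^bsub>G\<^esub> u \<oplus>\<^bsub>G\<^esub> dy \<triangleleft>\<^bsub>G\<^esub> v \<oplus>\<^bsub>G\<^esub> dt \<triangleleft>\<^bsub>G\<^esub> w"
  let ?AAA = "carrier A \<times> carrier A \<times> carrier A"
  have c: "\<forall>\<omega>\<in>carrier \<Gamma>. \<exists>!p. p \<in> ?AAA \<and> \<omega> = ?c p"
    using \<Gamma>_free_right unfolding qsp_differentials_def \<Gamma>.free_right_basis_3 qsp_gen_def
    by (elim conjE)
  have k: "\<forall>\<omega>\<in>carrier G. \<exists>!p. p \<in> ?AAA \<and> \<omega> = ?k p"
    using basis unfolding qsp_differentials_def G.free_right_basis_3 qsp_gen_def
    by (elim conjE)
  have map: "?c p \<in> carrier \<Gamma> \<and> \<psi> (?c p) = ?k p" if "p \<in> ?AAA" for p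
  proof -
    obtain u v w where "p = (u, v, w)" by (cases p)
    with that show ?thesis
      by (simp add: \<psi>_add \<psi>_ract \<Gamma>.ract_closed \<psi>_d)
  qed
  show ?thesis
  proof (rule bij_betwI')
    fix \<omega> \<omega>' assume \<omega>: "\<omega> \<in> carrier \<Gamma>" "\<omega>' \<in> carrier \<Gamma>"
    obtain p where p: "p \<in> ?AAA \<and> \<omega> = ?c p"
      using ex1_implies_ex[OF bspec[OF c \<omega>(1)]] by (rule exE)
    obtain p' where p': "p' \<in> ?AAA \<and> \<omega>' = ?c p'"
      using ex1_implies_ex[OF bspec[OF c \<omega>(2)]] by (rule exE)
    show "(\<psi> \<omega> = \<psi> \<omega>') = (\<omega> = \<omega>')"
    proof
      assume eq: "\<psi> \<omega> = \<psi> \<omega>'"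
      have "\<psi> \<omega> = ?k p" "\<psi> \<omega> = ?k p'"
        using map[OF conjunct1[OF p]] map[OF conjunct1[OF p']] eq
        by (simp_all only: conjunct2[OF p] conjunct2[OF p'])
      then have "p = p'"
        using p p' by (intro ex1_uniqueness[OF bspec[OF k \<psi>_closed[OF \<omega>(1)]]] conjI) (elim conjE, assumption)+
      then show "\<omega> = \<omega>'"
        by (simp only: conjunct2[OF p] conjunct2[OF p'])
    qed simp
  next
    fix \<eta> assume \<eta>: "\<eta> \<in> carrier G"
    obtain p where p: "p \<in> ?AAA \<and> \<eta> = ?k p"
      using ex1_implies_ex[OF bspec[OF k \<eta>]] by (rule exE)
    then show "\<exists>\<omega>\<in>carrier \<Gamma>. \<eta> = \<psi> \<omega>"
      using map[OF conjunct1[OF p]] by (intro bexI[of _ "?c p"]) (simp_all only:)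
  qed simp
qed

lemma \<psi>_homog_sub:
  assumes "\<omega> \<in> homog \<Gamma> i"
  shows "\<psi> \<omega> \<in> homog G i"
proof -
  obtain u1 u2 u3 where u: "\<omega> = (u1, u2, u3)" "u1 \<in> homog A (i + 1)" "u2 \<in> homog A (i + 1)" "u3 \<in> homog A i"
    using assms by (auto simp: \<Gamma>_def)
  have sum: "(i + 1) + (0 + 1) = i" "i + (1 + 1) = i" for i :: bit
    by (cases i; simp)+
  have even: "Q.mo [GX] \<in> homog A 0" "Q.mo [GY] \<in> homog A 0" "Q.mo [GTheta] \<in> homog A 1"
    using Q.mo_homog[of "[GX]"] Q.mo_homog[of "[GY]"] Q.mo_homog[of "[GTheta]"] by simp_all
  show ?thesis
    using G.homog_lact[OF u(2) G.diff_parity[OF even(1)]] G.homog_lact[OF u(3) G.diff_parity[OF even(2)]]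
      G.homog_lact[OF u(4) G.diff_parity[OF even(3)]]
    unfolding sum by (simp add: \<psi>_def u(1) G.M.homog_add)
qed

lemma \<psi>_homog: "\<psi> ` homog \<Gamma> i = homog G i"
proof
  show "\<psi> ` homog \<Gamma> i \<subseteq> homog G i"
    using \<psi>_homog_sub by blast
  show "homog G i \<subseteq> \<psi> ` homog \<Gamma> i"
  proof
    fix \<eta> assume \<eta>: "\<eta> \<in> homog G i"
    then obtain \<omega> where \<omega>: "\<omega> \<in> carrier \<Gamma>" "\<eta> = \<psi> \<omega>"
      using bij_betw_imp_surj_on[OF \<psi>_bij] G.M.homog_closed by blast
    obtain u w where u: "u \<in> homog \<Gamma> i" "w \<in> homog \<Gamma> (i + 1)" "\<omega> = u \<oplus>\<^bsub>\<Gamma>\<^esub> w"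
      by (rule \<Gamma>.M.homog_part_exists[OF \<omega>(1)])
    \<comment> \<open>The preimage may a priori have a part of the other parity; uniqueness of the
      decomposition of \<open>\<eta>\<close> makes the image of that part zero.\<close>
    have "\<eta> \<oplus>\<^bsub>G\<^esub> \<zero>\<^bsub>G\<^esub> = \<psi> u \<oplus>\<^bsub>G\<^esub> \<psi> w"
      using u \<omega> \<Gamma>.M.homog_closed by (simp add: \<psi>_add)
    then have "\<eta> = \<psi> u"
      using G.M.homog_part_unique[OF \<eta> G.M.homog_zero \<psi>_homog_sub[OF u(1)] \<psi>_homog_sub[OF u(2)]] by blast
    then show "\<eta> \<in> \<psi> ` homog \<Gamma> i" using u(1) by blast
  qed
qed

lemma isomorphic: "calculus_isomorphic (qsp q) G \<delta> \<Gamma> d"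
proof (rule calculus_isomorphic_sym[OF \<Gamma>_fodc])
  show "calculus_isomorphic A \<Gamma> d G \<delta>"
    unfolding calculus_isomorphic_def linear_map_def
    using \<psi>_bij \<psi>_closed \<psi>_add \<psi>_smult \<psi>_homog \<psi>_lact \<psi>_ract \<psi>_d
    by (intro exI[of _ \<psi>]) simp
qed

end

section \<open>Non-isomorphism\<close>

text \<open>The one-element index type makes this scalar-valued map an instance of
  \<open>lext\<close>.\<close>

definition counit :: "ncpoly \<Rightarrow> complex" where
  "counit p = Poly_Mapping.lookup (lext (\<lambda>w. if GTheta \<in> set (letters w) then 0 else Poly_Mapping.single () 1) p) ()"

lemma counit_simps:
  "counit 0 = 0" "counit (p + p') = counit p + counit p'" "counit (p - p') = counit p - counit p'"
  "counit (scal c p) = c * counit p"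
  "counit (nc_monom w) = (if GTheta \<in> set w then 0 else 1)"
  by (simp_all add: counit_def lext_simps nc_monom_def lookup_add lookup_minus)

lemma counit_mult: "counit (p * p') = counit p * counit p'"
proof (induction p rule: ncpoly_induct)
  case (monom a u)
  show ?case
  proof (induction p' rule: ncpoly_induct)
    case (monom c w)
    show ?case by (simp add: scal_mult_left scal_mult_right nc_monom_mult counit_simps)
  qed (simp_all add: counit_simps distrib_left)
qed (simp_all add: counit_simps distrib_right)

text \<open>Every relator has counit 0 and the counit is multiplicative. A nonzero counit thus
  certifies that a polynomial lies outside the ideal.\<close>

lemma counit_ideal:
  assumes "p \<in> qsp_ideal q"
  shows "counit p = 0"
proof -
  have one: "counit 1 = 1" using counit_simps(5)[of "[]"] by (simp add: nc_monom_Nil)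
  have "p \<in> {p. counit p = 0}"
    by (rule qsp_ideal_minimal[OF assms])
      (auto simp: counit_simps counit_mult one qsp_relators_def)
  then show ?thesis by simp
qed

text \<open>Comparison with \<open>dx \<cdot> y = s y \<cdot> dx\<close> leaves (1 - s) y dx + (r -
  1) x dy = 0, and the counits of the two coordinates are 1 - s and r - 1.\<close>

lemma (in calc) not_first:
  assumes "\<not> b" "d (qsp_gen q GX) \<triangleleft>\<^bsub>\<Gamma>\<^esub> qsp_gen q GY =
    (qsp_gen q GY \<triangleright>\<^bsub>\<Gamma>\<^esub> d (qsp_gen q GX)) \<oplus>\<^bsub>\<Gamma>\<^esub> ((r - 1) \<odot>\<^bsub>\<Gamma>\<^esub> (qsp_gen q GX \<triangleright>\<^bsub>\<Gamma>\<^esub> d (qsp_gen q GY)))"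
  shows "r = 1 \<and> s = 1"
proof -
  let ?R = "\<lambda>j. nc_monom [GY] * \<gamma> GX IS j + scal (r - 1) (nc_monom [GX] * \<gamma> GY IS j) -
      scal s (nc_monom [GY] * \<gamma> GX IS j)"
  have "d (qsp_gen q GX) \<triangleleft>\<^bsub>\<Gamma>\<^esub> qsp_gen q GY = s \<odot>\<^bsub>\<Gamma>\<^esub> (qsp_gen q GY \<triangleright>\<^bsub>\<Gamma>\<^esub> d (qsp_gen q GX))"
    using second_relations_hold[OF assms(1)] by (simp add: second_relations_def Let_def)
  with assms(2) have "?R j \<in> qsp_ideal q" if "j \<noteq> IS" for j
    using that by (simp add: qsp_gen_def d_gen \<Gamma>_simps tri_eq_iff)
  from counit_ideal[OF this[of IX]] counit_ideal[OF this[of IY]] show ?thesis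
    by (simp add: counit_simps counit_mult calc_gen_def)
qed

text \<open>At \<open>r = s = 1\<close> the two systems of relations coincide, so distinctness is
  claimed away from that point. That a system determines its calculus is expressed as uniqueness up
  to isomorphism.\<close>

theorem theorem4p6:
  fixes q r s :: complex
  assumes "q \<noteq> 0" and "r \<noteq> 0" and "s \<noteq> 0"
  shows "\<exists>(\<Gamma>\<^sub>1 :: (ncpoly set, ncpoly set \<times> ncpoly set \<times> ncpoly set) superbimodule) d\<^sub>1
          (\<Gamma>\<^sub>2 :: (ncpoly set, ncpoly set \<times> ncpoly set \<times> ncpoly set) superbimodule) d\<^sub>2.
      super_fodc (qsp q) \<Gamma>\<^sub>1 d\<^sub>1 \<and>
      right_covariant (qsp q) (qsp_comult q) \<Gamma>\<^sub>1 d\<^sub>1 \<and>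
      free_left_basis (qsp q) \<Gamma>\<^sub>1 (qsp_differentials q d\<^sub>1) \<and>
      free_right_basis (qsp q) \<Gamma>\<^sub>1 (qsp_differentials q d\<^sub>1) \<and>
      first_relations q r s \<Gamma>\<^sub>1 d\<^sub>1 \<and>
      super_fodc (qsp q) \<Gamma>\<^sub>2 d\<^sub>2 \<and>
      right_covariant (qsp q) (qsp_comult q) \<Gamma>\<^sub>2 d\<^sub>2 \<and>
      free_left_basis (qsp q) \<Gamma>\<^sub>2 (qsp_differentials q d\<^sub>2) \<and>
      free_right_basis (qsp q) \<Gamma>\<^sub>2 (qsp_differentials q d\<^sub>2) \<and>
      second_relations q r s \<Gamma>\<^sub>2 d\<^sub>2 \<and>
      ((r, s) \<noteq> (1, 1) \<longrightarrow> \<not> calculus_isomorphic (qsp q) \<Gamma>\<^sub>1 d\<^sub>1 \<Gamma>\<^sub>2 d\<^sub>2) \<and>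
      (\<forall>(\<Gamma> :: (ncpoly set, 'g) superbimodule) d.
         super_fodc (qsp q) \<Gamma> d \<and> free_right_basis (qsp q) \<Gamma> (qsp_differentials q d) \<longrightarrow>
           (first_relations q r s \<Gamma> d \<longrightarrow> calculus_isomorphic (qsp q) \<Gamma> d \<Gamma>\<^sub>1 d\<^sub>1) \<and>
           (second_relations q r s \<Gamma> d \<longrightarrow> calculus_isomorphic (qsp q) \<Gamma> d \<Gamma>\<^sub>2 d\<^sub>2))"
proof -
  have calc: "calc q r s"
    using assms by (rule calc.intro)
  let ?\<Gamma> = "\<lambda>b. calc.\<Gamma> b q r s" and ?d = "\<lambda>b. calc.d b q r s"
  have iso: "calculus_isomorphic (qsp q) G \<delta> (?\<Gamma> b) (?d b)"
    if "super_fodc (qsp q) G \<delta>" "free_right_basis (qsp q) G (qsp_differentials q \<delta>)"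
      "if b then first_relations q r s G \<delta> else second_relations q r s G \<delta>"
    for G :: "(ncpoly set, 'g) superbimodule" and \<delta> b
    using that calc
    by (intro calc_comparison.isomorphic calc_comparison.intro calc_comparison_axioms.intro)
  have noniso: "\<not> calculus_isomorphic (qsp q) (?\<Gamma> True) (?d True) (?\<Gamma> False) (?d False)"
    if "(r, s) \<noteq> (1, 1)"
  proof
    assume "calculus_isomorphic (qsp q) (?\<Gamma> True) (?d True) (?\<Gamma> False) (?d False)"
    then obtain f where lin: "linear_map (?\<Gamma> True) (?\<Gamma> False) f"
      and act: "\<And>a \<omega>. a \<in> carrier (qsp q) \<Longrightarrow> \<omega> \<in> carrier (?\<Gamma> True) \<Longrightarrow>
        f (a \<triangleright>\<^bsub>?\<Gamma> True\<^esub> \<omega>) = a \<triangleright>\<^bsub>?\<Gamma> False\<^esub> f \<omega> \<and> f (\<omega> \<triangleleft>\<^bsub>?\<Gamma> True\<^esub> a) = f \<omega> \<triangleleft>\<^bsub>?\<Gamma> False\<^esub> a"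
      and d: "\<And>a. a \<in> carrier (qsp q) \<Longrightarrow> f (?d True a) = ?d False a"
      unfolding calculus_isomorphic_def by blast
    interpret C: super_fodc "qsp q" "?\<Gamma> True" "?d True"
      by (rule calc.\<Gamma>_fodc[OF calc])
    have gen: "qsp_gen q g \<in> carrier (qsp q)" for g
      by (simp add: qsp_gen_def)
    have "?d True (qsp_gen q GX) \<triangleleft>\<^bsub>?\<Gamma> True\<^esub> qsp_gen q GY =
        (qsp_gen q GY \<triangleright>\<^bsub>?\<Gamma> True\<^esub> ?d True (qsp_gen q GX))
        \<oplus>\<^bsub>?\<Gamma> True\<^esub> ((r - 1) \<odot>\<^bsub>?\<Gamma> True\<^esub> (qsp_gen q GX \<triangleright>\<^bsub>?\<Gamma> True\<^esub> ?d True (qsp_gen q GY)))"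
      using calc.first_relations_hold[OF calc, of True] by (simp add: first_relations_def Let_def)
    \<comment> \<open>An isomorphism would carry the first relation for \<open>dx \<cdot> y\<close>
      over to the second calculus, where \<open>calc.not_first\<close> allows it only for
      \<open>r = s = 1\<close>.\<close>
    then have "f (?d True (qsp_gen q GX) \<triangleleft>\<^bsub>?\<Gamma> True\<^esub> qsp_gen q GY) =
        f ((qsp_gen q GY \<triangleright>\<^bsub>?\<Gamma> True\<^esub> ?d True (qsp_gen q GX))
        \<oplus>\<^bsub>?\<Gamma> True\<^esub> ((r - 1) \<odot>\<^bsub>?\<Gamma> True\<^esub> (qsp_gen q GX \<triangleright>\<^bsub>?\<Gamma> True\<^esub> ?d True (qsp_gen q GY))))"
      by (rule arg_cong)
    then have "r = 1 \<and> s = 1"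
      by (intro calc.not_first[OF calc, of False])
        (simp_all add: linear_mapD[OF lin] act d gen C.lact_closed)
    with that show False by simp
  qed
  show ?thesis
    by (rule exI[of _ "?\<Gamma> True"], rule exI[of _ "?d True"], rule exI[of _ "?\<Gamma> False"], rule exI[of _ "?d False"])
      (use calc.\<Gamma>_fodc[OF calc] calc.\<Gamma>_right_covariant[OF calc] calc.\<Gamma>_free_left[OF calc]
        calc.\<Gamma>_free_right[OF calc] calc.first_relations_hold[OF calc, of True] calc.second_relations_hold[OF calc, of False]
        iso[of _ _ True] iso[of _ _ False] noniso in simp)
qed

end
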